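(* Let $\Phi\colon L_M\to\mathbb{R}$ be a map. Then $\Phi$ is a monotone additive statistic on $L_M$ if and only if there exists a Borel probability measure $\mu$ with compact support in $\mathbb{R}$ such that for every $X\in L_M$ $$\Phi(X)=\int K_a(X)\,\mathrm{d}\mu(a).$$ Moreover, in this case the measure $\mu$ is unique.
   Context: Random variables are real-valued and defined on a fixed nonatomic probability space $(\Omega,\mathcal{F},\mathbb{P})$; each $c\in\mathbb{R}$ is identified with the constant random variable $c$. For $a\in\mathbb{R}\setminus\{0\}$, $K_a(X)=\frac1a\log\mathbb{E}[e^{aX}]$, and $K_0(X)=\mathbb{E}[X]$. $L_M$ is the set of random variables $X$ for which $K_a(X)$ is finite for all $a\in\mathbb{R}$. $X\ge_1 Y$ denotes first-order stochastic dominance: $\mathbb{P}[X\le t]\le\mathbb{P}[Y\le t]$ for all $t\in\mathbb{R}$. A map $\Phi\colon L_M\to\mathbb{R}$ is a statistic if (i) $\Phi(X)=\Phi(Y)$ whenever $X,Y\in L_M$ have the same distribution and (ii) $\Phi(c)=c$ for every $c\in\mathbb{R}$. It is additive if $\Phi(X+Y)=\Phi(X)+\Phi(Y)$ whenever $X,Y\in L_M$ are independent. It is monotone if $X\ge_1 Y$ implies $\Phi(X)\ge\Phi(Y)$. A monotone additive statistic is a statistic that is monotone and additive. *)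

theory Defs
  imports "HOL-Probability.Probability"
begin

definition nonatomic :: "'a measure \<Rightarrow> bool" where
  "nonatomic M \<longleftrightarrow>
     (\<forall>A\<in>sets M. emeasure M A > 0 \<longrightarrow>
        (\<exists>B\<in>sets M. B \<subseteq> A \<and> 0 < emeasure M B \<and> emeasure M B < emeasure M A))"

definition K :: "'a measure \<Rightarrow> real \<Rightarrow> ('a \<Rightarrow> real) \<Rightarrow> real" where
  "K M a X = (if a = 0 then (\<integral>\<omega>. X \<omega> \<partial>M) else ln (\<integral>\<omega>. exp (a * X \<omega>) \<partial>M) / a)"

(* Finiteness of K_a(X) is integrability of the function under the expectation; on a
   probability space the expectation of an exponential is positive, so its logarithm
   is finite as soon as the expectation is. *)
definition L_M :: "'a measure \<Rightarrow> ('a \<Rightarrow> real) set" where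
  "L_M M = {X \<in> borel_measurable M.
     integrable M X \<and> (\<forall>a. a \<noteq> 0 \<longrightarrow> integrable M (\<lambda>\<omega>. exp (a * X \<omega>)))}"

definition fosd :: "'a measure \<Rightarrow> ('a \<Rightarrow> real) \<Rightarrow> ('a \<Rightarrow> real) \<Rightarrow> bool" where
  "fosd M X Y \<longleftrightarrow>
     (\<forall>t. measure M {\<omega> \<in> space M. X \<omega> \<le> t} \<le> measure M {\<omega> \<in> space M. Y \<omega> \<le> t})"

(* A map on L_M is a total HOL function of which only the values on L_M matter. *)

definition statistic :: "'a measure \<Rightarrow> (('a \<Rightarrow> real) \<Rightarrow> real) \<Rightarrow> bool" where
  "statistic M \<Phi> \<longleftrightarrow>
     (\<forall>X\<in>L_M M. \<forall>Y\<in>L_M M. distr M borel X = distr M borel Y \<longrightarrow> \<Phi> X = \<Phi> Y) \<and>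
     (\<forall>c. \<Phi> (\<lambda>_. c) = c)"

definition additive_map :: "'a measure \<Rightarrow> (('a \<Rightarrow> real) \<Rightarrow> real) \<Rightarrow> bool" where
  "additive_map M \<Phi> \<longleftrightarrow>
     (\<forall>X\<in>L_M M. \<forall>Y\<in>L_M M. prob_space.indep_var M borel X borel Y \<longrightarrow>
        \<Phi> (\<lambda>\<omega>. X \<omega> + Y \<omega>) = \<Phi> X + \<Phi> Y)"

definition monotone_map :: "'a measure \<Rightarrow> (('a \<Rightarrow> real) \<Rightarrow> real) \<Rightarrow> bool" where
  "monotone_map M \<Phi> \<longleftrightarrow> (\<forall>X\<in>L_M M. \<forall>Y\<in>L_M M. fosd M X Y \<longrightarrow> \<Phi> X \<ge> \<Phi> Y)"

definition monotone_additive_statistic :: "'a measure \<Rightarrow> (('a \<Rightarrow> real) \<Rightarrow> real) \<Rightarrow> bool" where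
  "monotone_additive_statistic M \<Phi> \<longleftrightarrow> statistic M \<Phi> \<and> monotone_map M \<Phi> \<and> additive_map M \<Phi>"

definition msupport :: "'b::topological_space measure \<Rightarrow> 'b set" where
  "msupport \<mu> = {x. \<forall>U. open U \<and> x \<in> U \<longrightarrow> emeasure \<mu> U > 0}"

definition compactly_supported_prob :: "real measure \<Rightarrow> bool" where
  "compactly_supported_prob \<mu> \<longleftrightarrow>
     sets \<mu> = sets borel \<and> prob_space \<mu> \<and> compact (msupport \<mu>)"

(* For X in L_M the map a \<mapsto> K M a X is continuous, hence integrable with respect to a
   compactly supported probability measure, so the default value of the integral of a
   non-integrable function plays no role. *)
definition represents :: "'a measure \<Rightarrow> real measure \<Rightarrow> (('a \<Rightarrow> real) \<Rightarrow> real) \<Rightarrow> bool" where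
  "represents M \<mu> \<Phi> \<longleftrightarrow> (\<forall>X\<in>L_M M. \<Phi> X = (\<integral>a. K M a X \<partial>\<mu>))"

end

(*
A statistic depends on laws only, so it is a functional phi on the laws with all exponential moments,
additive under convolution.

Comparison: if K_a(X) > K_a(Y) for all a, including the essential extrema, and X, Y are bounded, then
X + Z dominates Y + Z for a centred Gaussian Z of large variance, hence phi(X) >= phi(Y).

Compactness: phi cannot stay away from 0 on ever rarer nonnegative laws, since infinitely many of them
combine to a law in the domain. So the two-point laws with jump r of probability exp(- n r) have
phi at most 1 for a suitable n and all large r, although their K_a grows linearly in r for a > n.
Adding them to large convolution powers yields an A such that the values of K_a on [-A, A] alone decide
the comparison.

Representation: phi is thus a positive functional of the function a |-> K_a on [-A, A]. The differences
(K_a(X) - K_a(Y)) / m are dense in C[-A, A], because rare jumps give the functions (exp(a x) - 1) / a,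
whose difference quotients in x tend to exp(a x); the Riesz theorem provides the measure, and the
same density gives uniqueness. Unbounded X is sandwiched between truncations and rare tails.
*)

theory Submission
  imports Defs
begin

section \<open>Cumulants of laws with exponential moments\<close>

text \<open>No continuity of \<phi> is assumed, and on bounded variables the essential maximum and
  minimum, the limits of K_a at a = \<infinity> and a = -\<infinity>, are monotone and additive as
  well. It is the size of L_M that excludes them, and the exclusion is quantitative: the jump r may
  be chosen after the convolution power k, so large that the jump law outweighs the k-fold cumulants
  at every a beyond A, while its value under \<phi> stays below 1. Division by k then removes this
  cost. The same jumps separate the essential extrema of the two sides, as the comparison by
  Gaussian noise demands. Reflection X \<mapsto> -X turns all statements for positive a into those
  for negative a. Nonatomicity supplies, for any two laws, independent variables that have these
  laws; this is what makes \<phi> additive under convolution. Convolution powers multiply cumulants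
  by integers only, so the functional on C[-A, A] is at first homogeneous over the rationals;
  positivity bounds it, and boundedness gives linearity over the reals.\<close>

definition expint :: "real \<Rightarrow> real \<Rightarrow> real" where
  "expint a x = (if a = 0 then x else (exp (a * x) - 1) / a)"

text \<open>\<open>expint a x\<close> is the integral of exp (a s) over s from 0 to x, and
  \<open>lnq\<close> extends ln (1 + z) / z by its limit at 0. As E[exp (a X)] = 1 + a m with m =
  E[\<open>expint a X\<close>], K_a equals m times \<open>lnq\<close> at a m, a formula that is
  continuous across a = 0.\<close>

definition lnq :: "real \<Rightarrow> real" where
  "lnq z = (if z = 0 then 1 else ln (1 + z) / z)"

lemma expint_zero [simp]: "expint 0 x = x"
  by (simp add: expint_def)

lemma expint_DERIV: "(expint a has_real_derivative exp (a * x)) (at x)"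
proof (cases "a = 0")
  case True
  then have "expint a = (\<lambda>x. x)" by (auto simp: expint_def)
  with True show ?thesis by simp
next
  case False
  then have "expint a = (\<lambda>x. (exp (a * x) - 1) / a)" by (auto simp: expint_def)
  with False show ?thesis
    by (auto intro!: derivative_eq_intros)
qed

lemma continuous_on_expint: "continuous_on S (expint a)"
  by (meson DERIV_continuous_on DERIV_subset expint_DERIV subset_UNIV)

lemma borel_measurable_expint [measurable]: "expint a \<in> borel_measurable borel"
  by (rule borel_measurable_continuous_onI) (rule continuous_on_expint)

lemma expint_strict_mono: "x < y \<Longrightarrow> expint a x < expint a y"
  by (rule DERIV_pos_imp_increasing) (auto intro!: exI expint_DERIV)

lemma expint_mono: "x \<le> y \<Longrightarrow> expint a x \<le> expint a y"
  using expint_strict_mono[of x y a] by (cases "x = y") auto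

lemma one_plus_expint: "1 + a * expint a x = exp (a * x)"
  by (simp add: expint_def)

lemma isCont_expint_param: "isCont (\<lambda>a. expint a x) a"
proof (cases "a = 0")
  case True
  have "((\<lambda>a. exp (a * x)) has_real_derivative x) (at 0)"
    by (auto intro!: derivative_eq_intros)
  then have "((\<lambda>a. (exp (a * x) - exp (0 * x)) / (a - 0)) \<longlongrightarrow> x) (at 0)"
    by (simp add: has_field_derivative_iff)
  then have "((\<lambda>a. expint a x) \<longlongrightarrow> x) (at 0)"
    by (rule Lim_transform_eventually) (auto simp: eventually_at_filter expint_def)
  with True show ?thesis by (simp add: isCont_def)
next
  case False
  have "isCont (\<lambda>a. (exp (a * x) - 1) / a) a"
    using False by (intro continuous_intros) auto
  moreover have "\<forall>\<^sub>F b in nhds a. expint b x = (exp (b * x) - 1) / b"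
    using False by (auto simp: expint_def eventually_nhds intro!: exI[of _ "- {0}"])
  ultimately show ?thesis
    using isCont_cong by fastforce
qed

text \<open>The derivative exp (a z) gives the bound |x| exp (A |x|), and the extra 1 in the
  exponent absorbs the factor |x|. Being uniform over |a| \<le> A, the bound serves as a dominating
  function when a varies.\<close>

lemma abs_expint_le: "\<bar>a\<bar> \<le> A \<Longrightarrow> \<bar>expint a x\<bar> \<le> exp ((A + 1) * \<bar>x\<bar>)"
proof -
  assume a: "\<bar>a\<bar> \<le> A"
  have "\<bar>expint a x - expint a 0\<bar> \<le> exp (A * \<bar>x\<bar>) * \<bar>x - 0\<bar>"
  proof -
    have "norm (expint a x - expint a 0) \<le> exp (A * \<bar>x\<bar>) * norm (x - 0)"
    proof (rule field_differentiable_bound[of "cball 0 \<bar>x\<bar>"])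
      fix z :: real assume "z \<in> cball 0 \<bar>x\<bar>"
      then have "\<bar>z\<bar> \<le> \<bar>x\<bar>" by (simp add: dist_real_def)
      then have "\<bar>a * z\<bar> \<le> A * \<bar>x\<bar>" using a by (simp add: abs_mult mult_mono)
      then show "norm (exp (a * z)) \<le> exp (A * \<bar>x\<bar>)" by simp
      show "(expint a has_field_derivative exp (a * z)) (at z within cball 0 \<bar>x\<bar>)"
        by (rule has_field_derivative_at_within[OF expint_DERIV])
    qed auto
    then show ?thesis by simp
  qed
  moreover have "expint a 0 = 0" by (simp add: expint_def)
  moreover have "exp (A * \<bar>x\<bar>) * \<bar>x\<bar> \<le> exp (A * \<bar>x\<bar>) * exp \<bar>x\<bar>"
  proof (rule mult_left_mono)
    show "\<bar>x\<bar> \<le> exp \<bar>x\<bar>" using exp_ge_add_one_self[of "\<bar>x\<bar>"] by linarith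
  qed simp
  moreover have "exp ((A + 1) * \<bar>x\<bar>) = exp (A * \<bar>x\<bar>) * exp \<bar>x\<bar>"
    by (simp only: distrib_right exp_add mult_1_left)
  ultimately show ?thesis unfolding diff_0_right by linarith
qed

lemma isCont_lnq: "z > -1 \<Longrightarrow> isCont lnq z"
proof (cases "z = 0")
  case True
  have "((\<lambda>z. ln (1 + z)) has_real_derivative 1) (at 0)"
    by (auto intro!: derivative_eq_intros)
  then have "((\<lambda>z. (ln (1 + z) - ln (1 + 0)) / (z - 0)) \<longlongrightarrow> 1) (at (0::real))"
    by (simp add: has_field_derivative_iff)
  then have "(lnq \<longlongrightarrow> 1) (at 0)"
    by (rule Lim_transform_eventually) (auto simp: eventually_at_filter lnq_def)
  with True show ?thesis by (simp add: isCont_def lnq_def)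
next
  case False
  assume "z > -1"
  then have "isCont (\<lambda>z. ln (1 + z) / z) z"
    using False by (intro continuous_intros) auto
  moreover have "\<forall>\<^sub>F b in nhds z. lnq b = ln (1 + b) / b"
    using False by (auto simp: lnq_def eventually_nhds intro!: exI[of _ "- {0}"])
  ultimately show ?thesis
    using isCont_cong by fastforce
qed

definition exp_law :: "real measure \<Rightarrow> bool" where
  "exp_law N \<longleftrightarrow> prob_space N \<and> sets N = sets borel \<and> (\<forall>a. integrable N (\<lambda>x. exp (a * x)))"

definition mexp :: "real measure \<Rightarrow> real \<Rightarrow> real" where
  "mexp N a = (\<integral>x. expint a x \<partial>N)"

definition KL :: "real measure \<Rightarrow> real \<Rightarrow> real" where
  "KL N a = K N a (\<lambda>x. x)"

lemma exp_law_real_distr: "exp_law N \<Longrightarrow> real_distribution N"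
  by (auto simp: exp_law_def real_distribution_def real_distribution_axioms_def dest: sets_eq_imp_space_eq)

lemma exp_lawD:
  assumes "exp_law N"
  shows "prob_space N" "sets N = sets borel" "space N = UNIV" "integrable N (\<lambda>x. exp (a * x))"
    "finite_measure N"
  using assms by (auto simp: exp_law_def prob_space_def dest: sets_eq_imp_space_eq)

lemma exp_law_integrable_exp_abs:
  assumes "exp_law N"
  shows "integrable N (\<lambda>x. exp (a * \<bar>x\<bar>))"
proof (rule Bochner_Integration.integrable_bound)
  show "integrable N (\<lambda>x. exp (a * x) + exp ((- a) * x))"
    by (intro Bochner_Integration.integrable_add exp_lawD(4)[OF assms])
  show "(\<lambda>x. exp (a * \<bar>x\<bar>)) \<in> borel_measurable N"
    using exp_lawD(2)[OF assms] by (simp cong: measurable_cong_sets)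
  show "AE x in N. norm (exp (a * \<bar>x\<bar>)) \<le> norm (exp (a * x) + exp ((- a) * x))"
  proof (rule AE_I2)
    fix x
    have "exp (a * \<bar>x\<bar>) \<le> exp (a * x) + exp ((- a) * x)"
      by (cases "x \<ge> 0") simp_all
    then show "norm (exp (a * \<bar>x\<bar>)) \<le> norm (exp (a * x) + exp ((- a) * x))" by simp
  qed
qed

lemma exp_law_integrable_expint:
  assumes "exp_law N"
  shows "integrable N (expint a)"
proof (rule Bochner_Integration.integrable_bound)
  show "integrable N (\<lambda>x. exp ((\<bar>a\<bar> + 1) * \<bar>x\<bar>))"
    by (rule exp_law_integrable_exp_abs[OF assms])
  show "expint a \<in> borel_measurable N"
    using exp_lawD(2)[OF assms] by (simp cong: measurable_cong_sets)
  show "AE x in N. norm (expint a x) \<le> norm (exp ((\<bar>a\<bar> + 1) * \<bar>x\<bar>))"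
    using abs_expint_le[of a "\<bar>a\<bar>"] by auto
qed

lemma exp_law_integrable_id: "exp_law N \<Longrightarrow> integrable N (\<lambda>x. x)"
  using exp_law_integrable_expint[of N 0] by (simp cong: Bochner_Integration.integrable_cong)

lemma one_plus_mexp:
  assumes "exp_law N"
  shows "1 + a * mexp N a = (\<integral>x. exp (a * x) \<partial>N)"
proof -
  interpret prob_space N by (rule exp_lawD[OF assms])
  have "(\<integral>x. exp (a * x) \<partial>N) = (\<integral>x. 1 + a * expint a x \<partial>N)"
    by (simp add: one_plus_expint)
  also have "\<dots> = 1 + a * mexp N a"
    using exp_law_integrable_expint[OF assms, of a] by (simp add: mexp_def prob_space)
  finally show ?thesis by simp
qed

lemma exp_law_expectation_exp_pos:
  assumes "exp_law N"
  shows "(\<integral>x. exp (a * x) \<partial>N) > 0"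
proof -
  interpret prob_space N by (rule exp_lawD[OF assms])
  have "(\<integral>x. exp (a * x) \<partial>N) \<ge> 0" by (rule integral_nonneg_AE) auto
  moreover have "(\<integral>x. exp (a * x) \<partial>N) \<noteq> 0"
    using exp_lawD(4)[OF assms, of a] by (subst integral_nonneg_eq_0_iff_AE) auto
  ultimately show ?thesis by linarith
qed

lemma KL_eq:
  assumes "exp_law N"
  shows "KL N a = mexp N a * lnq (a * mexp N a)"
  using one_plus_mexp[OF assms, of a]
  by (auto simp: KL_def K_def lnq_def mexp_def)

text \<open>Both sides are increasing functions of E[exp (a X)] for a > 0 and decreasing ones for a
  < 0. Comparisons of cumulants thus reduce to \<open>mexp\<close>, which is linear in the
  law.\<close>

lemma KL_less_iff:
  assumes "exp_law N" "exp_law N'"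
  shows "KL N a < KL N' a \<longleftrightarrow> mexp N a < mexp N' a"
proof (cases "a = 0")
  case True
  then show ?thesis by (simp add: KL_def K_def mexp_def)
next
  case False
  let ?E = "\<lambda>N. \<integral>x. exp (a * x) \<partial>N"
  have *: "?E N > 0" "?E N' > 0" by (simp_all add: exp_law_expectation_exp_pos assms)
  have "KL N a < KL N' a \<longleftrightarrow> (if a > 0 then ?E N < ?E N' else ?E N' < ?E N)"
    using False * by (simp add: KL_def K_def divide_less_cancel)
  also have "\<dots> \<longleftrightarrow> mexp N a < mexp N' a"
    using False one_plus_mexp[OF assms(1), of a] one_plus_mexp[OF assms(2), of a]
    by (smt (verit) mult_less_cancel_left_disj)
  finally show ?thesis .
qed

lemma KL_le_iff:
  assumes "exp_law N" "exp_law N'"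
  shows "KL N a \<le> KL N' a \<longleftrightarrow> mexp N a \<le> mexp N' a"
  using KL_less_iff[OF assms(2,1), of a] by linarith

lemma isCont_mexp:
  assumes "exp_law N"
  shows "isCont (mexp N) a"
proof -
  have "(\<lambda>n. mexp N (u n)) \<longlonglongrightarrow> mexp N a" if u: "u \<longlonglongrightarrow> a" for u
    unfolding mexp_def
  proof -
    obtain B where "\<forall>n. norm (u n) \<le> B"
      using u by (meson Bseq_def convergentI convergent_imp_Bseq)
    then have B: "\<bar>u n\<bar> \<le> B" for n by simp
    show "(\<lambda>n. integral\<^sup>L N (expint (u n))) \<longlonglongrightarrow> integral\<^sup>L N (expint a)"
    proof (rule integral_dominated_convergence[where w = "\<lambda>x. exp ((B + 1) * \<bar>x\<bar>)"])
      show "integrable N (\<lambda>x. exp ((B + 1) * \<bar>x\<bar>))"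
        by (rule exp_law_integrable_exp_abs[OF assms])
      show "AE x in N. (\<lambda>i. expint (u i) x) \<longlonglongrightarrow> expint a x"
        using isCont_tendsto_compose[OF isCont_expint_param u] by simp
      show "AE x in N. norm (expint (u i) x) \<le> exp ((B + 1) * \<bar>x\<bar>)" for i
        using abs_expint_le[OF B] by auto
    qed (use exp_lawD(2)[OF assms] in \<open>simp_all cong: measurable_cong_sets\<close>)
  qed
  then show ?thesis
    by (auto simp: isCont_def LIMSEQ_SEQ_conv[symmetric])
qed

lemma isCont_KL:
  assumes "exp_law N"
  shows "isCont (KL N) a"
proof -
  have "a * mexp N a > -1" for a
    using one_plus_mexp[OF assms, of a] exp_law_expectation_exp_pos[OF assms, of a] by linarith
  then have "isCont (\<lambda>a. mexp N a * lnq (a * mexp N a)) a"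
    using isCont_mexp[OF assms, of a] isCont_o2[OF continuous_mult[OF continuous_ident isCont_mexp[OF assms]] isCont_lnq]
    by (intro isCont_mult) auto
  moreover have "KL N = (\<lambda>a. mexp N a * lnq (a * mexp N a))"
    using KL_eq[OF assms] by auto
  ultimately show ?thesis by simp
qed

text \<open>For \<open>a > 0\<close> this is Jensen below and \<open>ln z \<le> z - 1\<close> above; for \<open>a < 0\<close> the two swap.\<close>

lemma abs_KL_le:
  assumes "exp_law N" and a: "\<bar>a\<bar> \<le> A"
  shows "\<bar>KL N a\<bar> \<le> (\<integral>x. exp ((A + 1) * \<bar>x\<bar>) \<partial>N)"
proof -
  interpret prob_space N by (rule exp_lawD[OF assms(1)])
  let ?C = "\<integral>x. exp ((A + 1) * \<bar>x\<bar>) \<partial>N" and ?E = "\<integral>x. exp (a * x) \<partial>N"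
  have m: "\<bar>mexp N b\<bar> \<le> ?C" if "\<bar>b\<bar> \<le> A" for b
    unfolding mexp_def
    by (rule order_trans[OF integral_abs_bound integral_mono])
       (use that exp_law_integrable_exp_abs exp_law_integrable_expint abs_expint_le assms in auto)
  have m0: "\<bar>mexp N 0\<bar> \<le> ?C" using m[of 0] a by simp
  have ma: "\<bar>mexp N a\<bar> \<le> ?C" using m a by simp
  show ?thesis
  proof (cases "a = 0")
    case True
    with m0 show ?thesis by (simp add: KL_def K_def mexp_def)
  next
    case False
    have E: "?E > 0" by (rule exp_law_expectation_exp_pos[OF assms(1)])
    have KL: "KL N a = ln ?E / a" using False by (simp add: KL_def K_def)
    have 1: "ln ?E \<le> a * mexp N a"
      using ln_le_minus_one[OF E] one_plus_mexp[OF assms(1), of a] by simp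
    have "exp (a * mexp N 0) \<le> ?E"
    proof -
      let ?c = "mexp N 0"
      \<comment> \<open>The tangent of exp (a x) at the mean, whose linear part integrates to
        0.\<close>
      have "exp (a * ?c) = (\<integral>x. exp (a * ?c) * (1 + a * (x - ?c)) \<partial>N)"
        using exp_law_integrable_id[OF assms(1)] by (simp add: prob_space mexp_def)
      also have "\<dots> \<le> ?E"
      proof (rule integral_mono)
        fix x
        have "1 + a * (x - ?c) \<le> exp (a * (x - ?c))" by (rule exp_ge_add_one_self)
        then have "exp (a * ?c) * (1 + a * (x - ?c)) \<le> exp (a * ?c) * exp (a * (x - ?c))" by simp
        also have "\<dots> = exp (a * x)" by (simp add: exp_add[symmetric] algebra_simps)
        finally show "exp (a * ?c) * (1 + a * (x - ?c)) \<le> exp (a * x)" .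
      qed (use exp_law_integrable_id[OF assms(1)] exp_lawD(4)[OF assms(1)] in auto)
      finally show ?thesis .
    qed
    then have 2: "a * mexp N 0 \<le> ln ?E" using E by (simp add: ln_ge_iff)
    show ?thesis
    proof (cases "a > 0")
      case True
      then have "ln ?E / a \<le> mexp N a" "mexp N 0 \<le> ln ?E / a"
        using 1 2 by (simp_all add: divide_le_eq le_divide_eq mult.commute[of _ a])
      with ma m0 KL show ?thesis by linarith
    next
      case neg: False
      then have "ln ?E / a \<ge> mexp N a" "mexp N 0 \<ge> ln ?E / a"
        using 1 2 False by (simp_all add: divide_le_eq le_divide_eq mult.commute[of _ a])
      with ma m0 KL show ?thesis by linarith
    qed
  qed
qed

section \<open>Quantile coupling and convolution\<close>

definition unif :: "real measure" where
  "unif = restrict_space lborel {0<..<1}"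

text \<open>The pseudoinverse of the distribution function in the form used by
  \<open>cdf_distribution\<close>, whose facts on measurability and on the pushforward therefore
  apply after unfolding.\<close>

definition quantile :: "real measure \<Rightarrow> real \<Rightarrow> real" where
  "quantile N u = Inf {x. u \<le> cdf N x}"

lemma prob_space_unif: "prob_space unif"
  unfolding unif_def
  by (auto simp: emeasure_restrict_space space_restrict_space intro!: prob_spaceI)

lemma space_unif: "space unif = {0<..<1}"
  by (simp add: unif_def space_restrict_space)

lemma quantile_measurable:
  assumes "real_distribution N"
  shows "quantile N \<in> borel_measurable unif"
proof -
  interpret cdf_distribution N using assms by (simp add: cdf_distribution_def)
  show ?thesis
    using measurable_CI unfolding quantile_def[abs_def] unif_def
    by (simp add: measurable_def space_restrict_space sets_restrict_space)
qed

lemma distr_quantile: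
  assumes "real_distribution N"
  shows "distr unif borel (quantile N) = N"
proof -
  interpret cdf_distribution N using assms by (simp add: cdf_distribution_def)
  show ?thesis using distr_I_eq_M unfolding quantile_def[abs_def] unif_def .
qed

lemma quantile_le_iff:
  assumes "real_distribution N" "u \<in> {0<..<1}"
  shows "quantile N u \<le> x \<longleftrightarrow> u \<le> cdf N x"
proof -
  interpret cdf_distribution N using assms by (simp add: cdf_distribution_def)
  show ?thesis using pseudoinverse[of u x] assms by (simp add: quantile_def)
qed

lemma quantile_mono:
  assumes "real_distribution N1" "real_distribution N2" "\<And>t. cdf N1 t \<le> cdf N2 t" "u \<in> {0<..<1}"
  shows "quantile N2 u \<le> quantile N1 u"
  using assms quantile_le_iff[OF assms(1,4), of "quantile N1 u"]
  by (auto simp: quantile_le_iff intro: order_trans)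

lemma integral_quantile:
  fixes f :: "real \<Rightarrow> real"
  assumes N: "real_distribution N" and [measurable]: "f \<in> borel_measurable borel"
  shows "(\<integral>x. f x \<partial>N) = (\<integral>u. f (quantile N u) \<partial>unif)"
    and "integrable unif (\<lambda>u. f (quantile N u)) \<longleftrightarrow> integrable N f"
proof -
  note [measurable] = quantile_measurable[OF N]
  show "(\<integral>x. f x \<partial>N) = (\<integral>u. f (quantile N u) \<partial>unif)"
    using integral_distr[of "quantile N" unif borel f] by (simp add: distr_quantile[OF N])
  show "integrable unif (\<lambda>u. f (quantile N u)) \<longleftrightarrow> integrable N f"
    using integrable_distr_eq[of "quantile N" unif borel f] by (simp add: distr_quantile[OF N])
qed

lemma cdf_distr_le:
  assumes "prob_space P" "X \<in> borel_measurable P" "Y \<in> borel_measurable P"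
    and "AE \<omega> in P. Y \<omega> \<le> X \<omega>"
  shows "cdf (distr P borel X) t \<le> cdf (distr P borel Y) t"
proof -
  interpret prob_space P by fact
  note [measurable] = assms(2,3)
  have "prob {\<omega> \<in> space P. X \<omega> \<le> t} \<le> prob {\<omega> \<in> space P. Y \<omega> \<le> t}"
    by (rule finite_measure_mono_AE) (use assms(4) in auto)
  then show ?thesis
    by (simp add: cdf_def measure_distr vimage_def Int_def conj_commute)
qed

text \<open>On the common space \<open>unif\<close> dominance becomes the pointwise order of the
  quantile functions, and a decreasing g reverses that order pointwise.\<close>

lemma cdf_distr_antimono:
  assumes N: "real_distribution N1" "real_distribution N2" and le: "\<And>t. cdf N1 t \<le> cdf N2 t"
    and [measurable]: "g \<in> borel_measurable borel" and g: "\<And>x y. x \<le> y \<Longrightarrow> g y \<le> g x"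
  shows "cdf (distr N2 borel g) t \<le> cdf (distr N1 borel g) t"
proof -
  note [measurable] = N[THEN quantile_measurable]
  have *: "distr N borel g = distr unif borel (\<lambda>u. g (quantile N u))" if "N = N1 \<or> N = N2" for N
  proof -
    have [measurable]: "quantile N \<in> borel_measurable unif" and eq: "N = distr unif borel (quantile N)"
      using that N by (auto simp: quantile_measurable distr_quantile)
    show ?thesis by (subst (1) eq, subst distr_distr) (auto simp: comp_def)
  qed
  show ?thesis
    unfolding *[OF disjI1[OF refl]] *[OF disjI2[OF refl]]
    by (rule cdf_distr_le[OF prob_space_unif])
       (auto intro!: AE_I2 g quantile_mono N le simp: space_unif)
qed

lemma mexp_mono:
  assumes "exp_law N1" "exp_law N2" "\<And>t. cdf N1 t \<le> cdf N2 t"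
  shows "mexp N2 a \<le> mexp N1 a"
proof -
  note N = assms(1,2)[THEN exp_law_real_distr]
  have "(\<integral>u. expint a (quantile N2 u) \<partial>unif) \<le> (\<integral>u. expint a (quantile N1 u) \<partial>unif)"
    by (rule integral_mono)
       (auto intro!: expint_mono quantile_mono N assms exp_law_integrable_expint simp: space_unif integral_quantile(2) N)
  then show ?thesis by (simp add: mexp_def integral_quantile N)
qed

lemma exp_law_return [simp]: "exp_law (return borel c)"
proof -
  interpret prob_space "return borel c" by (rule prob_space_return) simp
  have "integrable (return borel c) (\<lambda>x. exp (a * x))" for a
    by (rule integrable_const_bound[where B = "exp (a * c)"]) (auto simp: AE_return)
  then show ?thesis by (auto simp: exp_law_def prob_space_axioms)
qed

lemma KL_return [simp]: "KL (return borel c) a = c"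
  by (simp add: KL_def K_def integral_return)

lemma exp_law_distr_linear_growth:
  assumes N: "exp_law N" and [measurable]: "g \<in> borel_measurable borel" and g: "\<And>x. \<bar>g x\<bar> \<le> c * \<bar>x\<bar> + d"
  shows "exp_law (distr N borel g)"
proof -
  interpret prob_space N by (rule exp_lawD[OF N])
  have [simp, measurable_cong]: "sets N = sets borel" by (rule exp_lawD[OF N])
  have "integrable N (\<lambda>x. exp (a * g x))" for a
  proof (rule Bochner_Integration.integrable_bound)
    show "integrable N (\<lambda>x. exp (\<bar>a\<bar> * d) * exp ((\<bar>a\<bar> * c) * \<bar>x\<bar>))"
      by (intro integrable_mult_right exp_law_integrable_exp_abs N)
    show "AE x in N. norm (exp (a * g x)) \<le> norm (exp (\<bar>a\<bar> * d) * exp (\<bar>a\<bar> * c * \<bar>x\<bar>))"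
    proof (rule AE_I2)
      fix x
      have "a * g x \<le> \<bar>a\<bar> * \<bar>g x\<bar>" by (simp add: abs_mult[symmetric])
      also have "\<dots> \<le> \<bar>a\<bar> * (c * \<bar>x\<bar> + d)" by (intro mult_left_mono g) auto
      finally show "norm (exp (a * g x)) \<le> norm (exp (\<bar>a\<bar> * d) * exp (\<bar>a\<bar> * c * \<bar>x\<bar>))"
        by (simp add: exp_add[symmetric] algebra_simps)
    qed
  qed simp
  then show ?thesis
    by (auto simp: exp_law_def integrable_distr_eq intro: prob_space_distr)
qed

definition reflect :: "real measure \<Rightarrow> real measure" where
  "reflect N = distr N borel uminus"

lemma exp_law_reflect: "exp_law N \<Longrightarrow> exp_law (reflect N)"
  unfolding reflect_def by (rule exp_law_distr_linear_growth[where c = 1 and d = 0]) auto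

lemma mexp_distr:
  assumes [simp, measurable_cong]: "sets N = sets borel" and [measurable]: "g \<in> borel_measurable borel"
  shows "mexp (distr N borel g) a = (\<integral>x. expint a (g x) \<partial>N)"
  unfolding mexp_def by (rule integral_distr) auto

lemma mexp_reflect: "exp_law N \<Longrightarrow> mexp (reflect N) a = - mexp N (- a)"
proof -
  assume "exp_law N"
  have "expint a (- x) = - expint (- a) x" for x
    by (simp add: expint_def minus_divide_right[symmetric])
  with \<open>exp_law N\<close> show ?thesis
    by (simp add: reflect_def mexp_distr exp_lawD(2)) (simp add: mexp_def)
qed

lemma KL_reflect: "exp_law N \<Longrightarrow> KL (reflect N) a = - KL N (- a)"
  using mexp_reflect[of N a] exp_law_reflect[of N] by (simp add: KL_eq)

lemma reflect_return: "reflect (return borel c) = return borel (- c)"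
  by (simp add: reflect_def distr_return)

lemma cdf_reflect_mono:
  assumes "exp_law N1" "exp_law N2" "\<And>t. cdf N1 t \<le> cdf N2 t"
  shows "cdf (reflect N2) t \<le> cdf (reflect N1) t"
  unfolding reflect_def
  by (rule cdf_distr_antimono) (auto intro: exp_law_real_distr assms)

section \<open>Cumulants and bounds under convolution\<close>

lemma convolution_exp:
  assumes "exp_law N1" "exp_law N2"
  shows "integrable (N1 \<star> N2) (\<lambda>x. exp (a * x))"
    and "(\<integral>x. exp (a * x) \<partial>(N1 \<star> N2)) = (\<integral>x. exp (a * x) \<partial>N1) * (\<integral>x. exp (a * x) \<partial>N2)"
proof -
  interpret N1: prob_space N1 by (rule exp_lawD[OF assms(1)])
  interpret N2: prob_space N2 by (rule exp_lawD[OF assms(2)])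
  interpret pair_prob_space N1 N2 ..
  have [simp, measurable_cong]: "sets N1 = sets borel" "sets N2 = sets borel"
    by (rule exp_lawD, fact)+
  have i: "integrable N1 (\<lambda>x. exp (a * x))" "integrable N2 (\<lambda>x. exp (a * x))"
    by (auto intro: exp_lawD assms)
  have e: "exp (a * (case z of (x, y) \<Rightarrow> x + y)) = exp (a * fst z) * exp (a * snd z)" for z
    by (cases z) (simp add: exp_add[symmetric] algebra_simps)
  have int: "integrable (N1 \<Otimes>\<^sub>M N2) (\<lambda>z. exp (a * fst z) * exp (a * snd z))"
    by (rule Fubini_integrable) (use i in \<open>auto simp: integrable_mult_right\<close>)
  show "integrable (N1 \<star> N2) (\<lambda>x. exp (a * x))"
    unfolding convolution_def using int by (subst integrable_distr_eq) (auto simp: e)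
  have "(\<integral>x. exp (a * x) \<partial>(N1 \<star> N2)) = (\<integral>z. exp (a * fst z) * exp (a * snd z) \<partial>(N1 \<Otimes>\<^sub>M N2))"
    unfolding convolution_def by (subst integral_distr) (auto simp: e)
  also have "\<dots> = (\<integral>x. (\<integral>y. exp (a * x) * exp (a * y) \<partial>N2) \<partial>N1)"
    using integral_fst'[OF int] by simp
  finally show "(\<integral>x. exp (a * x) \<partial>(N1 \<star> N2)) = (\<integral>x. exp (a * x) \<partial>N1) * (\<integral>x. exp (a * x) \<partial>N2)"
    by simp
qed

lemma exp_law_convolution:
  assumes "exp_law N1" "exp_law N2"
  shows "exp_law (N1 \<star> N2)"
proof -
  interpret N1: prob_space N1 by (rule exp_lawD[OF assms(1)])
  interpret N2: prob_space N2 by (rule exp_lawD[OF assms(2)])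
  interpret pair_prob_space N1 N2 ..
  have [simp, measurable_cong]: "sets N1 = sets borel" "sets N2 = sets borel"
    by (rule exp_lawD, fact)+
  have "prob_space (N1 \<star> N2)"
    unfolding convolution_def by (rule prob_space_distr) simp
  then show ?thesis
    unfolding exp_law_def using convolution_exp(1)[OF assms] by simp
qed

lemma integral_convolution_id:
  assumes "exp_law N1" "exp_law N2"
  shows "(\<integral>x. x \<partial>(N1 \<star> N2)) = (\<integral>x. x \<partial>N1) + (\<integral>x. x \<partial>N2)"
proof -
  interpret N1: prob_space N1 by (rule exp_lawD[OF assms(1)])
  interpret N2: prob_space N2 by (rule exp_lawD[OF assms(2)])
  interpret pair_prob_space N1 N2 ..
  have [simp, measurable_cong]: "sets N1 = sets borel" "sets N2 = sets borel"
    by (rule exp_lawD, fact)+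
  have i: "integrable N1 (\<lambda>x. x)" "integrable N2 (\<lambda>x. x)"
    by (auto intro: exp_law_integrable_id assms)
  have 1: "integrable (N1 \<Otimes>\<^sub>M N2) (\<lambda>z. fst z)"
    by (rule Fubini_integrable) (use i N2.prob_space in auto)
  have 2: "integrable (N1 \<Otimes>\<^sub>M N2) (\<lambda>z. snd z)"
    by (rule Fubini_integrable) (use i in auto)
  have "(\<integral>x. x \<partial>(N1 \<star> N2)) = (\<integral>z. fst z + snd z \<partial>(N1 \<Otimes>\<^sub>M N2))"
    unfolding convolution_def by (subst integral_distr) (auto simp: case_prod_unfold)
  also have "\<dots> = (\<integral>x. x \<partial>N1) + (\<integral>x. x \<partial>N2)"
    using 1 2 integral_fst'[OF 1] integral_fst'[OF 2] N1.prob_space N2.prob_space by simp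
  finally show ?thesis .
qed

lemma KL_convolution:
  assumes "exp_law N1" "exp_law N2"
  shows "KL (N1 \<star> N2) a = KL N1 a + KL N2 a"
  using exp_law_expectation_exp_pos[OF assms(1), of a] exp_law_expectation_exp_pos[OF assms(2), of a]
  by (simp add: KL_def K_def integral_convolution_id convolution_exp assms ln_mult add_divide_distrib)

lemma AE_convolution:
  assumes "exp_law N1" "exp_law N2" "AE x in N1. P x" "AE y in N2. Q y"
    and R: "\<And>x y. P x \<Longrightarrow> Q y \<Longrightarrow> R (x + y)" and [measurable]: "Measurable.pred borel R"
  shows "AE z in N1 \<star> N2. R z"
proof -
  interpret N1: prob_space N1 by (rule exp_lawD[OF assms(1)])
  interpret N2: prob_space N2 by (rule exp_lawD[OF assms(2)])
  interpret pair_prob_space N1 N2 ..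
  have [simp, measurable_cong]: "sets N1 = sets borel" "sets N2 = sets borel"
    by (rule exp_lawD, fact)+
  have "AE z in N1 \<Otimes>\<^sub>M N2. R (fst z + snd z)"
  proof (rule AE_pair_measure)
    show "{z \<in> space (N1 \<Otimes>\<^sub>M N2). R (fst z + snd z)} \<in> sets (N1 \<Otimes>\<^sub>M N2)"
      by measurable
    show "AE x in N1. AE y in N2. R (fst (x, y) + snd (x, y))"
      using assms(3)
    proof eventually_elim
      case (elim x)
      from assms(4) show ?case
        by eventually_elim (simp add: R elim)
    qed
  qed
  then show ?thesis
    unfolding convolution_def by (subst AE_distr_iff) (auto simp: case_prod_beta)
qed

primrec conv_pow :: "nat \<Rightarrow> real measure \<Rightarrow> real measure" where
  "conv_pow 0 N = return borel 0"
| "conv_pow (Suc n) N = (N \<star> conv_pow n N)"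

lemma exp_law_conv_pow: "exp_law N \<Longrightarrow> exp_law (conv_pow n N)"
  by (induction n) (auto intro: exp_law_convolution)

lemma KL_conv_pow: "exp_law N \<Longrightarrow> KL (conv_pow n N) a = n * KL N a"
  by (induction n) (auto simp: KL_convolution exp_law_conv_pow algebra_simps)

section \<open>Monotone additive functionals of laws\<close>

locale law_statistic =
  fixes \<phi> :: "real measure \<Rightarrow> real"
  assumes add: "exp_law N1 \<Longrightarrow> exp_law N2 \<Longrightarrow> \<phi> (N1 \<star> N2) = \<phi> N1 + \<phi> N2"
    and mono: "exp_law N1 \<Longrightarrow> exp_law N2 \<Longrightarrow> (\<And>t. cdf N1 t \<le> cdf N2 t) \<Longrightarrow> \<phi> N2 \<le> \<phi> N1"
    and const: "\<phi> (return borel c) = c"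
begin

lemma conv_pow: "exp_law N \<Longrightarrow> \<phi> (conv_pow n N) = n * \<phi> N"
  by (induction n) (auto simp: add const exp_law_conv_pow algebra_simps)

end

lemma reflect_convolution:
  assumes "exp_law N1" "exp_law N2"
  shows "reflect (N1 \<star> N2) = (reflect N1 \<star> reflect N2)"
proof -
  interpret N1: prob_space N1 by (rule exp_lawD[OF assms(1)])
  interpret N2: prob_space N2 by (rule exp_lawD[OF assms(2)])
  interpret pair_prob_space N1 N2 ..
  have [simp, measurable_cong]: "sets N1 = sets borel" "sets N2 = sets borel"
    by (rule exp_lawD, fact)+
  interpret R: prob_space "distr N2 borel uminus" by (rule N2.prob_space_distr) simp
  show ?thesis
    unfolding reflect_def convolution_def
    by (subst pair_measure_distr)
       (auto simp: distr_distr comp_def case_prod_beta R.sigma_finite_measure_axioms intro!: distr_cong)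
qed

text \<open>Duality: a result on upper tails or positive a, applied to this functional, becomes one
  on lower tails or negative a.\<close>

lemma (in law_statistic) reflected: "law_statistic (\<lambda>N. - \<phi> (reflect N))"
  by standard
     (auto simp: reflect_convolution add exp_law_reflect reflect_return const intro!: mono cdf_reflect_mono)

section \<open>Independent variables on a nonatomic space\<close>

locale nonatomic_prob_space = prob_space +
  assumes nonatomic: "nonatomic M"
begin

lemma nonatomic_prob:
  assumes "A \<in> events" "0 < prob A"
  obtains B where "B \<in> events" "B \<subseteq> A" "0 < prob B" "prob B < prob A"
  using nonatomic assms unfolding nonatomic_def
  by (auto simp: emeasure_eq_measure ennreal_less_iff zero_less_measure_iff)

text \<open>Repeated splitting: of a proper part C of B and its complement in B, one has at most
  half the measure of B, and both have positive measure.\<close>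

lemma nonatomic_small_subset:
  assumes A: "A \<in> events" "0 < prob A" and e: "0 < e"
  shows "\<exists>B\<in>events. B \<subseteq> A \<and> 0 < prob B \<and> prob B < e"
proof -
  have "\<exists>B\<in>events. B \<subseteq> A \<and> 0 < prob B \<and> prob B \<le> prob A / 2 ^ n" for n
  proof (induction n)
    case 0
    then show ?case using A by auto
  next
    case (Suc n)
    then obtain B where B: "B \<in> events" "B \<subseteq> A" "0 < prob B" "prob B \<le> prob A / 2 ^ n" by auto
    from nonatomic_prob[OF B(1,3)] obtain C
      where C: "C \<in> events" "C \<subseteq> B" "0 < prob C" "prob C < prob B" by blast
    have d: "prob (B - C) = prob B - prob C" using B C by (intro finite_measure_Diff) auto
    have h: "prob B / 2 \<le> prob A / 2 ^ Suc n" using B by simp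
    show ?case
    proof (cases "prob C \<le> prob B / 2")
      case True
      with h have "prob C \<le> prob A / 2 ^ Suc n" by linarith
      then show ?thesis using B C by (intro bexI[of _ C]) auto
    next
      case False
      with h d have "prob (B - C) \<le> prob A / 2 ^ Suc n" by linarith
      then show ?thesis using B C d by (intro bexI[of _ "B - C"]) auto
    qed
  qed
  moreover obtain n where "prob A / 2 ^ n < e"
  proof -
    have "(\<lambda>n. prob A / 2 ^ n) \<longlonglongrightarrow> 0" by (rule LIMSEQ_divide_realpow_zero) simp
    from order_tendstoD(2)[OF this e] that show ?thesis
      by (auto simp: eventually_sequentially)
  qed
  ultimately show ?thesis by (meson le_less_trans)
qed

text \<open>Sierpinski's theorem by greedy exhaustion: each step adds a set of at least half the largest
  admissible measure, so a missing amount would leave a set that all steps could have added.\<close>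

lemma nonatomic_subset_measure_eq:
  assumes A: "A \<in> events" and c: "0 \<le> c" "c \<le> prob A"
  shows "\<exists>B\<in>events. B \<subseteq> A \<and> prob B = c"
proof -
  define adm where "adm B C \<longleftrightarrow> C \<in> events \<and> C \<subseteq> A - B \<and> prob B + prob C \<le> c" for B C
  have "\<exists>C. adm B C \<and> (\<forall>D. adm B D \<longrightarrow> prob D \<le> 2 * prob C)" if B: "prob B \<le> c" for B
  proof (cases "\<exists>D. adm B D \<and> 0 < prob D")
    case False
    then have "\<forall>D. adm B D \<longrightarrow> prob D \<le> 2 * prob {}" by (auto simp: not_less)
    moreover have "adm B {}" using B by (simp add: adm_def)
    ultimately show ?thesis by blast
  next
    case True
    then obtain D where D: "adm B D" "0 < prob D" by blast
    let ?S = "prob ` {C. adm B C}"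
    have bdd: "bdd_above ?S" by (intro bdd_aboveI[of _ 1]) auto
    have "prob D \<le> Sup ?S" using D bdd by (intro cSup_upper) auto
    then have "Sup ?S / 2 < Sup ?S" using D by simp
    then obtain C where C: "adm B C" "Sup ?S / 2 < prob C"
      using less_cSup_iff[OF _ bdd, of "Sup ?S / 2"] D by auto
    then have "\<forall>E. adm B E \<longrightarrow> prob E \<le> 2 * prob C"
      using cSup_upper[OF _ bdd] by fastforce
    with C show ?thesis by blast
  qed
  then obtain f where f: "\<And>B. prob B \<le> c \<Longrightarrow> adm B (f B)"
    "\<And>B D. prob B \<le> c \<Longrightarrow> adm B D \<Longrightarrow> prob D \<le> 2 * prob (f B)" by metis
  define B where "B n = ((\<lambda>B. B \<union> f B) ^^ n) {}" for n
  have BS: "B (Suc n) = B n \<union> f (B n)" for n by (simp add: B_def)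
  have B0: "B 0 = {}" by (simp add: B_def)
  have BA: "B n \<in> events \<and> B n \<subseteq> A \<and> prob (B n) \<le> c" for n
  proof (induction n)
    case 0
    then show ?case using c by (simp add: B0)
  next
    case (Suc n)
    with f(1)[of "B n"] have "adm (B n) (f (B n))" by simp
    with Suc show ?case
      by (subst (3) BS, subst finite_measure_Union) (auto simp: adm_def BS)
  qed
  have adm: "adm (B n) (f (B n))" for n using f(1) BA by simp
  have mono: "incseq B" by (rule incseq_SucI) (auto simp: BS)
  have prob_eq: "prob (B n) = (\<Sum>i<n. prob (f (B i)))" for n
  proof (induction n)
    case (Suc n)
    have "prob (B (Suc n)) = prob (B n) + prob (f (B n))"
      unfolding BS using adm[of n] BA[of n] by (intro finite_measure_Union) (auto simp: adm_def)
    with Suc show ?case by simp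
  qed (simp add: B0)
  let ?B = "\<Union>n. B n"
  have ev: "?B \<in> events" using BA by auto
  have lim: "(\<lambda>n. prob (B n)) \<longlonglongrightarrow> prob ?B"
    using BA mono by (intro finite_Lim_measure_incseq) auto
  then have le: "prob ?B \<le> c" using BA by (intro LIMSEQ_le_const2) auto
  have "prob ?B = c"
  proof (rule ccontr)
    assume "prob ?B \<noteq> c"
    with le have less: "prob ?B < c" by simp
    have "prob (A - ?B) = prob A - prob ?B" using A ev BA by (intro finite_measure_Diff) auto
    then have "0 < prob (A - ?B)" using less c by simp
    from nonatomic_small_subset[OF _ this, of "c - prob ?B"] less ev A
    obtain D where D: "D \<in> events" "D \<subseteq> A - ?B" "0 < prob D" "prob D < c - prob ?B" by auto
    have half: "prob D \<le> 2 * prob (f (B n))" for n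
    proof (rule f(2))
      have "prob (B n) \<le> prob ?B" using ev by (intro finite_measure_mono) auto
      with D show "adm (B n) D" by (auto simp: adm_def)
    qed (use BA in simp)
    \<comment> \<open>The added masses have a finite sum and so tend to 0, whereas each of them is
      at least half of \<open>prob D\<close>.\<close>
    have "summable (\<lambda>i. prob (f (B i)))"
      using lim unfolding prob_eq summable_def sums_def by blast
    then have "(\<lambda>i. 2 * prob (f (B i))) \<longlonglongrightarrow> 2 * 0"
      by (intro tendsto_intros summable_LIMSEQ_zero)
    from LIMSEQ_le_const[OF this] half have "prob D \<le> 2 * 0" by blast
    with D show False by simp
  qed
  with ev BA show ?thesis by (intro bexI[of _ ?B]) auto
qed

section \<open>Two independent uniform coordinates from dyadic cells\<close>

definition half :: "'a set \<Rightarrow> 'a set" where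
  "half A = (SOME B. B \<in> events \<and> B \<subseteq> A \<and> prob B = prob A / 2)"

lemma half:
  assumes "A \<in> events"
  shows "half A \<in> events" "half A \<subseteq> A" "prob (half A) = prob A / 2"
  using someI_ex[OF nonatomic_subset_measure_eq[OF assms, of "prob A / 2", unfolded Bex_def]]
  unfolding half_def by simp_all

definition part :: "bool \<Rightarrow> 'a set \<Rightarrow> 'a set" where
  "part b A = (if b then half A else A - half A)"

lemma part:
  assumes "A \<in> events"
  shows "part b A \<in> events" "part b A \<subseteq> A" "prob (part b A) = prob A / 2"
  using half[OF assms] finite_measure_Diff[OF assms half(1,2)[OF assms]] assms by (auto simp: part_def)

lemma part_inj: "\<omega> \<in> part b A \<Longrightarrow> \<omega> \<in> part b' A \<Longrightarrow> b = b'"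
  by (auto simp: part_def split: if_splits)

text \<open>The n binary digits of j and of k address a square of side 2^-n. One level deeper, the
  cell is halved by the new digit of j and then by that of k, so its mass drops by the factor 4.
  Out-of-range indices lead back to an empty cell at level 0.\<close>

primrec cell :: "nat \<Rightarrow> nat \<Rightarrow> nat \<Rightarrow> 'a set" where
  "cell 0 j k = (if j = 0 \<and> k = 0 then space M else {})"
| "cell (Suc n) j k = part (even k) (part (even j) (cell n (j div 2) (k div 2)))"

lemma cell_events [measurable]: "cell n j k \<in> events"
  by (induction n arbitrary: j k) (auto intro: part)

lemma cell_Suc_subset: "cell (Suc n) j k \<subseteq> cell n (j div 2) (k div 2)"
  using part(2)[OF cell_events] part(2)[OF part(1)[OF cell_events]] by fastforce

lemma cell_bound: "\<omega> \<in> cell n j k \<Longrightarrow> j < 2 ^ n \<and> k < 2 ^ n"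
proof (induction n arbitrary: j k)
  case (Suc n)
  then have "\<omega> \<in> cell n (j div 2) (k div 2)" using cell_Suc_subset by blast
  from Suc.IH[OF this] show ?case by auto
qed (auto split: if_splits)

lemma prob_cell: "j < 2 ^ n \<Longrightarrow> k < 2 ^ n \<Longrightarrow> prob (cell n j k) = 1 / 4 ^ n"
proof (induction n arbitrary: j k)
  case (Suc n)
  then have "prob (cell n (j div 2) (k div 2)) = 1 / 4 ^ n" by auto
  then show ?case by (simp add: part cell_events)
qed (simp add: prob_space)

lemma prob_cell_le: "prob (cell n j k) \<le> 1 / 4 ^ n"
proof (cases "cell n j k = {}")
  case False
  then obtain \<omega> where "\<omega> \<in> cell n j k" by auto
  from prob_cell cell_bound[OF this] show ?thesis by simp
qed simp

lemma cell_unique: "\<omega> \<in> cell n j k \<Longrightarrow> \<omega> \<in> cell n j' k' \<Longrightarrow> j = j' \<and> k = k'"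
proof (induction n arbitrary: j k j' k')
  case (Suc n)
  then have d: "j div 2 = j' div 2 \<and> k div 2 = k' div 2" using cell_Suc_subset by blast
  let ?S = "cell n (j div 2) (k div 2)"
  have p: "\<omega> \<in> part (even k) (part (even j) ?S)" "\<omega> \<in> part (even k') (part (even j') ?S)"
    using Suc.prems d by simp_all
  then have "\<omega> \<in> part (even j) ?S" "\<omega> \<in> part (even j') ?S"
    using part(2)[OF part(1)[OF cell_events]] by blast+
  then have e: "even j = even j'" by (rule part_inj)
  with p have "even k = even k'" by (auto dest: part_inj)
  with d e show ?case by (metis even_two_times_div_two odd_two_times_div_two_succ)
qed (auto split: if_splits)

lemma cell_cover: "\<omega> \<in> space M \<Longrightarrow> \<exists>j k. \<omega> \<in> cell n j k"
proof (induction n)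
  case (Suc n)
  then obtain j k where jk: "\<omega> \<in> cell n j k" by auto
  define j' where "j' = (if \<omega> \<in> half (cell n j k) then 2 * j else Suc (2 * j))"
  have j': "\<omega> \<in> part (even j') (cell n (j' div 2) k)"
    using jk by (auto simp: j'_def part_def)
  define S where "S = part (even j') (cell n (j' div 2) k)"
  have "\<omega> \<in> cell (Suc n) j' (if \<omega> \<in> half S then 2 * k else Suc (2 * k))"
    using j' by (auto simp: S_def part_def)
  then show ?case by blast
qed auto

lemma cell_coarsen: "\<omega> \<in> cell (n + d) j k \<Longrightarrow> \<omega> \<in> cell n (j div 2 ^ d) (k div 2 ^ d)"
proof (induction d arbitrary: j k)
  case (Suc d)
  then have "\<omega> \<in> cell (n + d) (j div 2) (k div 2)" using cell_Suc_subset[of "n + d" j k] by auto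
  from Suc.IH[OF this] show ?case by (simp add: div_mult2_eq)
qed simp

text \<open>The limit of the truncated binary expansions, written as a supremum of left end points
  so that {t < U} is a countable union of cells.\<close>

definition Ucoord :: "'a \<Rightarrow> real" where
  "Ucoord \<omega> = Sup {j / 2 ^ n | n j. \<exists>k. \<omega> \<in> cell n j k}"

definition Vcoord :: "'a \<Rightarrow> real" where
  "Vcoord \<omega> = Sup {k / 2 ^ n | n k. \<exists>j. \<omega> \<in> cell n j k}"

text \<open>The dyadic intervals that contain one point are nested, the coarser index being the
  finer one divided by a power of 2. Hence each left end point lies below each right end point,
  whatever the levels.\<close>

lemma cell_dyadic_le:
  assumes "\<omega> \<in> cell n j k" "\<omega> \<in> cell n' j' k'"
  shows "real j' / 2 ^ n' \<le> real (Suc j) / 2 ^ n" "real k' / 2 ^ n' \<le> real (Suc k) / 2 ^ n"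
proof -
  have *: "real a' / 2 ^ (m + d) \<le> real (Suc a) / 2 ^ m" if "a' div 2 ^ d = a" for a a' m d :: nat
  proof -
    have "a' < Suc a * 2 ^ d"
      using that by (metis div_less_iff_less_mult lessI pos2 zero_less_power)
    then have "real a' \<le> real (Suc a * 2 ^ d)" by (intro of_nat_mono) simp
    then show ?thesis by (simp add: field_simps power_add)
  qed
  have **: "real a' / 2 ^ m \<le> real (Suc a) / 2 ^ (m + d)" if "a div 2 ^ d = a'" for a a' m d :: nat
  proof -
    have "a' * 2 ^ d \<le> a" using that by (metis div_times_less_eq_dividend)
    then have "real (a' * 2 ^ d) \<le> real (Suc a)" by (intro of_nat_mono) simp
    then show ?thesis by (simp add: field_simps power_add)
  qed
  show "real j' / 2 ^ n' \<le> real (Suc j) / 2 ^ n" "real k' / 2 ^ n' \<le> real (Suc k) / 2 ^ n"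
  proof (atomize (full), cases "n \<le> n'")
    case True
    then obtain d where d: "n' = n + d" by (auto simp: le_iff_add)
    with assms cell_coarsen have "j' div 2 ^ d = j \<and> k' div 2 ^ d = k" by (metis cell_unique)
    with * show "real j' / 2 ^ n' \<le> real (Suc j) / 2 ^ n \<and> real k' / 2 ^ n' \<le> real (Suc k) / 2 ^ n"
      by (simp add: d)
  next
    case False
    then obtain d where d: "n = n' + d" by (metis le_iff_add nat_le_linear)
    with assms cell_coarsen have "j div 2 ^ d = j' \<and> k div 2 ^ d = k'" by (metis cell_unique)
    with ** show "real j' / 2 ^ n' \<le> real (Suc j) / 2 ^ n \<and> real k' / 2 ^ n' \<le> real (Suc k) / 2 ^ n"
      by (simp add: d)
  qed
qed

lemma coord_bdd:
  "bdd_above {real j / 2 ^ n | n j. \<exists>k. \<omega> \<in> cell n j k}" "bdd_above {real k / 2 ^ n | n k. \<exists>j. \<omega> \<in> cell n j k}"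
  by (rule bdd_aboveI[of _ 1], use cell_bound[of \<omega>] in \<open>force simp: less_imp_le\<close>)+

lemma coord_bounds:
  assumes "\<omega> \<in> cell n j k"
  shows "real j / 2 ^ n \<le> Ucoord \<omega>" "Ucoord \<omega> \<le> real (Suc j) / 2 ^ n"
    "real k / 2 ^ n \<le> Vcoord \<omega>" "Vcoord \<omega> \<le> real (Suc k) / 2 ^ n"
  unfolding Ucoord_def Vcoord_def
  using assms cell_dyadic_le[OF assms]
  by (auto intro!: cSup_upper cSup_least coord_bdd simp del: of_nat_Suc)

lemma less_Ucoord_iff: "\<omega> \<in> space M \<Longrightarrow> t < Ucoord \<omega> \<longleftrightarrow> (\<exists>n j k. t < real j / 2 ^ n \<and> \<omega> \<in> cell n j k)"
  unfolding Ucoord_def using cell_cover[of \<omega>] by (subst less_cSup_iff) (auto intro!: coord_bdd)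

lemma less_Vcoord_iff: "\<omega> \<in> space M \<Longrightarrow> t < Vcoord \<omega> \<longleftrightarrow> (\<exists>n j k. t < real k / 2 ^ n \<and> \<omega> \<in> cell n j k)"
  unfolding Vcoord_def using cell_cover[of \<omega>]
  by (subst less_cSup_iff) (force intro!: coord_bdd, rule coord_bdd, blast)

lemma Ucoord_measurable [measurable]: "Ucoord \<in> borel_measurable M"
  unfolding borel_measurable_iff_greater
proof
  fix t
  have "{\<omega> \<in> space M. t < Ucoord \<omega>} = (\<Union>n j k. cell n j k \<inter> {\<omega> \<in> space M. t < real j / 2 ^ n})"
    by (simp add: set_eq_iff less_Ucoord_iff cong: conj_cong) blast
  also have "\<dots> \<in> events" by (intro sets.countable_UN'' sets.Int cell_events) auto
  finally show "{\<omega> \<in> space M. t < Ucoord \<omega>} \<in> events" .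
qed

lemma Vcoord_measurable [measurable]: "Vcoord \<in> borel_measurable M"
  unfolding borel_measurable_iff_greater
proof
  fix t
  have "{\<omega> \<in> space M. t < Vcoord \<omega>} = (\<Union>n j k. cell n j k \<inter> {\<omega> \<in> space M. t < real k / 2 ^ n})"
    by (simp add: set_eq_iff less_Vcoord_iff cong: conj_cong) blast
  also have "\<dots> \<in> events" by (intro sets.countable_UN'' sets.Int cell_events) auto
  finally show "{\<omega> \<in> space M. t < Vcoord \<omega>} \<in> events" .
qed

abbreviation quadrant :: "real \<Rightarrow> real \<Rightarrow> 'a set" where
  "quadrant s t \<equiv> {\<omega> \<in> space M. Ucoord \<omega> \<le> s \<and> Vcoord \<omega> \<le> t}"

lemma prob_cells:
  "prob (\<Union>(j, k)\<in>{..<a} \<times> {..<b}. cell n j k) = (\<Sum>(j, k)\<in>{..<a} \<times> {..<b}. prob (cell n j k))"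
  using cell_unique
  by (subst finite_measure_finite_Union) (fastforce simp: disjoint_family_on_def case_prod_unfold)+

text \<open>Strict here, weak in the matching lower estimate: a point of cell j has its coordinate
  in the closed interval from j / 2^n to (j + 1) / 2^n, so a grid value may come from either
  neighbouring cell.\<close>

lemma prob_coord_less:
  "prob {\<omega> \<in> space M. Ucoord \<omega> < real a / 2 ^ n \<and> Vcoord \<omega> < real b / 2 ^ n} \<le> real a * real b / 4 ^ n"
proof -
  let ?E = "{\<omega> \<in> space M. Ucoord \<omega> < real a / 2 ^ n \<and> Vcoord \<omega> < real b / 2 ^ n}"
  let ?U = "\<Union>(j, k)\<in>{..<a} \<times> {..<b}. cell n j k"
  have "?E \<subseteq> ?U"
  proof safe
    fix \<omega> assume \<omega>: "\<omega> \<in> space M" "Ucoord \<omega> < real a / 2 ^ n" "Vcoord \<omega> < real b / 2 ^ n"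
    then obtain j k where jk: "\<omega> \<in> cell n j k" using cell_cover by blast
    with coord_bounds[OF jk] \<omega> have "real j / 2 ^ n < real a / 2 ^ n" "real k / 2 ^ n < real b / 2 ^ n"
      by linarith+
    then have "j < a" "k < b" by (auto simp: divide_less_cancel)
    with jk show "\<omega> \<in> ?U" by auto
  qed
  then have "prob ?E \<le> prob ?U"
    by (intro finite_measure_mono) (auto intro!: sets.finite_UN)
  also have "\<dots> \<le> (\<Sum>(j, k)\<in>{..<a} \<times> {..<b}. 1 / 4 ^ n)"
    unfolding prob_cells by (intro sum_mono) (auto simp: prob_cell_le)
  finally show ?thesis by (simp add: case_prod_unfold)
qed

lemma prob_coord_le:
  assumes "a \<le> 2 ^ n" "b \<le> 2 ^ n"
  shows "real a * real b / 4 ^ n \<le> prob (quadrant (real a / 2 ^ n) (real b / 2 ^ n))"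
proof -
  let ?E = "quadrant (real a / 2 ^ n) (real b / 2 ^ n)"
  let ?U = "\<Union>(j, k)\<in>{..<a} \<times> {..<b}. cell n j k"
  have "real a * real b / 4 ^ n = (\<Sum>(j, k)\<in>{..<a} \<times> {..<b}. 1 / 4 ^ n)"
    by (simp add: case_prod_unfold)
  also have "\<dots> = (\<Sum>(j, k)\<in>{..<a} \<times> {..<b}. prob (cell n j k))"
    using assms by (intro sum.cong) (auto simp: prob_cell)
  also have "\<dots> = prob ?U" by (simp add: prob_cells)
  also have "\<dots> \<le> prob ?E"
  proof (rule finite_measure_mono)
    show "?U \<subseteq> ?E"
    proof safe
      fix \<omega> j k assume \<omega>: "\<omega> \<in> cell n j k" and "j < a" "k < b"
      then have "real (Suc j) / 2 ^ n \<le> real a / 2 ^ n" "real (Suc k) / 2 ^ n \<le> real b / 2 ^ n"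
        by (auto intro!: divide_right_mono)
      with coord_bounds[OF \<omega>] show "Ucoord \<omega> \<le> real a / 2 ^ n" "Vcoord \<omega> \<le> real b / 2 ^ n"
        by linarith+
      show "\<omega> \<in> space M" using \<omega> sets.sets_into_space[OF cell_events] by blast
    qed
  qed simp
  finally show ?thesis .
qed

text \<open>The quadrant lies between those at the grid points of level n just below and just above
  (s, t), and the masses of these differ from s t by an amount of order 2^-n.\<close>

lemma prob_coord:
  assumes s: "0 \<le> s" "s \<le> 1" and t: "0 \<le> t" "t \<le> 1"
  shows "prob (quadrant s t) = s * t"
proof (rule antisym)
  let ?P = "prob (quadrant s t)"
  define a where "a n = nat \<lfloor>s * 2 ^ n\<rfloor>" for n :: nat
  define b where "b n = nat \<lfloor>t * 2 ^ n\<rfloor>" for n :: nat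
  have a: "real (a n) \<le> s * 2 ^ n" "s * 2 ^ n < real (Suc (a n))" for n
    using s by (auto simp: a_def intro: of_nat_floor) linarith
  have b: "real (b n) \<le> t * 2 ^ n" "t * 2 ^ n < real (Suc (b n))" for n
    using t by (auto simp: b_def intro: of_nat_floor) linarith
  have four: "(4::real) ^ n = 2 ^ n * 2 ^ n" for n by (simp add: power_mult_distrib[symmetric])
  have up: "?P \<le> (s + 1 / 2 ^ n) * (t + 1 / 2 ^ n)" for n
  proof -
    have "?P \<le> prob {\<omega> \<in> space M. Ucoord \<omega> < real (Suc (a n)) / 2 ^ n \<and> Vcoord \<omega> < real (Suc (b n)) / 2 ^ n}"
    proof (rule finite_measure_mono)
      have "s < real (Suc (a n)) / 2 ^ n" "t < real (Suc (b n)) / 2 ^ n"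
        using a[of n] b[of n] by (auto simp: field_simps)
      then show "quadrant s t \<subseteq>
        {\<omega> \<in> space M. Ucoord \<omega> < real (Suc (a n)) / 2 ^ n \<and> Vcoord \<omega> < real (Suc (b n)) / 2 ^ n}"
        by (auto intro: le_less_trans)
    qed simp
    also have "\<dots> \<le> real (Suc (a n)) * real (Suc (b n)) / 4 ^ n" by (rule prob_coord_less)
    also have "\<dots> \<le> (s * 2 ^ n + 1) * (t * 2 ^ n + 1) / 4 ^ n"
      using a[of n] b[of n] s t by (intro divide_right_mono mult_mono) auto
    also have "\<dots> = (s + 1 / 2 ^ n) * (t + 1 / 2 ^ n)" by (simp add: four field_simps)
    finally show ?thesis .
  qed
  have "(\<lambda>n. (s + 1 / 2 ^ n) * (t + 1 / 2 ^ n)) \<longlonglongrightarrow> (s + 0) * (t + 0)"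
    by (intro tendsto_intros LIMSEQ_divide_realpow_zero) auto
  then show "?P \<le> s * t" using up by (intro LIMSEQ_le_const) auto
  have low: "s * t - 2 / 2 ^ n \<le> ?P" for n
  proof -
    have "s * 2 ^ n \<le> 2 ^ n" "t * 2 ^ n \<le> 2 ^ n" using s t by simp_all
    with a(1)[of n] b(1)[of n] have "real (a n) \<le> 2 ^ n" "real (b n) \<le> 2 ^ n" by linarith+
    then have ab: "a n \<le> 2 ^ n" "b n \<le> 2 ^ n"
      using of_nat_le_iff[of "a n" "2 ^ n", where 'a = real] of_nat_le_iff[of "b n" "2 ^ n", where 'a = real] by simp_all
    have "s * 2 ^ n * (t * 2 ^ n - real (b n)) \<le> 2 ^ n * 1"
      using s t b[of n] by (intro mult_mono) auto
    moreover have "real (b n) * (s * 2 ^ n - real (a n)) \<le> 2 ^ n * 1"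
      using \<open>real (b n) \<le> 2 ^ n\<close> s t a[of n] by (intro mult_mono) auto
    ultimately have "s * t * 4 ^ n - 2 * 2 ^ n \<le> real (a n) * real (b n)"
      by (simp add: four algebra_simps)
    then have "(s * t * 4 ^ n - 2 * 2 ^ n) / 4 ^ n \<le> real (a n) * real (b n) / 4 ^ n"
      by (intro divide_right_mono) auto
    moreover have "(s * t * 4 ^ n - 2 * 2 ^ n) / 4 ^ n = s * t - 2 / 2 ^ n"
      by (simp add: four field_simps)
    ultimately have "s * t - 2 / 2 ^ n \<le> real (a n) * real (b n) / 4 ^ n" by simp
    also have "\<dots> \<le> prob (quadrant (real (a n) / 2 ^ n) (real (b n) / 2 ^ n))"
      by (rule prob_coord_le[OF ab])
    also have "\<dots> \<le> ?P"
    proof (rule finite_measure_mono)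
      have "real (a n) / 2 ^ n \<le> s" "real (b n) / 2 ^ n \<le> t"
        using a(1)[of n] b(1)[of n] by (auto simp: field_simps)
      then show "quadrant (real (a n) / 2 ^ n) (real (b n) / 2 ^ n) \<subseteq>
        quadrant s t"
        by (auto intro: order_trans)
    qed simp
    finally show ?thesis .
  qed
  have "(\<lambda>n. s * t - 2 / 2 ^ n) \<longlonglongrightarrow> s * t - 0"
    by (intro tendsto_intros LIMSEQ_divide_realpow_zero) auto
  then show "s * t \<le> ?P" using low by (intro LIMSEQ_le_const2) auto
qed

lemma coord_range:
  assumes "\<omega> \<in> space M"
  shows "0 \<le> Ucoord \<omega>" "Ucoord \<omega> \<le> 1" "0 \<le> Vcoord \<omega>" "Vcoord \<omega> \<le> 1"
  using coord_bounds[of \<omega> 0 0 0] assms by auto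

definition clip01 :: "real \<Rightarrow> real" where
  "clip01 s = max 0 (min 1 s)"

lemma prob_coord_clip:
  "prob (quadrant s t) = (if s < 0 \<or> t < 0 then 0 else clip01 s * clip01 t)"
proof (cases "s < 0 \<or> t < 0")
  case True
  then have eq: "quadrant s t = {}"
    using coord_range by force
  show ?thesis using True unfolding eq by simp
next
  case False
  then have eq: "quadrant s t = quadrant (clip01 s) (clip01 t)"
    using coord_range by (force simp: clip01_def)
  have "0 \<le> clip01 s" "clip01 s \<le> 1" "0 \<le> clip01 t" "clip01 t \<le> 1" by (auto simp: clip01_def)
  from prob_coord[OF this] False show ?thesis unfolding eq by simp
qed

lemma prob_Ucoord: "prob {\<omega> \<in> space M. Ucoord \<omega> \<le> s} = (if s < 0 then 0 else clip01 s)"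
proof -
  have "{\<omega> \<in> space M. Ucoord \<omega> \<le> s} = quadrant s 1"
    using coord_range by auto
  then show ?thesis by (simp only: prob_coord_clip) (simp add: clip01_def)
qed

lemma prob_Vcoord: "prob {\<omega> \<in> space M. Vcoord \<omega> \<le> t} = (if t < 0 then 0 else clip01 t)"
proof -
  have "{\<omega> \<in> space M. Vcoord \<omega> \<le> t} = quadrant 1 t"
    using coord_range by auto
  then show ?thesis by (simp only: prob_coord_clip) (simp add: clip01_def)
qed

text \<open>The product formula on quadrants suffices, because the half-lines form an
  intersection-stable generator of the Borel sets.\<close>

lemma indep_var_coords: "indep_var borel Ucoord borel Vcoord"
proof -
  let ?A = "\<lambda>X. {X -` B \<inter> space M | B. B \<in> range (\<lambda>t::real. {..t})}"
  have A: "?A X = range (\<lambda>t. {\<omega> \<in> space M. X \<omega> \<le> t})" for X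
  proof -
    have "?A X = range (\<lambda>t. X -` {..t} \<inter> space M)" by auto
    moreover have "X -` {..t} \<inter> space M = {\<omega> \<in> space M. X \<omega> \<le> t}" for t by auto
    ultimately show ?thesis by simp
  qed
  have stable: "Int_stable (?A X)" for X
  proof (unfold A, rule Int_stableI_image)
    fix s t :: real
    show "\<exists>r\<in>UNIV. {\<omega> \<in> space M. X \<omega> \<le> s} \<inter> {\<omega> \<in> space M. X \<omega> \<le> t} = {\<omega> \<in> space M. X \<omega> \<le> r}"
      by (rule bexI[of _ "min s t"]) auto
  qed
  have sigma: "{X -` B \<inter> space M | B. B \<in> sets (borel :: real measure)} = sigma_sets (space M) (?A X)" for X
    by (subst borel_eq_atMost, subst sets_measure_of, simp, subst sigma_sets_vimage_commute) auto
  have "indep_set (?A Ucoord) (?A Vcoord)"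
  proof (unfold A, rule indep_setI)
    fix a b assume "a \<in> range (\<lambda>t. {\<omega> \<in> space M. Ucoord \<omega> \<le> t})" "b \<in> range (\<lambda>t. {\<omega> \<in> space M. Vcoord \<omega> \<le> t})"
    then obtain s t where st: "a = {\<omega> \<in> space M. Ucoord \<omega> \<le> s}" "b = {\<omega> \<in> space M. Vcoord \<omega> \<le> t}" by auto
    have "a \<inter> b = quadrant s t" by (auto simp: st)
    then show "prob (a \<inter> b) = prob a * prob b"
      by (simp add: prob_coord_clip) (simp add: st prob_Ucoord prob_Vcoord)
  qed auto
  from indep_set_sigma_sets[OF this stable stable]
  show ?thesis
    unfolding indep_var_eq sigma
    by (subst (1 2) sigma_sets_sigma_sets_eq) auto
qed

text \<open>Quantile functions turn independent uniform variables into independent variables with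
  prescribed laws.\<close>

lemma indep_pair_exists:
  assumes N: "real_distribution N1" "real_distribution N2"
  obtains X Y where "X \<in> borel_measurable M" "Y \<in> borel_measurable M" "indep_var borel X borel Y"
    "distr M borel X = N1" "distr M borel Y = N2"
proof -
  \<comment> \<open>Extended by 0 to a Borel function on the line. The coordinates have the law of
    \<open>unif\<close>, which lives on (0, 1), so the extension leaves the resulting law
    unchanged.\<close>
  define q where "q N x = (if x \<in> {0<..<1} then quantile N x else 0)" for N x
  have q [measurable]: "q N \<in> borel_measurable borel" if "real_distribution N" for N
  proof -
    have "(\<lambda>x. indicator {0<..<1} x *\<^sub>R quantile N x) \<in> borel_measurable borel"
      using quantile_measurable[OF that] unfolding unif_def
      by (subst (asm) borel_measurable_restrict_space_iff) auto
    moreover have "q N = (\<lambda>x. indicator {0<..<1} x *\<^sub>R quantile N x)"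
      by (auto simp: q_def indicator_def fun_eq_iff)
    ultimately show ?thesis by simp
  qed
  have d: "distr M borel (\<lambda>\<omega>. q N (W \<omega>)) = N"
    if N: "real_distribution N" and [measurable]: "W \<in> borel_measurable M"
      and W: "\<And>s. prob {\<omega> \<in> space M. W \<omega> \<le> s} = (if s < 0 then 0 else clip01 s)" for N W
  proof -
    have "distr M borel W = distr unif borel (\<lambda>x. x)"
    proof -
      interpret u: prob_space unif by (rule prob_space_unif)
      have [measurable]: "(\<lambda>x. x) \<in> borel_measurable unif" by (simp add: unif_def measurable_restrict_space1)
      have "cdf (distr M borel W) s = cdf (distr unif borel (\<lambda>x. x)) s" for s
      proof -
        have "cdf (distr M borel W) s = (if s < 0 then 0 else clip01 s)"
          using W[of s] by (simp add: cdf_def measure_distr vimage_def Int_def conj_commute)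
        moreover have "cdf (distr unif borel (\<lambda>x. x)) s = measure lborel ({..s} \<inter> {0<..<1})"
          by (simp add: cdf_def measure_distr space_unif) (simp add: unif_def measure_restrict_space)
        moreover have "measure lborel ({..s} \<inter> {0<..<1}) = (if s < 0 then 0 else clip01 s)"
        proof -
          consider "s < 0" | "0 \<le> s" "s < 1" | "1 \<le> s" by linarith
          then show ?thesis
          proof cases
            case 1
            then have "{..s} \<inter> {0<..<1} = {}" by auto
            with 1 show ?thesis by simp
          next
            case 2
            then have "{..s} \<inter> {0<..<1} = {0<..s}" by auto
            with 2 show ?thesis by (simp add: clip01_def)
          next
            case 3
            then have "{..s} \<inter> {0<..<1} = {0<..<1}" by auto
            with 3 show ?thesis by (simp add: clip01_def)
          qed
        qed
        ultimately show ?thesis by simp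
      qed
      then show ?thesis by (intro cdf_unique ext) auto
    qed
    then have "distr (distr M borel W) borel (q N) = distr (distr unif borel (\<lambda>x. x)) borel (q N)" by simp
    then have "distr M borel (\<lambda>\<omega>. q N (W \<omega>)) = distr unif borel (q N)"
      using q[OF N] by (simp add: distr_distr comp_def unif_def measurable_restrict_space1)
    also have "\<dots> = distr unif borel (quantile N)"
      by (rule distr_cong) (auto simp: q_def space_unif)
    finally show ?thesis using distr_quantile[OF N] by simp
  qed
  show ?thesis
  proof (rule that)
    show "indep_var borel (\<lambda>\<omega>. q N1 (Ucoord \<omega>)) borel (\<lambda>\<omega>. q N2 (Vcoord \<omega>))"
      using indep_var_compose[OF indep_var_coords q[OF N(1)] q[OF N(2)]] by (simp add: comp_def)
    show "distr M borel (\<lambda>\<omega>. q N1 (Ucoord \<omega>)) = N1"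
      by (rule d[OF N(1)]) (auto simp: prob_Ucoord)
    show "distr M borel (\<lambda>\<omega>. q N2 (Vcoord \<omega>)) = N2"
      by (rule d[OF N(2)]) (auto simp: prob_Vcoord)
  qed (use q N in measurable)
qed

end

section \<open>Gaussian catalysis\<close>

lemma integrable_indicator_Icc [simp]: "integrable lborel (indicator {a..b::real} :: real \<Rightarrow> real)"
  by (rule integrable_real_indicator) (auto simp: emeasure_lborel_Icc_eq)

text \<open>Integration by parts by way of Fubini: h (x) is h (- B) plus the integral of h' over s <
  x, and integrating the indicator of s < x against N leaves 1 - \<open>cdf N s\<close>.\<close>

lemma integral_eq_integral_cdf:
  fixes h h' :: "real \<Rightarrow> real"
  assumes N: "real_distribution N" and B: "0 \<le> B" and bnd: "AE x in N. \<bar>x\<bar> \<le> B"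
    and h: "\<And>x. (h has_real_derivative h' x) (at x)" and h': "continuous_on UNIV h'"
  shows "(\<integral>x. h x \<partial>N) = h (- B) + (\<integral>s. indicator {- B..B} s * (h' s * (1 - cdf N s)) \<partial>lborel)"
proof -
  interpret real_distribution N by fact
  interpret P: pair_sigma_finite N lborel ..
  have [measurable]: "h \<in> borel_measurable borel" "h' \<in> borel_measurable borel"
    using h h' by (auto intro!: borel_measurable_continuous_onI DERIV_continuous_on)
  have [measurable_cong]: "sets N = sets borel" by simp
  have "bounded (h' ` {- B..B})"
    by (intro compact_imp_bounded compact_continuous_image continuous_on_subset[OF h']) auto
  then obtain C where "\<forall>y\<in>h' ` {- B..B}. norm y \<le> C" by (auto simp: bounded_iff)
  then have C: "\<bar>h' x\<bar> \<le> C" if "x \<in> {- B..B}" for x using that by force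
  define f where "f x s = indicator {- B..B} s * (h' s * (if s < x then 1 else 0))" for x s :: real
  have [measurable]: "case_prod f \<in> borel_measurable (N \<Otimes>\<^sub>M lborel)"
    unfolding f_def by measurable
  have fC: "norm (f x s) \<le> C * indicator {- B..B} s" for x s
    using C[of s] by (auto simp: f_def indicator_def)
  have iC: "integrable lborel (\<lambda>s. C * indicator {- B..B} s)" by simp
  have if1: "integrable lborel (f x)" for x
    by (rule Bochner_Integration.integrable_bound[OF iC]) (use fC C[of 0] B in \<open>auto simp: f_def indicator_def\<close>)
  have int: "integrable (N \<Otimes>\<^sub>M lborel) (case_prod f)"
  proof (rule P.Fubini_integrable)
    show "integrable N (\<lambda>x. \<integral>s. norm (case_prod f (x, s)) \<partial>lborel)"
    proof (rule integrable_const_bound[where B = "\<integral>s. C * indicator {- B..B} s \<partial>lborel"])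
      show "AE x in N. norm (\<integral>s. norm (case_prod f (x, s)) \<partial>lborel) \<le> (\<integral>s. C * indicator {- B..B} s \<partial>lborel)"
      proof (rule AE_I2)
        fix x
        have "(\<integral>s. norm (f x s) \<partial>lborel) \<le> (\<integral>s. C * indicator {- B..B} s \<partial>lborel)"
          by (rule integral_mono[OF integrable_norm[OF if1] iC fC])
        then show "norm (\<integral>s. norm (case_prod f (x, s)) \<partial>lborel) \<le> (\<integral>s. C * indicator {- B..B} s \<partial>lborel)"
          by simp
      qed
    qed measurable
  qed (use if1 in auto)
  have inner: "h x = h (- B) + (\<integral>s. f x s \<partial>lborel)" if x: "\<bar>x\<bar> \<le> B" for x
  proof -
    have "(\<integral>s. f x s \<partial>lborel) = (\<integral>s. indicator {- B..x} s *\<^sub>R h' s \<partial>lborel)"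
    proof (rule integral_cong_AE)
      show "AE s in lborel. f x s = indicator {- B..x} s *\<^sub>R h' s"
        using AE_lborel_singleton[of x] by eventually_elim (use x in \<open>auto simp: f_def indicator_def\<close>)
    qed (auto simp: f_def)
    also have "\<dots> = h x - h (- B)"
      using x h h' by (intro integral_FTC_Icc) (auto simp: has_real_derivative_iff_has_vector_derivative[symmetric]
        intro: has_field_derivative_at_within continuous_on_subset)
    finally show ?thesis by simp
  qed
  have "(\<integral>x. h x \<partial>N) = (\<integral>x. h (- B) + (\<integral>s. f x s \<partial>lborel) \<partial>N)"
  proof (rule integral_cong_AE)
    show "AE x in N. h x = h (- B) + (\<integral>s. f x s \<partial>lborel)"
      using bnd by eventually_elim (rule inner)
  qed measurable
  also have "\<dots> = h (- B) + (\<integral>x. (\<integral>s. f x s \<partial>lborel) \<partial>N)"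
    using P.integrable_fst'[OF int] prob_space by simp
  also have "(\<integral>x. (\<integral>s. f x s \<partial>lborel) \<partial>N) = (\<integral>s. (\<integral>x. f x s \<partial>N) \<partial>lborel)"
    by (rule P.Fubini_integral[OF int, symmetric])
  also have "\<dots> = (\<integral>s. indicator {- B..B} s * (h' s * (1 - cdf N s)) \<partial>lborel)"
  proof (rule Bochner_Integration.integral_cong[OF refl])
    fix s :: real
    have "(\<integral>x. f x s \<partial>N) = (\<integral>x. indicator {- B..B} s * h' s * indicator {s<..} x \<partial>N)"
      by (rule Bochner_Integration.integral_cong) (auto simp: f_def indicator_def)
    also have "\<dots> = indicator {- B..B} s * h' s * prob {s<..}" by simp
    also have "prob {s<..} = 1 - cdf N s"
      using prob_compl[of "{..s}"] by (simp add: cdf_def Compl_atMost[symmetric] Compl_eq_Diff_UNIV)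
    finally show "(\<integral>x. f x s \<partial>N) = indicator {- B..B} s * (h' s * (1 - cdf N s))" by simp
  qed
  finally show ?thesis .
qed

lemma integrable_Icc_mult_bounded:
  fixes f D :: "real \<Rightarrow> real"
  assumes "continuous_on UNIV f" and [measurable]: "D \<in> borel_measurable borel" and D: "\<And>x. \<bar>D x\<bar> \<le> 1"
  shows "integrable lborel (\<lambda>x. indicator {a..b} x * (f x * D x))"
proof (rule Bochner_Integration.integrable_bound)
  show "integrable lborel (\<lambda>x. indicator {a..b} x *\<^sub>R f x)"
    using borel_integrable_atLeastAtMost'[OF continuous_on_subset[OF assms(1)], of a b]
    by (simp add: set_integrable_def)
  show "(\<lambda>x. indicator {a..b} x * (f x * D x)) \<in> borel_measurable lborel"
    using borel_measurable_continuous_onI[OF assms(1)] by measurable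
  show "AE x in lborel. norm (indicator {a..b} x * (f x * D x)) \<le> norm (indicator {a..b} x *\<^sub>R f x)"
    using D by (auto simp: abs_mult indicator_def mult_left_le)
qed

text \<open>The bridge from cumulants to dominance: the difference of the \<open>mexp\<close> is the
  two-sided Laplace transform of the difference of the distribution functions.\<close>

lemma mexp_diff_eq_integral_cdf:
  assumes N: "exp_law N1" "exp_law N2" and B: "0 \<le> B" "AE x in N1. \<bar>x\<bar> \<le> B" "AE x in N2. \<bar>x\<bar> \<le> B"
  shows "mexp N1 a - mexp N2 a = (\<integral>s. indicator {- B..B} s * (exp (a * s) * (cdf N2 s - cdf N1 s)) \<partial>lborel)"
proof -
  have *: "integrable lborel (\<lambda>s. indicator {- B..B} s * (exp (a * s) * (1 - cdf N s)))"
    "mexp N a = expint a (- B) + (\<integral>s. indicator {- B..B} s * (exp (a * s) * (1 - cdf N s)) \<partial>lborel)"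
    if N: "exp_law N" "AE x in N. \<bar>x\<bar> \<le> B" for N
  proof -
    interpret cdf_distribution N
      using exp_law_real_distr[OF N(1)] by (simp add: cdf_distribution_def)
    show "integrable lborel (\<lambda>s. indicator {- B..B} s * (exp (a * s) * (1 - cdf N s)))"
      by (rule integrable_Icc_mult_bounded)
         (auto intro!: continuous_intros simp: cdf_nonneg cdf_bounded_prob abs_le_iff le_diff_eq)
    show "mexp N a = expint a (- B) + (\<integral>s. indicator {- B..B} s * (exp (a * s) * (1 - cdf N s)) \<partial>lborel)"
      unfolding mexp_def
      by (rule integral_eq_integral_cdf)
         (auto intro!: real_distribution_axioms B N expint_DERIV continuous_intros)
  qed
  show ?thesis
    unfolding *(2)[OF N(1) B(2)] *(2)[OF N(2) B(3)]
    by (simp add: Bochner_Integration.integral_diff[OF *(1)[OF N(1) B(2)] *(1)[OF N(2) B(3)], symmetric])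
       (auto intro!: Bochner_Integration.integral_cong simp: algebra_simps)
qed

text \<open>For a large positive tilt \<open>a\<close> the weight sits at the right end, where \<open>D\<close> is nonnegative.\<close>

lemma tilted_integral_pos:
  fixes D :: "real \<Rightarrow> real"
  assumes [measurable]: "D \<in> borel_measurable borel" and D: "\<And>x. \<bar>D x\<bar> \<le> 1"
    and uvw: "- B \<le> u" "u < v" "v < w" "w \<le> B" and c: "0 < c"
    and Du: "\<And>x. u \<le> x \<Longrightarrow> 0 \<le> D x" and Dc: "\<And>x. v \<le> x \<Longrightarrow> x \<le> w \<Longrightarrow> c \<le> D x"
  obtains A where "0 \<le> A" "\<And>a s. A \<le> a \<Longrightarrow> 0 \<le> s \<Longrightarrow> s \<le> 1 \<Longrightarrow>
    0 < (\<integral>x. indicator {- B..B} x * (exp (a * x - s * x\<^sup>2) * D x) \<partial>lborel)"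
proof -
  \<comment> \<open>The gain on [v, w] is at least c (w - v) exp (a v - B^2), and the loss to the
    left of u is at most 2 B exp (a u). The gain prevails once exp (a (v - u)) > R, for which a (v -
    u) \<ge> R is enough.\<close>
  define R where "R = 2 * B * exp (B\<^sup>2) / (c * (w - v))"
  have "0 \<le> R" using uvw c by (auto simp: R_def intro!: divide_nonneg_nonneg)
  show ?thesis
  proof (rule that[of "R / (v - u)"])
    show "0 \<le> R / (v - u)" using \<open>0 \<le> R\<close> uvw by simp
    fix a s :: real assume a: "R / (v - u) \<le> a" and s: "0 \<le> s" "s \<le> 1"
    have "0 \<le> a" using a \<open>0 \<le> R / (v - u)\<close> by linarith
    let ?l = "\<lambda>x. c * exp (a * v - B\<^sup>2) * indicator {v..w} x - exp (a * u) * indicator {- B..B} x"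
    have i: "integrable lborel (\<lambda>x. c * exp (a * v - B\<^sup>2) * indicator {v..w} x)"
      "integrable lborel (\<lambda>x. exp (a * u) * indicator {- B..B} x :: real)"
      by auto
    have "R \<le> a * (v - u)" using a uvw by (simp add: field_simps)
    then have "R < exp (a * (v - u))" using exp_ge_add_one_self[of "a * (v - u)"] by linarith
    then have "2 * B * exp (B\<^sup>2) < exp (a * (v - u)) * (c * (w - v))"
      using uvw c by (simp add: R_def field_simps)
    then have "exp (a * u - B\<^sup>2) * (2 * B * exp (B\<^sup>2)) < exp (a * u - B\<^sup>2) * (exp (a * (v - u)) * (c * (w - v)))"
      by (rule mult_strict_left_mono) simp
    also have "exp (a * u - B\<^sup>2) * (2 * B * exp (B\<^sup>2)) = exp (a * u) * (2 * B)"
      by (simp add: exp_diff)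
    also have "exp (a * u - B\<^sup>2) * (exp (a * (v - u)) * (c * (w - v))) = c * exp (a * v - B\<^sup>2) * (w - v)"
    proof -
      have "exp (a * u - B\<^sup>2) * exp (a * (v - u)) = exp (a * v - B\<^sup>2)"
        by (simp add: exp_add[symmetric] algebra_simps)
      then show ?thesis by (metis mult.assoc mult.commute)
    qed
    finally have "0 < c * exp (a * v - B\<^sup>2) * (w - v) - exp (a * u) * (2 * B)" by simp
    also have "\<dots> = (\<integral>x. ?l x \<partial>lborel)"
      using uvw by (subst Bochner_Integration.integral_diff[OF i]) simp
    also have "\<dots> \<le> (\<integral>x. indicator {- B..B} x * (exp (a * x - s * x\<^sup>2) * D x) \<partial>lborel)"
    proof (rule integral_mono)
      show "integrable lborel ?l" using i by (intro Bochner_Integration.integrable_diff) auto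
      show "integrable lborel (\<lambda>x. indicator {- B..B} x * (exp (a * x - s * x\<^sup>2) * D x))"
        by (rule integrable_Icc_mult_bounded) (use D in \<open>auto intro!: continuous_intros\<close>)
      fix x
      consider "x \<notin> {- B..B}" | "- B \<le> x" "x < u" | "x \<in> {v..w}" | "u \<le> x" "x \<le> B" "x \<notin> {v..w}"
        using uvw by force
      then show "?l x \<le> indicator {- B..B} x * (exp (a * x - s * x\<^sup>2) * D x)"
      proof cases
        case 1
        then show ?thesis using uvw by (auto simp: indicator_def)
      next
        case 2
        have "a * x - s * x\<^sup>2 \<le> a * u"
          using mult_left_mono[of x u a] \<open>0 \<le> a\<close> 2 mult_nonneg_nonneg[OF s(1) zero_le_power2[of x]] by linarith
        then have "exp (a * x - s * x\<^sup>2) \<le> exp (a * u)" by simp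
        moreover have "exp (a * x - s * x\<^sup>2) * (- D x) \<le> exp (a * x - s * x\<^sup>2) * 1"
          using D[of x] by (intro mult_left_mono) (auto simp: abs_le_iff)
        ultimately have "- exp (a * u) \<le> exp (a * x - s * x\<^sup>2) * D x" unfolding mult_minus_right by linarith
        then show ?thesis using 2 uvw by (simp add: indicator_def)
      next
        case 3
        have "x\<^sup>2 \<le> B\<^sup>2" using 3 uvw by (intro abs_le_square_iff[THEN iffD1]) auto
        then have "s * x\<^sup>2 \<le> 1 * B\<^sup>2" using s by (intro mult_mono) auto
        moreover have "a * v \<le> a * x" using 3 \<open>0 \<le> a\<close> by (intro mult_left_mono) auto
        ultimately have "c * exp (a * v - B\<^sup>2) \<le> D x * exp (a * x - s * x\<^sup>2)"
          using Dc[of x] 3 c by (intro mult_mono) auto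
        moreover have "0 < exp (a * u)" by simp
        ultimately have "c * exp (a * v - B\<^sup>2) - exp (a * u) \<le> D x * exp (a * x - s * x\<^sup>2)" by linarith
        then show ?thesis using 3 uvw by (simp add: indicator_def mult.commute[of _ "D x"])
      next
        case 4
        then show ?thesis using Du[of x] uvw by (auto simp: indicator_def intro: order_trans[of _ 0])
      qed
    qed
    finally show "0 < (\<integral>x. indicator {- B..B} x * (exp (a * x - s * x\<^sup>2) * D x) \<partial>lborel)" .
  qed
qed

text \<open>For large |a| the sign is decided at the ends of the interval, uniformly in s \<le> 1,
  by \<open>tilted_integral_pos\<close> and its mirror image. On the remaining compact range of a, g
  has a positive minimum, which a small s cannot use up.\<close>

lemma gauss_tilted_integral_pos:
  fixes D :: "real \<Rightarrow> real"
  assumes [measurable]: "D \<in> borel_measurable borel" and D: "\<And>x. \<bar>D x\<bar> \<le> 1"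
    and g: "g = (\<lambda>a. \<integral>x. indicator {- B..B} x * (exp (a * x) * D x) \<partial>lborel)"
    and pos: "\<And>a. 0 < g a" and cont: "continuous_on UNIV g"
    and uvw: "- B \<le> u" "u < v" "v < w" "w \<le> B" and c: "0 < c"
    and Du: "\<And>x. u \<le> x \<Longrightarrow> 0 \<le> D x" and Dc: "\<And>x. v \<le> x \<Longrightarrow> x \<le> w \<Longrightarrow> c \<le> D x"
    and uvw': "u' \<le> B" "v' < u'" "w' < v'" "- B \<le> w'" and c': "0 < c'"
    and Du': "\<And>x. x \<le> u' \<Longrightarrow> 0 \<le> D x" and Dc': "\<And>x. w' \<le> x \<Longrightarrow> x \<le> v' \<Longrightarrow> c' \<le> D x"
  obtains s where "0 < s" "\<And>a. 0 < (\<integral>x. indicator {- B..B} x * (exp (a * x - s * x\<^sup>2) * D x) \<partial>lborel)"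
proof -
  let ?G = "\<lambda>D a s. \<integral>x. indicator {- B..B} x * (exp (a * x - s * x\<^sup>2) * D x) \<partial>lborel"
  have B: "0 < B" using uvw by linarith
  obtain A1 where A1: "0 \<le> A1" "\<And>a s. A1 \<le> a \<Longrightarrow> 0 \<le> s \<Longrightarrow> s \<le> 1 \<Longrightarrow> 0 < ?G D a s"
    using tilted_integral_pos[OF assms(1) D uvw c Du Dc] by blast
  obtain A2 where A2: "0 \<le> A2" "\<And>a s. A2 \<le> a \<Longrightarrow> 0 \<le> s \<Longrightarrow> s \<le> 1 \<Longrightarrow> 0 < ?G (\<lambda>x. D (- x)) a s"
    by (rule tilted_integral_pos[of "\<lambda>x. D (- x)" B "- u'" "- v'" "- w'" c'])
       (use D uvw' c' Du' Dc' in auto)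
  have flip: "?G (\<lambda>x. D (- x)) a s = ?G D (- a) s" for a s
  proof -
    have "?G (\<lambda>x. D (- x)) a s = (\<integral>x. indicator {- B..B} (- x) * (exp (a * (- x) - s * (- x)\<^sup>2) * D x) \<partial>lborel)"
      using lborel_integral_real_affine[of "-1" "\<lambda>x. indicator {- B..B} x * (exp (a * x - s * x\<^sup>2) * D (- x))" 0] by simp
    also have "\<dots> = ?G D (- a) s"
    proof (rule Bochner_Integration.integral_cong[OF refl])
      fix x
      have "indicator {- B..B} (- x) = (indicator {- B..B} x :: real)" by (simp add: indicator_def) linarith
      then show "indicator {- B..B} (- x) * (exp (a * (- x) - s * (- x)\<^sup>2) * D x) = indicator {- B..B} x * (exp (- a * x - s * x\<^sup>2) * D x)"
        by simp
    qed
    finally show ?thesis .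
  qed
  define A where "A = max A1 A2"
  have "continuous_on {- A..A} g" by (rule continuous_on_subset[OF cont]) auto
  moreover have "{- A..A} \<noteq> {}" using A1(1) by (simp add: A_def)
  ultimately obtain a0 where a0: "a0 \<in> {- A..A}" "\<And>a. a \<in> {- A..A} \<Longrightarrow> g a0 \<le> g a"
    using continuous_attains_inf[of "{- A..A}" g] by auto
  \<comment> \<open>On [-B, B], exp (a x) (1 - exp (- s x^2)) is at most exp (A B) s B^2; over the
    length 2 B this makes the total change at most s L.\<close>
  define L where "L = 2 * B * (exp (A * B) * B\<^sup>2)"
  have L: "0 < L" using B by (simp add: L_def)
  define s where "s = min 1 (g a0 / (2 * L))"
  have s: "0 < s" "s \<le> 1" "s * L < g a0"
  proof -
    show "0 < s" "s \<le> 1" using pos[of a0] L by (auto simp: s_def)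
    have "s * L \<le> g a0 / (2 * L) * L" using L by (intro mult_right_mono) (auto simp: s_def)
    then show "s * L < g a0" using L pos[of a0] by simp
  qed
  have mid: "0 < ?G D a s" if a: "a \<in> {- A..A}" for a
  proof -
    have i1: "integrable lborel (\<lambda>x. indicator {- B..B} x * (exp (a * x) * D x))"
      and i2: "integrable lborel (\<lambda>x. indicator {- B..B} x * (exp (a * x - s * x\<^sup>2) * D x))"
      by (rule integrable_Icc_mult_bounded, use D in \<open>auto intro!: continuous_intros\<close>)+
    have "g a - ?G D a s = (\<integral>x. indicator {- B..B} x * (exp (a * x) * D x) - indicator {- B..B} x * (exp (a * x - s * x\<^sup>2) * D x) \<partial>lborel)"
      unfolding g by (rule Bochner_Integration.integral_diff[OF i1 i2, symmetric])
    also have "\<dots> \<le> (\<integral>x. (exp (A * B) * (s * B\<^sup>2)) * indicator {- B..B} x \<partial>lborel)"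
    proof (rule integral_mono)
      fix x
      show "indicator {- B..B} x * (exp (a * x) * D x) - indicator {- B..B} x * (exp (a * x - s * x\<^sup>2) * D x)
        \<le> (exp (A * B) * (s * B\<^sup>2)) * indicator {- B..B} x"
      proof (cases "x \<in> {- B..B}")
        case True
        have "a * x \<le> \<bar>a\<bar> * \<bar>x\<bar>" by (simp add: abs_mult[symmetric])
        also have "\<dots> \<le> A * B" using a True by (intro mult_mono) auto
        finally have e: "exp (a * x) \<le> exp (A * B)" by simp
        have "x\<^sup>2 \<le> B\<^sup>2" using True by (intro abs_le_square_iff[THEN iffD1]) auto
        then have "s * x\<^sup>2 \<le> s * B\<^sup>2" using s by (intro mult_left_mono) auto
        then have q: "1 - exp (- (s * x\<^sup>2)) \<le> s * B\<^sup>2" using exp_ge_add_one_self[of "- (s * x\<^sup>2)"] by linarith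
        have q0: "0 \<le> 1 - exp (- (s * x\<^sup>2))" using s by simp
        have "exp (a * x) * D x - exp (a * x - s * x\<^sup>2) * D x = (exp (a * x) * (1 - exp (- (s * x\<^sup>2)))) * D x"
          by (simp add: exp_diff exp_minus field_simps)
        also have "\<dots> \<le> (exp (a * x) * (1 - exp (- (s * x\<^sup>2)))) * 1"
          using D[of x] q0 by (intro mult_left_mono) auto
        also have "\<dots> \<le> exp (A * B) * (s * B\<^sup>2)"
          using e q q0 by (simp add: mult_mono)
        finally show ?thesis using True by simp
      qed simp
    qed (use i1 i2 in auto)
    also have "\<dots> = s * L" using B by (simp add: L_def)
    finally have "g a - ?G D a s \<le> s * L" .
    with s(3) a0(2)[OF a] show ?thesis by linarith
  qed
  show ?thesis
  proof (rule that[OF s(1)])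
    fix a
    have "a \<in> {- A..A} \<or> A1 \<le> a \<or> A2 \<le> - a"
      using max.cobounded1[of A1 A2] max.cobounded2[of A2 A1] unfolding A_def atLeastAtMost_iff by linarith
    then consider "a \<in> {- A..A}" | "A1 \<le> a" | "A2 \<le> - a" by blast
    then show "0 < ?G D a s"
    proof cases
      case 1
      then show ?thesis by (rule mid)
    next
      case 2
      then show ?thesis using s by (intro A1(2)) auto
    next
      case 3
      then have "0 < ?G (\<lambda>x. D (- x)) (- a) s" using s by (intro A2(2)) auto
      then show ?thesis unfolding flip by simp
    qed
  qed
qed

section \<open>Convolution with centred normal laws\<close>

definition gauss :: "real \<Rightarrow> real measure" where
  "gauss \<sigma> = density lborel (normal_density 0 \<sigma>)"

lemma exp_law_gauss:
  assumes "0 < \<sigma>"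
  shows "exp_law (gauss \<sigma>)"
proof -
  have "integrable lborel (\<lambda>x. normal_density 0 \<sigma> x * exp (a * x))" for a
  proof -
    have "normal_density 0 \<sigma> x * exp (a * x) = exp (a\<^sup>2 * \<sigma>\<^sup>2 / 2) * normal_density (a * \<sigma>\<^sup>2) \<sigma> x" for x
    proof -
      have "- x\<^sup>2 / (2 * \<sigma>\<^sup>2) + a * x = a\<^sup>2 * \<sigma>\<^sup>2 / 2 + (- (x - a * \<sigma>\<^sup>2)\<^sup>2 / (2 * \<sigma>\<^sup>2))"
        using assms by (simp add: field_simps power2_eq_square)
      then have "exp (- x\<^sup>2 / (2 * \<sigma>\<^sup>2)) * exp (a * x) = exp (a\<^sup>2 * \<sigma>\<^sup>2 / 2) * exp (- (x - a * \<sigma>\<^sup>2)\<^sup>2 / (2 * \<sigma>\<^sup>2))"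
        unfolding exp_add[symmetric] by simp
      then show ?thesis by (simp add: normal_density_def)
    qed
    then show ?thesis using integrable_normal_density[OF assms] by simp
  qed
  then show ?thesis
    unfolding exp_law_def gauss_def
    using prob_space_normal_density[OF assms] by (simp add: integrable_density)
qed

lemma cdf_gauss_convolution:
  assumes N: "exp_law N" and \<sigma>: "0 < \<sigma>"
  shows "integrable lborel (\<lambda>x. normal_density 0 \<sigma> (t - x) * cdf N x)"
    and "cdf (gauss \<sigma> \<star> N) t = (\<integral>x. normal_density 0 \<sigma> (t - x) * cdf N x \<partial>lborel)"
proof -
  interpret N: cdf_distribution N
    using exp_law_real_distr[OF N] by (simp add: cdf_distribution_def)
  interpret G: prob_space "gauss \<sigma>" by (rule exp_lawD[OF exp_law_gauss[OF \<sigma>]])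
  interpret C: prob_space "gauss \<sigma> \<star> N" by (rule exp_lawD[OF exp_law_convolution[OF exp_law_gauss[OF \<sigma>] N]])
  have [simp, measurable_cong]: "sets (gauss \<sigma>) = sets borel" by (simp add: gauss_def)
  have [simp]: "space (gauss \<sigma>) = UNIV" by (simp add: gauss_def)
  have ig: "integrable lborel (\<lambda>z. normal_density 0 \<sigma> z * cdf N (t - z))"
    by (rule Bochner_Integration.integrable_bound[OF integrable_normal_density[OF \<sigma>, of 0]])
       (auto simp: abs_mult N.cdf_nonneg N.cdf_bounded_prob mult_left_le)
  have sub: "(\<lambda>z. normal_density 0 \<sigma> (t - (t + - 1 * z)) * cdf N (t + - 1 * z)) = (\<lambda>z. normal_density 0 \<sigma> z * cdf N (t - z))"
    by simp
  show "integrable lborel (\<lambda>x. normal_density 0 \<sigma> (t - x) * cdf N x)"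
    using lborel_integrable_real_affine_iff[of "-1" "\<lambda>x. normal_density 0 \<sigma> (t - x) * cdf N x" t] ig
    unfolding sub by simp
  have "emeasure (gauss \<sigma> \<star> N) {..t} = (\<integral>\<^sup>+z. emeasure N {a. a + z \<in> {..t}} \<partial>gauss \<sigma>)"
    by (rule convolution_emeasure) (auto simp: G.finite_measure_axioms N.finite_measure_axioms)
  also have "\<dots> = (\<integral>\<^sup>+z. ennreal (cdf N (t - z)) \<partial>gauss \<sigma>)"
    by (intro nn_integral_cong) (auto simp: N.emeasure_eq_measure cdf_def le_diff_eq intro!: arg_cong[where f = "measure N"])
  also have "\<dots> = ennreal (\<integral>z. cdf N (t - z) \<partial>gauss \<sigma>)"
    by (rule nn_integral_eq_integral)
       (auto intro!: G.integrable_const_bound[where B = 1] simp: N.cdf_nonneg N.cdf_bounded_prob)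
  finally have "cdf (gauss \<sigma> \<star> N) t = (\<integral>z. cdf N (t - z) \<partial>gauss \<sigma>)"
    by (simp add: cdf_def[of "gauss \<sigma> \<star> N"] C.emeasure_eq_measure Bochner_Integration.integral_nonneg N.cdf_nonneg)
  also have "\<dots> = (\<integral>z. normal_density 0 \<sigma> z * cdf N (t - z) \<partial>lborel)"
    unfolding gauss_def by (subst integral_density) auto
  also have "\<dots> = (\<integral>x. normal_density 0 \<sigma> (t - x) * cdf N x \<partial>lborel)"
    using lborel_integral_real_affine[of "-1" "\<lambda>x. normal_density 0 \<sigma> (t - x) * cdf N x" t]
    unfolding sub by simp
  finally show "cdf (gauss \<sigma> \<star> N) t = (\<integral>x. normal_density 0 \<sigma> (t - x) * cdf N x \<partial>lborel)" .
qed

lemma KL_le_of_AE_le: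
  assumes "exp_law N" "AE x in N. x \<le> b"
  shows "KL N a \<le> b"
proof -
  interpret prob_space N by (rule exp_lawD[OF assms(1)])
  have "mexp N a \<le> (\<integral>x. expint a b \<partial>N)"
    unfolding mexp_def
    using assms(2) by (intro integral_mono_AE exp_law_integrable_expint assms) (auto elim!: eventually_mono intro: expint_mono)
  also have "\<dots> = mexp (return borel b) a"
    by (simp add: prob_space mexp_def integral_return)
  finally have "KL N a \<le> KL (return borel b) a" using KL_le_iff[OF assms(1) exp_law_return] by blast
  then show ?thesis by simp
qed

lemma cdf_eq_1_iff:
  assumes "real_distribution N"
  shows "cdf N x = 1 \<longleftrightarrow> (AE y in N. y \<le> x)"
proof -
  interpret real_distribution N by fact
  show ?thesis by (simp add: cdf_def prob_eq_1)
qed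

lemma cdf_eq_0_of_AE_gt:
  assumes "real_distribution N" "AE y in N. x < y"
  shows "cdf N x = 0"
proof -
  interpret real_distribution N by fact
  show ?thesis using assms(2) by (simp add: cdf_def prob_eq_0 not_le)
qed

lemma KL_ge_of_AE_ge:
  assumes "exp_law N" "AE x in N. b \<le> x"
  shows "b \<le> KL N a"
proof -
  have "sets N = sets borel" by (rule exp_lawD[OF assms(1)])
  then have "AE x in reflect N. x \<le> - b"
    unfolding reflect_def using assms(2) by (subst AE_distr_iff) (auto cong: measurable_cong_sets)
  from KL_le_of_AE_le[OF exp_law_reflect[OF assms(1)] this, of "- a"]
  show ?thesis by (simp add: KL_reflect assms)
qed

text \<open>A Gaussian of large variance is a catalyst: with \<open>D = cdf N2 - cdf N1\<close>, completing the square turns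
  the difference of the convolved distribution functions at \<open>t\<close> into a positive multiple of
  \<open>\<integral>D(x) exp (2 s t x - s x\<^sup>2) dx\<close>, a perturbation of \<open>\<integral>D(x) exp (a x) dx = mexp N1 a - mexp N2 a\<close>.\<close>

lemma gaussian_catalyst:
  assumes N: "exp_law N1" "exp_law N2" and bnd: "AE x in N1. \<bar>x\<bar> \<le> B" "AE x in N2. \<bar>x\<bar> \<le> B"
    and less: "\<And>a. KL N2 a < KL N1 a"
    and right: "AE x in N2. x \<le> u" "u < KL N1 a1"
    and left: "AE x in N1. l \<le> x" "KL N2 a2 < l"
  obtains \<sigma> where "0 < \<sigma>" "\<And>t. cdf (gauss \<sigma> \<star> N1) t \<le> cdf (gauss \<sigma> \<star> N2) t"
proof -
  interpret N1: cdf_distribution N1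
    using exp_law_real_distr[OF N(1)] by (simp add: cdf_distribution_def)
  interpret N2: cdf_distribution N2
    using exp_law_real_distr[OF N(2)] by (simp add: cdf_distribution_def)
  note rd = N1.real_distribution_axioms N2.real_distribution_axioms
  define D where "D x = cdf N2 x - cdf N1 x" for x
  have Dm [measurable]: "D \<in> borel_measurable borel" unfolding D_def by measurable
  have D1: "\<bar>D x\<bar> \<le> 1" for x
    using N1.cdf_nonneg[of x] N2.cdf_nonneg[of x] N1.cdf_bounded_prob[of x] N2.cdf_bounded_prob[of x]
    by (auto simp: D_def abs_le_iff)
  \<comment> \<open>A cumulant of N1 lies above w, so N1 has mass beyond w; N2 has none beyond u.
    Hence D \<ge> 1 - \<open>cdf N1 w\<close> > 0 on [v, w].\<close>
  define w where "w = (u + KL N1 a1) / 2"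
  define v where "v = (u + w) / 2"
  \<comment> \<open>On the left the interval must stay strictly below l, since N1 may have an atom
    at l that makes \<open>cdf N1\<close> positive there. Hence the extra point u' < l, whereas u
    itself can serve on the right.\<close>
  define w' where "w' = (l + 2 * KL N2 a2) / 3"
  define u' where "u' = (2 * l + KL N2 a2) / 3"
  have uvw: "u < v" "v < w" "w < KL N1 a1" using right(2) by (auto simp: v_def w_def field_simps)
  have uvw': "u' < l" "w' < u'" "KL N2 a2 < w'" using left(2) by (auto simp: u'_def w'_def field_simps)
  define v' where "v' = (u' + w') / 2"
  have v': "v' < u'" "w' < v'" using uvw' by (auto simp: v'_def field_simps)
  define B' where "B' = 1 + \<bar>B\<bar> + \<bar>u\<bar> + \<bar>w\<bar> + \<bar>u'\<bar> + \<bar>w'\<bar>"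
  have B': "1 \<le> B'" "B \<le> B'" "\<bar>u\<bar> \<le> B'" "\<bar>w\<bar> \<le> B'" "\<bar>u'\<bar> \<le> B'" "\<bar>w'\<bar> \<le> B'"
    unfolding B'_def by linarith+
  have bnd': "AE x in N1. \<bar>x\<bar> \<le> B'" "AE x in N2. \<bar>x\<bar> \<le> B'"
    using bnd B'(2) by (auto elim!: eventually_mono)
  define g where "g = (\<lambda>a. \<integral>x. indicator {- B'..B'} x * (exp (a * x) * D x) \<partial>lborel)"
  have g: "g = (\<lambda>a. mexp N1 a - mexp N2 a)"
    using mexp_diff_eq_integral_cdf[OF N _ bnd'] B'(1) by (auto simp: g_def D_def)
  have gpos: "0 < g a" for a
    using less[of a] by (simp add: g KL_less_iff N)
  have gcont: "continuous_on UNIV g"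
    unfolding g by (intro continuous_at_imp_continuous_on ballI continuous_diff isCont_mexp N)
  have cdf2: "cdf N2 x = 1" if "u \<le> x" for x
    using right(1) that by (subst cdf_eq_1_iff[OF rd(2)]) (auto elim!: eventually_mono)
  have cdf1: "cdf N1 w < 1"
  proof (rule ccontr)
    assume "\<not> cdf N1 w < 1"
    then have "cdf N1 w = 1" using N1.cdf_bounded_prob[of w] by simp
    then have "KL N1 a1 \<le> w" using KL_le_of_AE_le[OF N(1)] by (simp add: cdf_eq_1_iff[OF rd(1)])
    with uvw show False by simp
  qed
  have cdf1': "cdf N1 x = 0" if "x < l" for x
    using left(1) that by (intro cdf_eq_0_of_AE_gt rd) (auto elim!: eventually_mono)
  have cdf2': "0 < cdf N2 w'"
  proof (rule ccontr)
    assume "\<not> 0 < cdf N2 w'"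
    then have "cdf N2 w' = 0" using N2.cdf_nonneg[of w'] by simp
    then have "AE x in N2. w' \<le> x" by (simp add: cdf_def N2.prob_eq_0) (auto elim!: eventually_mono)
    then have "w' \<le> KL N2 a2" by (rule KL_ge_of_AE_ge[OF N(2)])
    with uvw' show False by simp
  qed
  obtain s where s: "0 < s" "\<And>a. 0 < (\<integral>x. indicator {- B'..B'} x * (exp (a * x - s * x\<^sup>2) * D x) \<partial>lborel)"
  proof (rule gauss_tilted_integral_pos[OF Dm D1 g_def gpos gcont])
    show "- B' \<le> u" "u < v" "v < w" "w \<le> B'" "u' \<le> B'" "v' < u'" "w' < v'" "- B' \<le> w'"
      using B' uvw v' by auto
    show "0 < 1 - cdf N1 w" "0 < cdf N2 w'" using cdf1 cdf2' by auto
    show "0 \<le> D x" if "u \<le> x" for x using cdf2[OF that] N1.cdf_bounded_prob[of x] by (simp add: D_def)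
    show "1 - cdf N1 w \<le> D x" if "v \<le> x" "x \<le> w" for x
      using cdf2[of x] that uvw N1.cdf_nondecreasing[OF that(2)] by (simp add: D_def)
    show "0 \<le> D x" if "x \<le> u'" for x
      using cdf1'[of x] that uvw' N2.cdf_nonneg[of x] by (simp add: D_def)
    show "cdf N2 w' \<le> D x" if "w' \<le> x" "x \<le> v'" for x
      using cdf1'[of x] that uvw' v' N2.cdf_nondecreasing[OF that(1)] by (simp add: D_def)
  qed (rule that)
  have Dout: "D x = 0" if "x \<notin> {- B'..B'}" for x
  proof (cases "x < - B'")
    case True
    then have "cdf N1 x = 0" "cdf N2 x = 0"
      using bnd' by (auto intro!: cdf_eq_0_of_AE_gt rd elim!: eventually_mono)
    then show ?thesis by (simp add: D_def)
  next
    case False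
    then have "B' \<le> x" using that by auto
    then have "cdf N1 x = 1" "cdf N2 x = 1"
      using bnd' by (auto simp: cdf_eq_1_iff rd elim!: eventually_mono)
    then show ?thesis by (simp add: D_def)
  qed
  \<comment> \<open>This makes s the coefficient of the square in the normal density, so small s
    means large variance. The tilt at t is 2 s t, and positivity for every tilt covers every
    t.\<close>
  define \<sigma> where "\<sigma> = sqrt (1 / (2 * s))"
  have \<sigma>: "0 < \<sigma>" "\<sigma>\<^sup>2 = 1 / (2 * s)" using s(1) by (auto simp: \<sigma>_def)
  show ?thesis
  proof (rule that[OF \<sigma>(1)])
    fix t
    let ?c = "exp (- (s * t\<^sup>2)) / sqrt (2 * pi * \<sigma>\<^sup>2)"
    have nd: "normal_density 0 \<sigma> (t - x) = ?c * exp (2 * s * t * x - s * x\<^sup>2)" for x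
    proof -
      have "- (t - x)\<^sup>2 / (2 * \<sigma>\<^sup>2) = - (s * t\<^sup>2) + (2 * s * t * x - s * x\<^sup>2)"
        unfolding \<sigma>(2) using s(1) by (simp add: power2_eq_square algebra_simps)
      then have "exp (- (t - x)\<^sup>2 / (2 * \<sigma>\<^sup>2)) = exp (- (s * t\<^sup>2)) * exp (2 * s * t * x - s * x\<^sup>2)"
        by (simp only: exp_add)
      then show ?thesis by (simp add: normal_density_def)
    qed
    let ?n = "\<lambda>x. normal_density 0 \<sigma> (t - x)"
    let ?G = "\<lambda>x. indicator {- B'..B'} x * (exp ((2 * s * t) * x - s * x\<^sup>2) * D x)"
    have "cdf (gauss \<sigma> \<star> N2) t - cdf (gauss \<sigma> \<star> N1) t = (\<integral>x. ?n x * cdf N2 x - ?n x * cdf N1 x \<partial>lborel)"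
      unfolding cdf_gauss_convolution(2)[OF N(1) \<sigma>(1)] cdf_gauss_convolution(2)[OF N(2) \<sigma>(1)]
      by (rule Bochner_Integration.integral_diff[OF cdf_gauss_convolution(1)[OF N(2) \<sigma>(1)] cdf_gauss_convolution(1)[OF N(1) \<sigma>(1)], symmetric])
    also have "\<dots> = (\<integral>x. ?c * ?G x \<partial>lborel)"
    proof (rule Bochner_Integration.integral_cong[OF refl])
      fix x
      have "?n x * cdf N2 x - ?n x * cdf N1 x = ?n x * D x"
        by (simp add: D_def right_diff_distrib)
      also have "\<dots> = ?c * ?G x"
        using Dout[of x] by (cases "x \<in> {- B'..B'}") (simp_all add: nd)
      finally show "?n x * cdf N2 x - ?n x * cdf N1 x =
        ?c * ?G x" .
    qed
    also have "\<dots> = ?c * (\<integral>x. ?G x \<partial>lborel)"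
      by (rule integral_mult_right_zero)
    also have "0 \<le> \<dots>" using s(2)[of "2 * s * t"] by (intro mult_nonneg_nonneg) auto
    finally show "cdf (gauss \<sigma> \<star> N1) t \<le> cdf (gauss \<sigma> \<star> N2) t" by simp
  qed
qed

text \<open>Additivity lets the value of the catalyst cancel.\<close>

lemma (in law_statistic) catalytic_mono:
  assumes N: "exp_law N1" "exp_law N2" and "AE x in N1. \<bar>x\<bar> \<le> B" "AE x in N2. \<bar>x\<bar> \<le> B"
    and "\<And>a. KL N2 a < KL N1 a"
    and "AE x in N2. x \<le> u" "u < KL N1 a1" and "AE x in N1. l \<le> x" "KL N2 a2 < l"
  shows "\<phi> N2 \<le> \<phi> N1"
proof -
  obtain \<sigma> where \<sigma>: "0 < \<sigma>" "\<And>t. cdf (gauss \<sigma> \<star> N1) t \<le> cdf (gauss \<sigma> \<star> N2) t"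
    using gaussian_catalyst[OF assms] by blast
  have "\<phi> (gauss \<sigma> \<star> N2) \<le> \<phi> (gauss \<sigma> \<star> N1)"
    by (rule mono) (auto intro: \<sigma> exp_law_convolution exp_law_gauss N)
  then show ?thesis by (simp add: add exp_law_gauss \<sigma> N)
qed

section \<open>Domination on a compact set of parameters\<close>

lemma quantile_nonneg:
  assumes N: "real_distribution N" "AE x in N. 0 \<le> x" and u: "u \<in> {0<..<1}"
  shows "0 \<le> quantile N u"
proof (rule ccontr)
  assume "\<not> 0 \<le> quantile N u"
  then obtain x where x: "quantile N u \<le> x" "x < 0" by (meson linorder_not_le order_refl)
  then have "u \<le> cdf N x" using quantile_le_iff[OF N(1) u] by simp
  moreover have "cdf N x = 0"
    using N(2) by (intro cdf_eq_0_of_AE_gt[OF N(1)], eventually_elim) (use x in simp)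
  ultimately show False using u by simp
qed

lemma AE_return_borel: "P c \<Longrightarrow> Measurable.pred borel P \<Longrightarrow> AE x in return borel c. P x"
  by (subst AE_return) auto

lemma expectation_exp_conv_pow:
  assumes "exp_law N"
  shows "(\<integral>x. exp (a * x) \<partial>conv_pow n N) = (\<integral>x. exp (a * x) \<partial>N) ^ n"
  by (induction n) (simp_all add: integral_return convolution_exp exp_law_conv_pow assms)

lemma AE_conv_pow_nonneg:
  assumes "exp_law N" "AE x in N. 0 \<le> x"
  shows "AE x in conv_pow n N. 0 \<le> x"
proof (induction n)
  case (Suc n)
  show ?case unfolding conv_pow.simps
    by (rule AE_convolution[OF assms(1) exp_law_conv_pow[OF assms(1)] assms(2) Suc]) auto
next
  case 0
  show ?case unfolding conv_pow.simps by (rule AE_return_borel) auto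
qed

lemma AE_conv_pow_abs_le:
  assumes "exp_law N" "AE x in N. \<bar>x\<bar> \<le> B"
  shows "AE x in conv_pow n N. \<bar>x\<bar> \<le> real n * B"
proof (induction n)
  case (Suc n)
  show ?case unfolding conv_pow.simps
    by (rule AE_convolution[OF assms(1) exp_law_conv_pow[OF assms(1)] assms(2) Suc])
       (auto simp: algebra_simps)
next
  case 0
  show ?case unfolding conv_pow.simps by (rule AE_return_borel) auto
qed

text \<open>If \<open>\<phi>\<close> stayed above \<open>e\<close> on ever rarer laws \<open>R j\<close>, the supremum of the quantile functions of
  their \<open>(j + 1)\<close>-fold convolutions would be a law with all exponential moments and infinite \<open>\<phi>\<close>.\<close>

lemma (in law_statistic) rare_laws_small:
  assumes R: "\<And>j. exp_law (R j)" and R0: "\<And>j. AE x in R j. 0 \<le> x"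
    and small: "\<And>j. (\<integral>x. exp (real j * x) \<partial>R j) \<le> exp ((1 / 2) ^ j / real (Suc j))" and e: "0 < e"
  shows "\<exists>j. \<phi> (R j) < e"
proof (rule ccontr)
  assume "\<not> (\<exists>j. \<phi> (R j) < e)"
  then have large: "e \<le> \<phi> (R j)" for j by (simp add: not_less)
  define Q where "Q j = conv_pow (Suc j) (R j)" for j
  have Q: "exp_law (Q j)" for j unfolding Q_def by (rule exp_law_conv_pow[OF R])
  note Qr = exp_law_real_distr[OF Q]
  have Q0: "AE x in Q j. 0 \<le> x" for j unfolding Q_def by (rule AE_conv_pow_nonneg[OF R R0])
  \<comment> \<open>The divisor \<open>Suc j\<close> in the hypothesis pays for the
    \<open>Suc j\<close>-fold convolution; what remains, (1/2)^j, is summable.\<close>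
  have Qe: "(\<integral>x. exp (real j * x) \<partial>Q j) \<le> exp ((1 / 2) ^ j)" for j
  proof -
    have "(\<integral>x. exp (real j * x) \<partial>Q j) \<le> exp ((1 / 2) ^ j / real (Suc j)) ^ Suc j"
      unfolding Q_def expectation_exp_conv_pow[OF R]
      by (rule power_mono[OF small]) (rule less_imp_le[OF exp_law_expectation_exp_pos[OF R]])
    also have "\<dots> = exp ((1 / 2) ^ j)"
      unfolding exp_of_nat_mult[symmetric] by (simp del: of_nat_Suc)
    finally show ?thesis .
  qed
  have \<phi>Q: "real (Suc j) * e \<le> \<phi> (Q j)" for j
    unfolding Q_def conv_pow[OF R] using large[of j] by (intro mult_left_mono) auto
  define I where "I j = quantile (Q j)" for j
  have I0: "0 \<le> I j u" if "u \<in> {0<..<1}" for j u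
    unfolding I_def by (rule quantile_nonneg[OF Qr Q0 that])
  have Im [measurable]: "I j \<in> borel_measurable unif" for j
    unfolding I_def by (rule quantile_measurable[OF Qr])
  interpret u: prob_space unif by (rule prob_space_unif)
  have delta: "(\<lambda>j. exp ((1 / 2 :: real) ^ j) - 1) \<longlonglongrightarrow> exp 0 - 1"
    by (intro tendsto_intros LIMSEQ_power_zero) auto
  \<comment> \<open>The supremum is finite at every u: for j \<ge> 1, exp (j x) - 1 is at least 1 on
    x > 1, so the mass of \<open>Q j\<close> beyond 1 tends to 0, and eventually the quantile at u
    is at most 1.\<close>
  have bdd: "bdd_above (range (\<lambda>j. I j u))" if u: "u \<in> {0<..<1}" for u
  proof -
    have "\<forall>\<^sub>F j in sequentially. exp ((1 / 2 :: real) ^ j) - 1 < 1 - u"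
      using order_tendstoD(2)[OF delta, of "1 - u"] u by simp
    then obtain n where n: "\<And>j. n \<le> j \<Longrightarrow> exp ((1 / 2 :: real) ^ j) - 1 < 1 - u"
      by (auto simp: eventually_sequentially)
    have I1: "I j u \<le> 1" if j: "max 1 n \<le> j" for j
    proof -
      interpret Qj: real_distribution "Q j" by (rule Qr)
      have "(\<integral>x. indicator {1<..} x \<partial>Q j) \<le> (\<integral>x. exp (real j * x) - 1 \<partial>Q j)"
      proof (rule integral_mono_AE)
        show "AE x in Q j. indicator {1<..} x \<le> exp (real j * x) - 1"
          using Q0[of j]
        proof eventually_elim
          case (elim x)
          have "1 + real j * x \<le> exp (real j * x)" by (rule exp_ge_add_one_self)
          moreover have "1 \<le> real j * x" if "1 < x" using mult_mono[of 1 "real j" 1 x] j that by simp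
          moreover have "0 \<le> real j * x" using elim by simp
          ultimately have "0 \<le> exp (real j * x) - 1" "1 < x \<longrightarrow> 1 \<le> exp (real j * x) - 1" by linarith+
          then show ?case by (auto simp: indicator_def)
        qed
      qed (use exp_lawD(4)[OF Q] in \<open>auto intro!: integrable_real_indicator simp: less_top[symmetric]\<close>)
      also have "\<dots> = (\<integral>x. exp (real j * x) \<partial>Q j) - 1"
        using exp_lawD(4)[OF Q] Qj.prob_space by simp
      also have "\<dots> < 1 - u" using Qe[of j] n[of j] j by simp
      finally have "Qj.prob {1<..} < 1 - u" by simp
      moreover have "Qj.prob {1<..} = 1 - cdf (Q j) 1"
        using Qj.prob_compl[of "{..1}"] by (simp add: cdf_def Compl_atMost[symmetric] Compl_eq_Diff_UNIV)
      ultimately have "u \<le> cdf (Q j) 1" by simp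
      then show ?thesis using quantile_le_iff[OF Qr u] by (simp add: I_def)
    qed
    show ?thesis
    proof (rule bdd_aboveI)
      fix y assume "y \<in> range (\<lambda>j. I j u)"
      then obtain j where y: "y = I j u" by auto
      show "y \<le> Max (insert 1 ((\<lambda>j. I j u) ` {..max 1 n}))"
      proof (cases "j \<le> max 1 n")
        case True
        then show ?thesis unfolding y by (intro Max_ge) auto
      next
        case False
        then have "y \<le> 1" using I1[of j] y by simp
        also have "1 \<le> Max (insert 1 ((\<lambda>j. I j u) ` {..max 1 n}))" by (intro Max_ge) auto
        finally show ?thesis .
      qed
    qed
  qed
  define W where "W u = (SUP j. I j u)" for u
  have [measurable]: "W \<in> borel_measurable unif"
    unfolding W_def by (intro borel_measurable_cSUP bdd) (auto simp: space_unif)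
  have IW: "I j u \<le> W u" if "u \<in> {0<..<1}" for j u
    unfolding W_def by (intro cSUP_upper bdd that) auto
  \<comment> \<open>For a > 0, exp (a W) - 1 is at most the sum over j of exp (a I_j) - 1. Once j
    \<ge> a, the integral of the j-th term is at most 2 (1/2)^j.\<close>
  have intW: "integrable unif (\<lambda>u. exp (a * W u))" for a
  proof (cases "a \<le> 0")
    case True
    have "AE u in unif. norm (exp (a * W u)) \<le> 1"
    proof (rule AE_I2)
      fix u assume "u \<in> space unif"
      then have "0 \<le> W u" using I0[of u 0] IW[of u 0] by (simp add: space_unif)
      then show "norm (exp (a * W u)) \<le> 1" using True by (simp add: mult_nonpos_nonneg)
    qed
    then show ?thesis by (intro u.integrable_const_bound[where B = 1]) auto
  next
    case False
    then have a: "0 < a" by simp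
    define E where "E j = (\<integral>x. exp (a * x) \<partial>Q j) - 1" for j
    have E: "(\<integral>\<^sup>+u. ennreal (exp (a * I j u) - 1) \<partial>unif) = ennreal (E j)" "0 \<le> E j" for j
    proof -
      have i: "integrable unif (\<lambda>u. exp (a * I j u))" "(\<integral>u. exp (a * I j u) \<partial>unif) = (\<integral>x. exp (a * x) \<partial>Q j)"
        unfolding I_def using integral_quantile[OF Qr[of j], of "\<lambda>x. exp (a * x)"] exp_lawD(4)[OF Q] by auto
      have nn: "AE u in unif. 0 \<le> exp (a * I j u) - 1"
        by (rule AE_I2) (use a I0 in \<open>auto simp: space_unif\<close>)
      have eq: "(\<integral>u. exp (a * I j u) - 1 \<partial>unif) = E j"
        using i u.prob_space by (simp add: E_def)
      show "(\<integral>\<^sup>+u. ennreal (exp (a * I j u) - 1) \<partial>unif) = ennreal (E j)"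
        unfolding eq[symmetric] using i nn by (intro nn_integral_eq_integral) auto
      show "0 \<le> E j" unfolding eq[symmetric] using nn by (rule integral_nonneg_AE)
    qed
    have "summable E"
    proof (rule summable_comparison_test_ev)
      show "summable (\<lambda>j. 2 * (1 / 2 :: real) ^ j)" by (intro summable_mult summable_geometric) auto
      show "\<forall>\<^sub>F j in sequentially. norm (E j) \<le> 2 * (1 / 2) ^ j"
        using eventually_ge_at_top[of "nat \<lceil>a\<rceil>"]
      proof eventually_elim
        case (elim j)
        have "a \<le> real j" using elim by linarith
        interpret Qj: real_distribution "Q j" by (rule Qr)
        have "(\<integral>x. exp (a * x) \<partial>Q j) \<le> (\<integral>x. exp (real j * x) \<partial>Q j)"
          using Q0[of j] \<open>a \<le> real j\<close>
          by (intro integral_mono_AE exp_lawD(4)[OF Q]) (auto elim!: eventually_mono intro: mult_right_mono)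
        also have "\<dots> \<le> exp ((1 / 2) ^ j)" by (rule Qe)
        also have "\<dots> \<le> 1 + 2 * (1 / 2) ^ j"
        proof -
          have "exp x \<le> 1 + 2 * x" if "0 \<le> x" "x \<le> 1" for x :: real
            using exp_bound[OF that] that mult_left_mono[of x 1 x] by (simp add: power2_eq_square)
          then show ?thesis by (simp add: power_le_one)
        qed
        finally show ?case using E(2)[of j] by (simp add: E_def)
      qed
    qed
    then have fin: "(\<Sum>j. ennreal (E j)) \<noteq> top"
      using E(2) by (intro ennreal_suminf_neq_top) auto
    have "(\<integral>\<^sup>+u. ennreal (exp (a * W u)) \<partial>unif) \<le> (\<integral>\<^sup>+u. 1 + (\<Sum>j. ennreal (exp (a * I j u) - 1)) \<partial>unif)"
    proof (rule nn_integral_mono)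
      fix u assume "u \<in> space unif"
      then have u: "u \<in> {0<..<1}" by (simp add: space_unif)
      let ?S = "\<Sum>j. ennreal (exp (a * I j u) - 1)"
      show "ennreal (exp (a * W u)) \<le> 1 + ?S"
      proof (cases "?S = top")
        case False
        then obtain r where r: "0 \<le> r" "?S = ennreal r" by (cases ?S) auto
        have "exp (a * I j u) \<le> 1 + r" for j
        proof -
          have "ennreal (exp (a * I j u) - 1) \<le> ?S"
            using sum_le_suminf[of "\<lambda>j. ennreal (exp (a * I j u) - 1)" "{j}"] by simp
          then show ?thesis unfolding r(2) using r(1) by simp
        qed
        then have "I j u \<le> ln (1 + r) / a" for j
          using a r(1) by (simp add: field_simps ln_ge_iff[symmetric] add_pos_nonneg)
        then have "W u \<le> ln (1 + r) / a" unfolding W_def by (intro cSUP_least) auto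
        then have "a * W u \<le> ln (1 + r)" using a by (simp add: field_simps)
        then have "exp (a * W u) \<le> 1 + r" using r(1) by (simp add: ln_ge_iff)
        then show ?thesis
          unfolding r(2) using r(1) by (simp add: ennreal_1[symmetric] ennreal_plus[symmetric] del: ennreal_1 ennreal_plus)
      qed simp
    qed
    also have "\<dots> = 1 + (\<Sum>j. ennreal (E j))"
      by (simp add: nn_integral_add nn_integral_suminf E(1) u.emeasure_space_1)
    also have "\<dots> < top" using fin by (simp add: less_top)
    finally show ?thesis by (intro integrableI_nonneg) auto
  qed
  define N where "N = distr unif borel W"
  have N: "exp_law N"
    unfolding exp_law_def N_def using intW by (auto simp: integrable_distr_eq intro: u.prob_space_distr)
  have le: "\<phi> (Q j) \<le> \<phi> N" for j
  proof (rule mono[OF N Q])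
    fix t
    have "cdf (distr unif borel W) t \<le> cdf (distr unif borel (I j)) t"
      by (rule cdf_distr_le[OF prob_space_unif]) (auto intro!: AE_I2 IW simp: space_unif)
    then show "cdf N t \<le> cdf (Q j) t" by (simp add: N_def I_def distr_quantile[OF Qr])
  qed
  obtain j :: nat where "\<phi> N / e < real j" using reals_Archimedean2 by blast
  then have "\<phi> N < real j * e" using e by (simp add: field_simps)
  also have "\<dots> \<le> real (Suc j) * e" using e by simp
  also have "\<dots> \<le> \<phi> N" using \<phi>Q[of j] le[of j] by linarith
  finally show False by simp
qed

section \<open>Rare jumps and the compact parameter range\<close>

definition two_point :: "real \<Rightarrow> real \<Rightarrow> real measure" where
  "two_point p r = distr (measure_pmf (bernoulli_pmf p)) borel (\<lambda>b. if b then r else 0)"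

lemma integral_two_point:
  fixes f :: "real \<Rightarrow> real"
  assumes "f \<in> borel_measurable borel" "0 \<le> p" "p \<le> 1"
  shows "(\<integral>x. f x \<partial>two_point p r) = p * f r + (1 - p) * f 0"
  using assms unfolding two_point_def by (subst integral_distr) auto

lemma AE_two_point: "P r \<Longrightarrow> P 0 \<Longrightarrow> Measurable.pred borel P \<Longrightarrow> AE x in two_point p r. P x"
  unfolding two_point_def by (subst AE_distr_iff) auto

lemma exp_law_two_point [simp]: "exp_law (two_point p r)"
  unfolding exp_law_def two_point_def
  by (auto simp: integrable_distr_eq intro!: integrable_measure_pmf_finite measure_pmf.prob_space_distr)

lemma mexp_two_point: "0 \<le> p \<Longrightarrow> p \<le> 1 \<Longrightarrow> mexp (two_point p r) a = p * expint a r"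
  unfolding mexp_def by (subst integral_two_point) (auto simp: expint_def)

lemma expectation_exp_two_point:
  "0 \<le> p \<Longrightarrow> p \<le> 1 \<Longrightarrow> (\<integral>x. exp (a * x) \<partial>two_point p r) = p * exp (a * r) + (1 - p)"
  by (subst integral_two_point) auto

text \<open>Otherwise each n has arbitrarily large jumps of value at least 1. With jump probability
  exp (- (n + 1) r), the jump contributes only exp (- r) to E[exp (n X)], so large choices of r
  contradict \<open>rare_laws_small\<close>.\<close>

lemma (in law_statistic) rare_two_point_small:
  "\<exists>n r0. \<forall>r\<ge>r0. \<phi> (two_point (exp (- (real (Suc n) * r))) r) < 1"
proof (rule ccontr)
  assume "\<not> ?thesis"
  then have ex: "\<exists>r\<ge>r0. 1 \<le> \<phi> (two_point (exp (- (real (Suc n) * r))) r)" for n r0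
    by (force simp: not_less)
  \<comment> \<open>From here on exp (- r) is below the bound of \<open>rare_laws_small\<close>; the
    absolute value also makes the jumps nonnegative.\<close>
  define r0 where "r0 n = \<bar>ln ((1 / 2) ^ n / real (Suc n))\<bar>" for n
  obtain r where r: "\<And>n. r0 n \<le> r n" "\<And>n. 1 \<le> \<phi> (two_point (exp (- (real (Suc n) * r n))) (r n))"
    using ex[of "r0 _"] that by meson
  let ?p = "\<lambda>n. exp (- (real (Suc n) * r n))"
  let ?T = "\<lambda>n. two_point (?p n) (r n)"
  have rpos: "0 \<le> r n" for n using r(1)[of n] by (simp add: r0_def)
  have "\<exists>n. \<phi> (?T n) < 1"
  proof (rule rare_laws_small)
    fix n
    show "AE x in ?T n. 0 \<le> x"
      by (rule AE_two_point) (auto simp: rpos)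
    have le1: "?p n \<le> 1" using rpos[of n] by simp
    have "(\<integral>x. exp (real n * x) \<partial>?T n)
      = ?p n * exp (real n * r n) + (1 - ?p n)"
      by (rule expectation_exp_two_point[OF _ le1]) simp
    also have "?p n * exp (real n * r n) = exp (- r n)"
      by (simp add: exp_add[symmetric] algebra_simps)
    also have "exp (- r n) + (1 - ?p n) \<le> 1 + exp (- r n)" by simp
    also have "\<dots> \<le> exp (exp (- r n))" by (rule exp_ge_add_one_self)
    also have "\<dots> \<le> exp ((1 / 2) ^ n / real (Suc n))"
    proof -
      have "- r n \<le> ln ((1 / 2) ^ n / real (Suc n))" using r(1)[of n] unfolding r0_def by linarith
      then have "exp (- r n) \<le> exp (ln ((1 / 2) ^ n / real (Suc n)))" by (simp only: exp_le_cancel_iff)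
      also have "\<dots> = (1 / 2) ^ n / real (Suc n)" by (rule exp_ln) simp
      finally show ?thesis by (simp only: exp_le_cancel_iff)
    qed
    finally show "(\<integral>x. exp (real n * x) \<partial>?T n) \<le> exp ((1 / 2) ^ n / real (Suc n))" .
  qed auto
  with r(2) show False by (meson not_less)
qed

text \<open>The jump alone gives ln E[exp (a X)] \<ge> (a - (n + 1)) r. Divided by a, this is r (1 -
  (n + 1) / a), which is smallest at a = n + 2.\<close>

lemma KL_rare_two_point:
  assumes "0 \<le> r" and a: "real n + 2 \<le> a"
  shows "r / (real n + 2) \<le> KL (two_point (exp (- (real (Suc n) * r))) r) a"
proof -
  let ?p = "exp (- (real (Suc n) * r))"
  have p1: "?p \<le> 1" using assms by simp
  have a0: "0 < a" using a by simp
  have "exp (a * r - real (Suc n) * r) = ?p * exp (a * r)" by (simp add: exp_add[symmetric])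
  also have "\<dots> \<le> ?p * exp (a * r) + (1 - ?p)" using p1 by simp
  also have "\<dots> = (\<integral>x. exp (a * x) \<partial>two_point ?p r)" using p1 by (simp add: expectation_exp_two_point)
  finally have "a * r - real (Suc n) * r \<le> ln (\<integral>x. exp (a * x) \<partial>two_point ?p r)"
    by (subst ln_ge_iff) (auto intro: exp_law_expectation_exp_pos)
  then have "(a * r - real (Suc n) * r) / a \<le> KL (two_point ?p r) a"
    using a0 by (simp add: KL_def K_def divide_right_mono)
  moreover have "r / (real n + 2) \<le> (a * r - real (Suc n) * r) / a"
  proof -
    have "(real n + 1) * (r * (a - (real n + 2))) \<ge> 0" using assms by (intro mult_nonneg_nonneg) auto
    then show ?thesis using a0 by (simp add: field_simps)
  qed
  ultimately show ?thesis by linarith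
qed

lemma (in law_statistic) mono_on_compact:
  "\<exists>A>0. \<forall>N1 N2 B. exp_law N1 \<longrightarrow> exp_law N2 \<longrightarrow> (AE x in N1. \<bar>x\<bar> \<le> B) \<longrightarrow> (AE x in N2. \<bar>x\<bar> \<le> B) \<longrightarrow>
     (\<forall>a\<in>{- A..A}. KL N2 a \<le> KL N1 a) \<longrightarrow> \<phi> N2 \<le> \<phi> N1"
proof -
  interpret refl: law_statistic "\<lambda>N. - \<phi> (reflect N)" by (rule reflected)
  define T where "T n r = two_point (exp (- (real (Suc n) * r))) r" for n r
  have T: "exp_law (T n r)" for n r by (simp add: T_def)
  have T0: "AE x in T n r. 0 \<le> x \<and> x \<le> r" if "0 \<le> r" for n r
    unfolding T_def by (rule AE_two_point) (use that in auto)
  have TK: "0 \<le> KL (T n r) a" if "0 \<le> r" for n r a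
    using T0[OF that] by (intro KL_ge_of_AE_ge T) (auto elim: eventually_mono)
  obtain n1 r1 where 1: "\<And>r. r1 \<le> r \<Longrightarrow> \<phi> (T n1 r) < 1"
    using rare_two_point_small unfolding T_def by blast
  obtain n2 r2 where 2: "\<And>r. r2 \<le> r \<Longrightarrow> - \<phi> (reflect (T n2 r)) < 1"
    using refl.rare_two_point_small unfolding T_def by blast
  \<comment> \<open>At least n1 + 2 and n2 + 2, so that both the upward and the reflected jumps grow
    linearly beyond A.\<close>
  define A where "A = real n1 + real n2 + 2"
  have A: "0 < A" by (simp add: A_def)
  have TA: "r / A \<le> KL (T n r) a" if "0 \<le> r" "A \<le> a" "n = n1 \<or> n = n2" for n r a
  proof -
    have "r / A \<le> r / (real n + 2)" using that by (intro divide_left_mono) (auto simp: A_def)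
    also have "\<dots> \<le> KL (T n r) a"
      unfolding T_def using that by (intro KL_rare_two_point) (auto simp: A_def)
    finally show ?thesis .
  qed
  show ?thesis
  proof (intro exI[of _ A] conjI allI impI A)
    fix N1 N2 B
    assume N: "exp_law N1" "exp_law N2" and B: "AE x in N1. \<bar>x\<bar> \<le> B" "AE x in N2. \<bar>x\<bar> \<le> B"
      and le: "\<forall>a\<in>{- A..A}. KL N2 a \<le> KL N1 a"
    have KB: "\<bar>KL N a\<bar> \<le> B" if "exp_law N" "AE x in N. \<bar>x\<bar> \<le> B" for N a
    proof -
      have "AE x in N. x \<le> B" "AE x in N. - B \<le> x" using that(2) by (auto elim!: eventually_mono)
      with KL_le_of_AE_le[OF that(1), of B a] KL_ge_of_AE_ge[OF that(1), of "- B" a] show ?thesis by simp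
    qed
    have B0: "0 \<le> B" using KB[OF N(1) B(1), of 0] by simp
    \<comment> \<open>The bound 3 does not depend on k: it collects the two jump laws, each costing
      less than 1, and the constant 1 added to one side.\<close>
    have main: "real k * (\<phi> N2 - \<phi> N1) \<le> 3" for k :: nat
    proof -
      define b where "b = real k * B"
      have b: "0 \<le> b" using B0 by (simp add: b_def)
      \<comment> \<open>The k-fold cumulants lie in [-b, b]. With r / A \<ge> 2 b, the jump makes up
        for their difference at every |a| \<ge> A.\<close>
      define r where "r = \<bar>r1\<bar> + \<bar>r2\<bar> + A * (2 * b)"
      have r: "0 \<le> r" "r1 \<le> r" "r2 \<le> r" using mult_nonneg_nonneg[of A "2 * b"] A b unfolding r_def by linarith+
      have rA: "2 * b \<le> r / A" using A by (simp add: r_def field_simps)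
      let ?R = "reflect (T n2 r)"
      \<comment> \<open>The constant 1 provides strictness: on [-A, A], where the cumulants are only
        weakly ordered, and at both essential extrema.\<close>
      let ?S = "T n1 r \<star> return borel 1"
      define M1 where "M1 = (conv_pow k N1 \<star> ?S)"
      define M2 where "M2 = (conv_pow k N2 \<star> ?R)"
      have P: "exp_law (conv_pow k N1)" "exp_law (conv_pow k N2)" "exp_law ?S" "exp_law ?R"
        by (auto intro!: exp_law_conv_pow N exp_law_convolution T exp_law_reflect)
      have M: "exp_law M1" "exp_law M2" by (auto simp: M1_def M2_def intro!: exp_law_convolution P)
      have S: "AE x in ?S. 1 \<le> x \<and> x \<le> r + 1"
        by (rule AE_convolution[OF T exp_law_return T0[OF r(1)], of "\<lambda>y. y = 1" 1]) (auto simp: AE_return)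
      have R: "AE x in ?R. - r \<le> x \<and> x \<le> 0"
        unfolding reflect_def using T0[OF r(1), of n2] exp_lawD(2)[OF T, of n2 r]
        by (subst AE_distr_iff) (auto cong: measurable_cong_sets)
      have C: "AE x in conv_pow k N1. \<bar>x\<bar> \<le> b" "AE x in conv_pow k N2. \<bar>x\<bar> \<le> b"
        unfolding b_def by (auto intro!: AE_conv_pow_abs_le N B)
      have K1: "KL M1 a = real k * KL N1 a + KL (T n1 r) a + 1" for a
        by (simp add: M1_def KL_convolution P T KL_conv_pow N)
      have K2: "KL M2 a = real k * KL N2 a - KL (T n2 r) (- a)" for a
        by (simp add: M2_def KL_convolution P T KL_conv_pow KL_reflect N)
      have kK: "\<bar>real k * KL N1 a\<bar> \<le> b" "\<bar>real k * KL N2 a\<bar> \<le> b" for a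
        unfolding b_def using KB[OF N(1) B(1), of a] KB[OF N(2) B(2), of a]
        by (auto simp: abs_mult intro: mult_left_mono)
      have "\<phi> M2 \<le> \<phi> M1"
      proof (rule catalytic_mono[OF M])
        show "AE x in M1. \<bar>x\<bar> \<le> b + r + 1"
          unfolding M1_def by (rule AE_convolution[OF P(1,3) C(1) S]) (use r in auto)
        show "AE x in M2. \<bar>x\<bar> \<le> b + r + 1"
          unfolding M2_def by (rule AE_convolution[OF P(2,4) C(2) R]) (use r in auto)
        show "AE x in M2. x \<le> b"
          unfolding M2_def by (rule AE_convolution[OF P(2,4) C(2) R]) auto
        show "AE x in M1. - b + 1 \<le> x"
          unfolding M1_def by (rule AE_convolution[OF P(1,3) C(1) S]) auto
        show "b < KL M1 A"
          using kK(1)[of A] TA[OF r(1), of A n1] rA unfolding K1 by auto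
        show "KL M2 (- A) < - b + 1"
          using kK(2)[of "- A"] TA[OF r(1), of A n2] rA unfolding K2 by auto
        fix a
        have TT: "0 \<le> KL (T n1 r) a" "0 \<le> KL (T n2 r) (- a)" by (auto intro: TK r)
        consider "a \<in> {- A..A}" | "A \<le> a" | "A \<le> - a" by fastforce
        then show "KL M2 a < KL M1 a"
        proof cases
          case 1
          then have "real k * KL N2 a \<le> real k * KL N1 a" using le by (intro mult_left_mono) auto
          with TT show ?thesis unfolding K1 K2 by linarith
        next
          case 2
          then show ?thesis using kK[of a] TA[OF r(1) 2, of n1] rA TT unfolding K1 K2 by auto
        next
          case 3
          then show ?thesis using kK[of a] TA[OF r(1) 3, of n2] rA TT unfolding K1 K2 by auto
        qed
      qed
      moreover have "\<phi> M1 = real k * \<phi> N1 + \<phi> (T n1 r) + 1"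
        by (simp add: M1_def add P T conv_pow N const)
      moreover have "\<phi> M2 = real k * \<phi> N2 + \<phi> ?R"
        by (simp add: M2_def add P T conv_pow N)
      ultimately show ?thesis using 1[OF r(2)] 2[OF r(3)] by (simp add: algebra_simps)
    qed
    show "\<phi> N2 \<le> \<phi> N1"
    proof (rule ccontr)
      assume "\<not> \<phi> N2 \<le> \<phi> N1"
      then have "0 < \<phi> N2 - \<phi> N1" by simp
      then obtain k :: nat where "3 < real k * (\<phi> N2 - \<phi> N1)" using reals_Archimedean3 by blast
      with main[of k] show False by simp
    qed
  qed
qed

section \<open>Riesz representation on an interval\<close>

text \<open>The values of L at the Bernstein polynomials are weights of a probability measure on the
  nodes k / n, and integrating f against it gives L of the n-th Bernstein approximation of f, which
  tends to L f. A weak limit along a subsequence is the desired measure.\<close>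

lemma riesz_unit_interval:
  fixes L :: "(real \<Rightarrow> real) \<Rightarrow> real"
  assumes add: "\<And>f g. continuous_on {0..1} f \<Longrightarrow> continuous_on {0..1} g \<Longrightarrow> L (\<lambda>x. f x + g x) = L f + L g"
    and scale: "\<And>c f. continuous_on {0..1} f \<Longrightarrow> L (\<lambda>x. c * f x) = c * L f"
    and pos: "\<And>f. continuous_on {0..1} f \<Longrightarrow> (\<And>x. x \<in> {0..1} \<Longrightarrow> 0 \<le> f x) \<Longrightarrow> 0 \<le> L f"
    and one: "L (\<lambda>_. 1) = 1"
  obtains \<mu> where "real_distribution \<mu>" "AE x in \<mu>. x \<in> {0..1}"
    "\<And>f. continuous_on UNIV f \<Longrightarrow> (\<integral>x. f x \<partial>\<mu>) = L f"
proof -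
  have cB: "continuous_on S (Bernstein n k)" for S n k
    unfolding Bernstein_def[abs_def] by (intro continuous_intros)
  define w where "w n k = L (Bernstein n k)" for n k
  have w0: "0 \<le> w n k" for n k
    unfolding w_def by (intro pos cB) (auto simp: Bernstein_nonneg)
  have L_sum: "L (\<lambda>x. \<Sum>k\<in>F. c k * g k x) = (\<Sum>k\<in>F. c k * L (g k))"
    if "finite F" "\<And>k. continuous_on {0..1} (g k)" for F :: "nat set" and c g
    using that(1)
  proof (induction F)
    case empty
    show ?case using scale[of "\<lambda>_. 1" 0] by simp
  next
    case (insert k F)
    have "L (\<lambda>x. c k * g k x + (\<Sum>k\<in>F. c k * g k x)) = c k * L (g k) + (\<Sum>k\<in>F. c k * L (g k))"
      using insert that(2) by (subst add) (auto intro!: continuous_intros simp: scale)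
    then show ?case using insert by simp
  qed
  \<comment> \<open>Positivity makes L a contraction for the supremum norm on [0, 1]. The case e = 0
    shows that L depends only on the restriction to [0, 1].\<close>
  have L_le: "\<bar>L f - L g\<bar> \<le> e"
    if fg: "continuous_on {0..1} f" "continuous_on {0..1} g" and e: "\<And>x. x \<in> {0..1} \<Longrightarrow> \<bar>f x - g x\<bar> \<le> e" for f g e
  proof -
    have le: "L f - L g \<le> e" if fg: "continuous_on {0..1} f" "continuous_on {0..1} g" and e: "\<And>x. x \<in> {0..1} \<Longrightarrow> f x - g x \<le> e" for f g
    proof -
      have "0 \<le> L (\<lambda>x. (e * 1 + g x) + (- 1) * f x)"
        using fg e by (intro pos continuous_intros) (auto simp: algebra_simps)
      also have "\<dots> = (e * 1 + L g) + (- 1) * L f"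
      proof -
        have "L (\<lambda>x. (e * 1 + g x) + (- 1) * f x) = L (\<lambda>x. e * 1 + g x) + L (\<lambda>x. (- 1) * f x)"
          using fg by (intro add continuous_intros)
        also have "L (\<lambda>x. e * 1 + g x) = L (\<lambda>x. e * 1) + L g"
          using fg by (intro add continuous_intros)
        also have "L (\<lambda>x. e * 1) = e * 1" using scale[of "\<lambda>_. 1" e] one by simp
        also have "L (\<lambda>x. (- 1) * f x) = (- 1) * L f" by (rule scale[OF fg(1)])
        finally show ?thesis .
      qed
      finally show ?thesis by simp
    qed
    show ?thesis using le[OF fg] le[OF fg(2,1)] e by (auto simp: abs_le_iff)
  qed
  \<comment> \<open>For n = 0 the only node is 0 / 0 = 0, still inside the interval.\<close>
  define \<mu> where "\<mu> n = distr (point_measure {..n} (\<lambda>k. ennreal (w n k))) borel (\<lambda>k. real k / real n)" for n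
  have w1: "(\<Sum>k\<le>n. w n k) = 1" for n
    using L_sum[of "{..n}" "Bernstein n" "\<lambda>_. 1"] cB one by (simp add: w_def)
  have \<mu>: "real_distribution (\<mu> n)" for n
  proof -
    have "prob_space (point_measure {..n} (\<lambda>k. ennreal (w n k)))"
      by (rule prob_spaceI) (simp add: space_point_measure emeasure_point_measure_finite sum_ennreal w0 w1)
    then show ?thesis unfolding \<mu>_def by (intro prob_space.real_distribution_distr) auto
  qed
  have int: "(\<integral>x. f x \<partial>\<mu> n) = (\<Sum>k\<le>n. f (real k / real n) * w n k)" if [measurable]: "f \<in> borel_measurable borel" for f :: "real \<Rightarrow> real" and n
    unfolding \<mu>_def
    by (subst integral_distr) (auto simp: lebesgue_integral_point_measure_finite w0 mult.commute)
  have conv: "(\<lambda>n. \<integral>x. f x \<partial>\<mu> n) \<longlonglongrightarrow> L f" if f: "continuous_on UNIV f" for f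
  proof (rule LIMSEQ_I)
    fix e :: real assume "0 < e"
    have f01: "continuous_on {0..1} f" using f by (rule continuous_on_subset) simp
    obtain N where N: "\<And>n x. N \<le> n \<Longrightarrow> x \<in> {0..1} \<Longrightarrow> \<bar>f x - (\<Sum>k\<le>n. f (real k / real n) * Bernstein n k x)\<bar> < e / 2"
      using Bernstein_Weierstrass[OF f01, of "e / 2"] \<open>0 < e\<close> by auto
    show "\<exists>N. \<forall>n\<ge>N. norm ((\<integral>x. f x \<partial>\<mu> n) - L f) < e"
    proof (intro exI[of _ N] allI impI)
      fix n assume n: "N \<le> n"
      have "\<bar>L f - L (\<lambda>x. \<Sum>k\<le>n. f (real k / real n) * Bernstein n k x)\<bar> \<le> e / 2"
        by (intro L_le f01 continuous_intros cB less_imp_le[OF N[OF n]])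
      also have "L (\<lambda>x. \<Sum>k\<le>n. f (real k / real n) * Bernstein n k x) = (\<integral>x. f x \<partial>\<mu> n)"
        using borel_measurable_continuous_onI[OF f] cB by (subst L_sum) (auto simp: int w_def)
      finally show "norm ((\<integral>x. f x \<partial>\<mu> n) - L f) < e" using \<open>0 < e\<close> by (simp add: abs_minus_commute)
    qed
  qed
  have "tight \<mu>"
    unfolding tight_def
  proof (intro conjI allI impI \<mu>)
    fix e :: real assume "0 < e"
    \<comment> \<open>Tightness speaks of half-open intervals; the left end -1 keeps the node 0
      inside.\<close>
    have "measure (\<mu> n) {-1<..1} = 1" for n
    proof -
      interpret real_distribution "\<mu> n" by (rule \<mu>)
      have "measure (\<mu> n) {-1<..1} = (\<integral>x. indicator {-1<..1} x \<partial>\<mu> n)" by simp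
      also have "\<dots> = (\<Sum>k\<le>n. indicator {-1<..1} (real k / real n) * w n k)" by (rule int) simp
      also have "\<dots> = (\<Sum>k\<le>n. w n k)"
      proof (rule sum.cong[OF refl])
        fix k assume "k \<in> {..n}"
        then have "real k / real n \<le> 1" by (cases "n = 0") (auto simp: divide_le_eq_1)
        moreover have "-1 < real k / real n" by (rule less_le_trans[of _ 0]) auto
        ultimately show "indicator {-1<..1} (real k / real n) * w n k = w n k" by simp
      qed
      finally show ?thesis by (simp add: w1)
    qed
    with \<open>0 < e\<close> show "\<exists>a b. a < b \<and> (\<forall>n. 1 - e < measure (\<mu> n) {a<..b})"
      by (intro exI[of _ "-1"] exI[of _ 1]) auto
  qed
  from tight_imp_convergent_subsubsequence[OF this, of id]
  obtain r M where r: "strict_mono r" and M: "real_distribution M" and wc: "weak_conv_m (\<mu> \<circ> r) M"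
    by (auto simp: strict_mono_def)
  interpret M: real_distribution M by (rule M)
  have bc: "(\<integral>x. f x \<partial>M) = L f" if f: "continuous_on UNIV f" and B: "\<And>x. \<bar>f x\<bar> \<le> B" for f B
  proof (rule LIMSEQ_unique)
    show "(\<lambda>n. \<integral>x. f x \<partial>(\<mu> \<circ> r) n) \<longlonglongrightarrow> (\<integral>x. f x \<partial>M)"
      by (rule weak_conv_imp_integral_bdd_continuous_conv[OF _ M wc, where B = B])
         (use \<mu> f B in \<open>auto simp: continuous_on_eq_continuous_at\<close>)
    show "(\<lambda>n. \<integral>x. f x \<partial>(\<mu> \<circ> r) n) \<longlonglongrightarrow> L f"
      using LIMSEQ_subseq_LIMSEQ[OF conv[OF f] r] by (simp add: comp_def)
  qed
  have supp: "AE x in M. x \<in> {0..1}"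
  proof -
    \<comment> \<open>A bounded continuous function whose zero set is exactly [0, 1]; L f = 0
      therefore locates the limit measure.\<close>
    define f where "f x = min 1 (max 0 (- x) + max 0 (x - 1))" for x :: real
    have fc: "continuous_on S f" for S unfolding f_def by (intro continuous_intros)
    have f: "0 \<le> f x" "f x \<le> 1" for x by (auto simp: f_def)
    have "\<bar>L f - L (\<lambda>_. 0)\<bar> \<le> 0" by (rule L_le[OF fc]) (auto simp: f_def)
    then have "L f = 0" using scale[of "\<lambda>_. 1" 0] by simp
    then have "(\<integral>x. f x \<partial>M) = 0" using bc[OF fc, of 1] f by simp
    moreover have "integrable M f"
      using f borel_measurable_continuous_onI[OF fc] by (intro M.integrable_const_bound[where B = 1]) auto
    ultimately have "AE x in M. f x = 0"
      using f by (subst (asm) integral_nonneg_eq_0_iff_AE) auto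
    then show ?thesis by eventually_elim (auto simp: f_def min_def max_def split: if_splits)
  qed
  show ?thesis
  proof (rule that[OF M supp])
    fix f :: "real \<Rightarrow> real" assume f: "continuous_on UNIV f"
    \<comment> \<open>Weak convergence tests bounded functions only, so f is frozen outside
      [0, 1].\<close>
    define g where "g x = f (max 0 (min 1 x))" for x
    have gc: "continuous_on UNIV g"
      unfolding g_def by (rule continuous_on_compose2[OF f]) (auto intro!: continuous_intros)
    have f01: "continuous_on {0..1} f" using f by (rule continuous_on_subset) simp
    have "bounded (f ` {0..1})" by (intro compact_imp_bounded compact_continuous_image f01) auto
    then obtain B where B: "\<forall>y\<in>f ` {0..1}. norm y \<le> B" by (auto simp: bounded_iff)
    have "\<bar>g x\<bar> \<le> B" for x using B by (auto simp: g_def)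
    then have "(\<integral>x. g x \<partial>M) = L g" by (rule bc[OF gc])
    moreover have "\<bar>L g - L f\<bar> \<le> 0"
      by (rule L_le[OF continuous_on_subset[OF gc] f01]) (auto simp: g_def)
    moreover have "(\<integral>x. f x \<partial>M) = (\<integral>x. g x \<partial>M)"
    proof (rule integral_cong_AE)
      show "AE x in M. f x = g x" using supp by eventually_elim (simp add: g_def)
    qed (use borel_measurable_continuous_onI[OF f] borel_measurable_continuous_onI[OF gc] in auto)
    ultimately show "(\<integral>x. f x \<partial>M) = L f" by simp
  qed
qed

lemma riesz_interval:
  fixes L :: "(real \<Rightarrow> real) \<Rightarrow> real"
  assumes lu: "l < u"
    and add: "\<And>f g. continuous_on {l..u} f \<Longrightarrow> continuous_on {l..u} g \<Longrightarrow> L (\<lambda>x. f x + g x) = L f + L g"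
    and scale: "\<And>c f. continuous_on {l..u} f \<Longrightarrow> L (\<lambda>x. c * f x) = c * L f"
    and pos: "\<And>f. continuous_on {l..u} f \<Longrightarrow> (\<And>x. x \<in> {l..u} \<Longrightarrow> 0 \<le> f x) \<Longrightarrow> 0 \<le> L f"
    and one: "L (\<lambda>_. 1) = 1"
  obtains \<mu> where "real_distribution \<mu>" "AE x in \<mu>. x \<in> {l..u}"
    "\<And>f. continuous_on UNIV f \<Longrightarrow> (\<integral>x. f x \<partial>\<mu>) = L f"
proof -
  define s where "s x = (x - l) / (u - l)" for x
  define t where "t y = l + (u - l) * y" for y
  have st: "t (s x) = x" for x using lu by (simp add: s_def t_def)
  have s: "s x \<in> {0..1}" if "x \<in> {l..u}" for x using that lu by (auto simp: s_def field_simps)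
  have tc: "continuous_on S t" for S unfolding t_def by (intro continuous_intros)
  have sc: "continuous_on {l..u} (\<lambda>x. f (s x))" if "continuous_on {0..1} f" for f :: "real \<Rightarrow> real"
    by (rule continuous_on_compose2[OF that]) (use s lu in \<open>auto simp: s_def intro!: continuous_intros\<close>)
  obtain \<nu> where \<nu>: "real_distribution \<nu>" "AE x in \<nu>. x \<in> {0..1}"
    "\<And>f. continuous_on UNIV f \<Longrightarrow> (\<integral>x. f x \<partial>\<nu>) = L (\<lambda>x. f (s x))"
    by (rule riesz_unit_interval[of "\<lambda>f. L (\<lambda>x. f (s x))"])
       (use s in \<open>auto intro!: add scale pos one sc\<close>)
  interpret \<nu>: real_distribution \<nu> by fact
  have [measurable]: "t \<in> borel_measurable borel" by (intro borel_measurable_continuous_onI tc)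
  show ?thesis
  proof (rule that)
    show "real_distribution (distr \<nu> borel t)" by (rule \<nu>.real_distribution_distr) simp
    have t01: "t y \<in> {l..u}" if "y \<in> {0..1}" for y
    proof -
      have "0 \<le> (u - l) * y" "(u - l) * y \<le> (u - l) * 1"
        using that lu by (auto intro: mult_left_mono)
      then show ?thesis by (simp add: t_def)
    qed
    have "AE y in \<nu>. t y \<in> {l..u}" using \<nu>(2) by eventually_elim (rule t01)
    then show "AE x in distr \<nu> borel t. x \<in> {l..u}" by (subst AE_distr_iff) simp_all
    fix f :: "real \<Rightarrow> real" assume f: "continuous_on UNIV f"
    have "(\<integral>x. f x \<partial>distr \<nu> borel t) = (\<integral>y. f (t y) \<partial>\<nu>)"
      using borel_measurable_continuous_onI[OF f] by (intro integral_distr) auto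
    also have "\<dots> = L (\<lambda>x. f (t (s x)))"
      by (rule \<nu>(3)) (auto intro!: continuous_on_compose2[OF f] tc)
    finally show "(\<integral>x. f x \<partial>distr \<nu> borel t) = L f" by (simp add: st)
  qed
qed

text \<open>Cauchy's functional equation: n c splits into an integer, where g is linear, and a
  fractional part, where g deviates from linearity by at most 2 C. Division by n removes the
  deviation.\<close>

lemma additive_bounded_linear:
  fixes g :: "real \<Rightarrow> real"
  assumes add: "\<And>x y. g (x + y) = g x + g y" and bnd: "\<And>x. \<bar>g x\<bar> \<le> C * \<bar>x\<bar>"
  shows "g c = c * g 1"
proof -
  have n: "g (real n * x) = real n * g x" for n x
  proof (induction n)
    case 0
    then show ?case using bnd[of 0] by simp
  next
    case (Suc n)
    have "g (x + real n * x) = g x + g (real n * x)" by (rule add)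
    with Suc show ?case by (simp add: algebra_simps)
  qed
  have neg: "g (- x) = - g x" for x using add[of x "- x"] n[of 0 0] by simp
  have z: "g (of_int k) = of_int k * g 1" for k
    using n[of "nat k" 1] n[of "nat (- k)" 1] neg[of "real_of_int (- k)"] by (cases "0 \<le> k") auto
  have C: "0 \<le> C" using bnd[of 1] by simp
  have "real n * \<bar>g c - c * g 1\<bar> \<le> 2 * C" for n :: nat
  proof -
    let ?y = "real n * c"
    have "g ?y = g (of_int \<lfloor>?y\<rfloor>) + g (frac ?y)" by (simp add: add[symmetric] frac_def)
    then have "g ?y - ?y * g 1 = g (frac ?y) - frac ?y * g 1" by (simp add: z frac_def algebra_simps)
    moreover have "g ?y = real n * g c" by (rule n)
    ultimately have "real n * (g c - c * g 1) = g (frac ?y) - frac ?y * g 1" by (simp add: right_diff_distrib)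
    moreover have "\<bar>g (frac ?y)\<bar> \<le> C * 1"
      using bnd[of "frac ?y"] mult_left_mono[OF less_imp_le[OF frac_lt_1[of ?y]] C] by simp
    moreover have "\<bar>frac ?y * g 1\<bar> \<le> 1 * (C * 1)"
      unfolding abs_mult using bnd[of 1] less_imp_le[OF frac_lt_1[of ?y]] by (intro mult_mono) auto
    ultimately have "\<bar>real n * (g c - c * g 1)\<bar> \<le> 2 * C" by linarith
    then show ?thesis by (simp add: abs_mult)
  qed
  then have "\<not> 0 < \<bar>g c - c * g 1\<bar>" using reals_Archimedean3[of "\<bar>g c - c * g 1\<bar>"] by (meson not_less)
  then show ?thesis by simp
qed

section \<open>Density of cumulant differences\<close>

definition bounded_law :: "real measure \<Rightarrow> bool" where
  "bounded_law N \<longleftrightarrow> exp_law N \<and> (\<exists>B. AE x in N. \<bar>x\<bar> \<le> B)"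

lemma bounded_law_exp_law: "bounded_law N \<Longrightarrow> exp_law N"
  by (simp add: bounded_law_def)

lemma bounded_law_return [simp]: "bounded_law (return borel c)"
  unfolding bounded_law_def by (auto intro!: exI[of _ "\<bar>c\<bar>"] AE_return_borel)

lemma bounded_law_two_point [simp]: "bounded_law (two_point p r)"
  unfolding bounded_law_def by (auto intro!: exI[of _ "\<bar>r\<bar>"] AE_two_point)

lemma bounded_law_convolution:
  assumes "bounded_law N1" "bounded_law N2"
  shows "bounded_law (N1 \<star> N2)"
proof -
  obtain B1 B2 where B: "AE x in N1. \<bar>x\<bar> \<le> B1" "AE x in N2. \<bar>x\<bar> \<le> B2"
    using assms by (auto simp: bounded_law_def)
  note N = assms[THEN bounded_law_exp_law]
  have "AE x in N1 \<star> N2. \<bar>x\<bar> \<le> B1 + B2" by (rule AE_convolution[OF N B]) auto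
  with exp_law_convolution[OF N] show ?thesis by (auto simp: bounded_law_def)
qed

lemma bounded_law_conv_pow: "bounded_law N \<Longrightarrow> bounded_law (conv_pow n N)"
  by (induction n) (auto intro: bounded_law_convolution)

text \<open>Membership in the uniform closure on [-A, A] of the rational multiples of cumulant
  differences: convolution powers give integer factors and m the denominator.\<close>

definition KL_approx :: "real \<Rightarrow> (real \<Rightarrow> real) \<Rightarrow> bool" where
  "KL_approx A f \<longleftrightarrow> (\<forall>e>0. \<exists>N1 N2 m. bounded_law N1 \<and> bounded_law N2 \<and> 0 < (m::nat) \<and>
     (\<forall>a\<in>{- A..A}. \<bar>f a - (KL N1 a - KL N2 a) / real m\<bar> \<le> e))"

lemma KL_common_denominator:
  assumes "exp_law N1" "exp_law N2" "exp_law P1" "exp_law P2" "0 < m" "0 < n"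
  shows "(KL (conv_pow n N1 \<star> conv_pow m P1) a - KL (conv_pow n N2 \<star> conv_pow m P2) a) / real (m * n) =
    (KL N1 a - KL N2 a) / real m + (KL P1 a - KL P2 a) / real n"
  using assms by (simp add: KL_convolution KL_conv_pow exp_law_conv_pow field_simps)

lemma KL_approx_add:
  assumes "KL_approx A f" "KL_approx A g"
  shows "KL_approx A (\<lambda>a. f a + g a)"
  unfolding KL_approx_def
proof (intro allI impI)
  fix e :: real assume "0 < e"
  then have e: "0 < e / 2" by simp
  obtain N1 N2 m where f: "bounded_law N1" "bounded_law N2" "0 < (m::nat)"
    "\<forall>a\<in>{- A..A}. \<bar>f a - (KL N1 a - KL N2 a) / real m\<bar> \<le> e / 2"
    using assms(1) e unfolding KL_approx_def by meson
  obtain P1 P2 n where g: "bounded_law P1" "bounded_law P2" "0 < (n::nat)"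
    "\<forall>a\<in>{- A..A}. \<bar>g a - (KL P1 a - KL P2 a) / real n\<bar> \<le> e / 2"
    using assms(2) e unfolding KL_approx_def by meson
  let ?Q1 = "conv_pow n N1 \<star> conv_pow m P1" and ?Q2 = "conv_pow n N2 \<star> conv_pow m P2"
  note K = KL_common_denominator[OF f(1,2)[THEN bounded_law_exp_law] g(1,2)[THEN bounded_law_exp_law] f(3) g(3)]
  show "\<exists>N1 N2 m. bounded_law N1 \<and> bounded_law N2 \<and> 0 < (m::nat) \<and>
     (\<forall>a\<in>{- A..A}. \<bar>f a + g a - (KL N1 a - KL N2 a) / real m\<bar> \<le> e)"
  proof (intro exI conjI ballI)
    fix a assume "a \<in> {- A..A}"
    with f(4) g(4) have "\<bar>f a - (KL N1 a - KL N2 a) / real m\<bar> \<le> e / 2" "\<bar>g a - (KL P1 a - KL P2 a) / real n\<bar> \<le> e / 2"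
      by auto
    then show "\<bar>f a + g a - (KL ?Q1 a - KL ?Q2 a) / real (m * n)\<bar> \<le> e" unfolding K by linarith
  qed (use f g in \<open>auto intro!: bounded_law_convolution bounded_law_conv_pow\<close>)
qed

lemma KL_approx_uminus:
  assumes "KL_approx A f"
  shows "KL_approx A (\<lambda>a. - f a)"
  unfolding KL_approx_def
proof (intro allI impI)
  fix e :: real assume "0 < e"
  then obtain N1 N2 m where f: "bounded_law N1" "bounded_law N2" "0 < (m::nat)"
    "\<forall>a\<in>{- A..A}. \<bar>f a - (KL N1 a - KL N2 a) / real m\<bar> \<le> e"
    using assms unfolding KL_approx_def by meson
  have "\<bar>- f a - (KL N2 a - KL N1 a) / real m\<bar> = \<bar>f a - (KL N1 a - KL N2 a) / real m\<bar>" for a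
    by (simp add: diff_divide_distrib abs_minus_commute)
  with f show "\<exists>N1 N2 m. bounded_law N1 \<and> bounded_law N2 \<and> 0 < (m::nat) \<and>
     (\<forall>a\<in>{- A..A}. \<bar>- f a - (KL N1 a - KL N2 a) / real m\<bar> \<le> e)"
    by (intro exI[of _ N2] exI[of _ N1] exI[of _ m]) auto
qed

lemma KL_approx_closed:
  assumes "\<And>e. 0 < e \<Longrightarrow> \<exists>g. KL_approx A g \<and> (\<forall>a\<in>{- A..A}. \<bar>f a - g a\<bar> \<le> e)"
  shows "KL_approx A f"
  unfolding KL_approx_def
proof (intro allI impI)
  fix e :: real assume "0 < e"
  then have e: "0 < e / 2" by simp
  obtain g where g: "KL_approx A g" "\<forall>a\<in>{- A..A}. \<bar>f a - g a\<bar> \<le> e / 2" using assms[OF e] by blast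
  obtain N1 N2 m where N: "bounded_law N1" "bounded_law N2" "0 < (m::nat)"
    "\<forall>a\<in>{- A..A}. \<bar>g a - (KL N1 a - KL N2 a) / real m\<bar> \<le> e / 2"
    using g(1) e unfolding KL_approx_def by meson
  have "\<forall>a\<in>{- A..A}. \<bar>f a - (KL N1 a - KL N2 a) / real m\<bar> \<le> e"
  proof
    fix a assume "a \<in> {- A..A}"
    with g(2) N(4) have "\<bar>f a - g a\<bar> \<le> e / 2" "\<bar>g a - (KL N1 a - KL N2 a) / real m\<bar> \<le> e / 2" by auto
    then show "\<bar>f a - (KL N1 a - KL N2 a) / real m\<bar> \<le> e" by linarith
  qed
  with N show "\<exists>N1 N2 m. bounded_law N1 \<and> bounded_law N2 \<and> 0 < (m::nat) \<and>
     (\<forall>a\<in>{- A..A}. \<bar>f a - (KL N1 a - KL N2 a) / real m\<bar> \<le> e)" by blast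
qed

lemma KL_approx_KL: "bounded_law N \<Longrightarrow> KL_approx A (KL N)"
  unfolding KL_approx_def
  by (intro allI impI exI[of _ N] exI[of _ "return borel 0"] exI[of _ 1]) auto

text \<open>\<open>m\<close> copies of a jump to \<open>x\<close> of probability \<open>c / m\<close> have cumulants approaching those of a compound
  Poisson law, which are linear in \<open>c\<close>.\<close>

lemma KL_approx_expint:
  assumes A: "0 \<le> A"
  shows "KL_approx A (\<lambda>a. c * expint a x)"
proof -
  have pos: "KL_approx A (\<lambda>a. c * expint a x)" if c: "0 < c" for c
  proof (rule KL_approx_closed)
    fix e :: real assume e: "0 < e"
    define C where "C = exp ((A + 1) * \<bar>x\<bar>)"
    have C: "0 < C" "\<And>a. a \<in> {- A..A} \<Longrightarrow> \<bar>expint a x\<bar> \<le> C"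
      unfolding C_def by (simp, rule abs_expint_le) auto
    have "(lnq \<longlongrightarrow> lnq 0) (nhds 0)"
      using isCont_lnq[of 0] by (simp add: isCont_def tendsto_nhds_iff)
    then have "\<forall>\<^sub>F z in nhds 0. dist (lnq z) 1 < e / (c * C)"
      using tendstoD[of lnq "lnq 0" "nhds 0" "e / (c * C)"] e c C by (simp add: lnq_def)
    then obtain d where d: "0 < d" "\<And>z. \<bar>z\<bar> < d \<Longrightarrow> \<bar>lnq z - 1\<bar> < e / (c * C)"
      by (auto simp: eventually_nhds_metric dist_real_def)
    \<comment> \<open>m > c makes c / m a probability, and the second bound brings the argument of
      \<open>lnq\<close> within d of 0, where \<open>lnq\<close> is close to 1.\<close>
    obtain m :: nat where m: "max c (A * (c * C) / d) < real m" using reals_Archimedean2 by blast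
    then have m0: "0 < m" using c by (cases m) auto
    let ?N = "conv_pow m (two_point (c / real m) x)"
    show "\<exists>g. KL_approx A g \<and> (\<forall>a\<in>{- A..A}. \<bar>c * expint a x - g a\<bar> \<le> e)"
    proof (intro exI[of _ "KL ?N"] conjI ballI KL_approx_KL bounded_law_conv_pow bounded_law_two_point)
      fix a assume a: "a \<in> {- A..A}"
      let ?z = "a * (c / real m * expint a x)"
      have p: "0 \<le> c / real m" "c / real m \<le> 1" using c m m0 by auto
      have "KL ?N a = c * expint a x * lnq ?z"
        using m0 by (simp add: KL_conv_pow KL_eq mexp_two_point p)
      then have eq: "c * expint a x - KL ?N a = (c * expint a x) * (1 - lnq ?z)" by (simp add: right_diff_distrib)
      have "\<bar>?z\<bar> = \<bar>a\<bar> * (c / real m * \<bar>expint a x\<bar>)" using c by (simp add: abs_mult)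
      also have "\<dots> \<le> A * (c / real m * C)"
        using a A p C by (intro mult_mono mult_nonneg_nonneg) auto
      also have "\<dots> < d"
      proof -
        have "A * (c * C) < real m * d" using m d by (simp add: field_simps)
        then show ?thesis using m0 by (simp add: field_simps)
      qed
      finally have z: "\<bar>lnq ?z - 1\<bar> < e / (c * C)" by (rule d(2))
      have "\<bar>c * expint a x - KL ?N a\<bar> = (c * \<bar>expint a x\<bar>) * \<bar>lnq ?z - 1\<bar>"
        unfolding eq using c by (simp add: abs_mult abs_minus_commute)
      also have "\<dots> \<le> (c * C) * (e / (c * C))" using z C(2)[OF a] c by (intro mult_mono) auto
      also have "\<dots> = e" using c C by simp
      finally show "\<bar>c * expint a x - KL ?N a\<bar> \<le> e" .
    qed
  qed
  consider "0 < c" | "c = 0" | "0 < - c" by linarith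
  then show ?thesis
  proof cases
    case 2
    then show ?thesis using KL_approx_KL[of "return borel 0" A] by (simp add: fun_eq_iff[of "KL _"] KL_approx_def)
  next
    case 3
    from KL_approx_uminus[OF pos[OF this]] show ?thesis by simp
  qed (rule pos)
qed

lemma KL_approx_exp:
  assumes A: "0 \<le> A"
  shows "KL_approx A (\<lambda>a. c * exp (a * x))"
proof (rule KL_approx_closed)
  fix e :: real assume e: "0 < e"
  \<comment> \<open>The mean value theorem, used twice: the difference quotient over [x, x + d] is
    exp (a z) for some z in between, and C d bounds |c| times its distance from exp (a x). The
    summands 1 keep C positive and leave room for d \<le> 1.\<close>
  define C where "C = (\<bar>c\<bar> + 1) * ((A + 1) * exp (A * (\<bar>x\<bar> + 1)))"
  have C: "0 < C" using A by (auto simp: C_def intro!: mult_pos_pos add_nonneg_pos)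
  define d where "d = min 1 (e / C)"
  have d: "0 < d" "d \<le> 1" "C * d \<le> e"
    using e C by (auto simp: d_def min_def field_simps)
  show "\<exists>g. KL_approx A g \<and> (\<forall>a\<in>{- A..A}. \<bar>c * exp (a * x) - g a\<bar> \<le> e)"
  proof (intro exI conjI ballI)
    show "KL_approx A (\<lambda>a. c / d * expint a (x + d) + (- (c / d)) * expint a x)"
      by (intro KL_approx_add KL_approx_expint A)
    fix a assume a: "a \<in> {- A..A}"
    obtain z where z: "x < z" "z < x + d" "expint a (x + d) - expint a x = (x + d - x) * exp (a * z)"
      using MVT2[of x "x + d" "expint a" "\<lambda>z. exp (a * z)"] d expint_DERIV by auto
    have "((\<lambda>z. exp (a * z)) has_real_derivative a * exp (a * y)) (at y)" for y
      by (auto intro!: derivative_eq_intros)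
    then obtain y where y: "x < y" "y < z" "exp (a * z) - exp (a * x) = (z - x) * (a * exp (a * y))"
      using MVT2[OF z(1), of "\<lambda>z. exp (a * z)" "\<lambda>y. a * exp (a * y)"] by auto
    have "a * y \<le> \<bar>a\<bar> * \<bar>y\<bar>" by (simp add: abs_mult[symmetric])
    also have "\<dots> \<le> A * (\<bar>x\<bar> + 1)" using a y z d A by (intro mult_mono) auto
    finally have ey: "exp (a * y) \<le> exp (A * (\<bar>x\<bar> + 1))" by simp
    have "\<bar>exp (a * z) - exp (a * x)\<bar> = (z - x) * (\<bar>a\<bar> * exp (a * y))"
      unfolding y(3) using z by (simp add: abs_mult)
    also have "\<dots> \<le> d * ((A + 1) * exp (A * (\<bar>x\<bar> + 1)))"
      using a z ey A by (intro mult_mono mult_nonneg_nonneg) auto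
    finally have *: "\<bar>exp (a * z) - exp (a * x)\<bar> \<le> d * ((A + 1) * exp (A * (\<bar>x\<bar> + 1)))" .
    have "c / d * expint a (x + d) + (- (c / d)) * expint a x = c / d * (expint a (x + d) - expint a x)"
      by (simp add: algebra_simps)
    also have "\<dots> = c * exp (a * z)" unfolding z(3) using d by simp
    finally have "\<bar>c * exp (a * x) - (c / d * expint a (x + d) + (- (c / d)) * expint a x)\<bar> = \<bar>c\<bar> * \<bar>exp (a * z) - exp (a * x)\<bar>"
      by (simp only: abs_mult[symmetric] right_diff_distrib abs_minus_commute)
    also have "\<dots> \<le> (\<bar>c\<bar> + 1) * (d * ((A + 1) * exp (A * (\<bar>x\<bar> + 1))))"
      using * by (intro mult_mono) auto
    also have "\<dots> = C * d" by (simp add: C_def)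
    finally show "\<bar>c * exp (a * x) - (c / d * expint a (x + d) + (- (c / d)) * expint a x)\<bar> \<le> e"
      using d(3) by linarith
  qed
qed

text \<open>The substitution y = exp a turns polynomials in y into sums of the functions exp (i a),
  which reduces the claim to the Weierstrass theorem.\<close>

lemma KL_dense:
  assumes A: "0 \<le> A" and f: "continuous_on {- A..A} f"
  shows "KL_approx A f"
proof (rule KL_approx_closed)
  fix e :: real assume e: "0 < e"
  have fc: "continuous_on {exp (- A)..exp A} (\<lambda>y. f (ln y))"
  proof (rule continuous_on_compose2[OF f])
    show "continuous_on {exp (- A)..exp A} ln"
      by (intro continuous_on_ln continuous_on_id) (auto dest: less_le_trans[OF exp_gt_zero])
    show "ln ` {exp (- A)..exp A} \<subseteq> {- A..A}"
    proof safe
      fix y assume y: "y \<in> {exp (- A)..exp A}"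
      then have "0 < y" by (auto intro: less_le_trans[OF exp_gt_zero])
      moreover from this y have "ln y \<le> ln (exp A)" by (subst ln_le_cancel_iff) auto
      ultimately show "ln y \<in> {- A..A}" using y by (simp add: ln_ge_iff)
    qed
  qed
  obtain p where p: "real_polynomial_function p" "\<And>y. y \<in> {exp (- A)..exp A} \<Longrightarrow> \<bar>f (ln y) - p y\<bar> < e"
    using Stone_Weierstrass_real_polynomial_function[OF _ fc e] by auto
  obtain c n where c: "p = (\<lambda>y. \<Sum>i\<le>n. c i * y ^ i)"
    using real_polynomial_function_imp_sum[OF p(1)] by blast
  show "\<exists>g. KL_approx A g \<and> (\<forall>a\<in>{- A..A}. \<bar>f a - g a\<bar> \<le> e)"
  proof (intro exI conjI ballI)
    have "KL_approx A (\<lambda>a. \<Sum>i\<in>F. c i * exp (a * real i))" if "finite F" for F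
      using that
    proof induction
      case empty
      show ?case using KL_approx_exp[OF A, of 0] by simp
    next
      case (insert i F)
      then show ?case using KL_approx_add[OF KL_approx_exp[OF A]] by simp
    qed
    then show "KL_approx A (\<lambda>a. \<Sum>i\<in>{..n}. c i * exp (a * real i))" by blast
    fix a assume "a \<in> {- A..A}"
    then have "\<bar>f (ln (exp a)) - p (exp a)\<bar> < e" by (intro p) auto
    moreover have "exp a ^ i = exp (a * real i)" for i by (simp add: exp_of_nat_mult[symmetric] mult.commute)
    ultimately show "\<bar>f a - (\<Sum>i\<le>n. c i * exp (a * real i))\<bar> \<le> e" unfolding c by simp
  qed
qed

section \<open>Uniqueness and existence of the measure on bounded laws\<close>

lemma integrable_continuous_compact_support:
  fixes f :: "real \<Rightarrow> real"
  assumes "real_distribution \<mu>" "AE x in \<mu>. x \<in> {- A..A}" "continuous_on UNIV f"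
  shows "integrable \<mu> f"
proof -
  interpret real_distribution \<mu> by fact
  have "bounded (f ` {- A..A})"
    by (intro compact_imp_bounded compact_continuous_image continuous_on_subset[OF assms(3)]) auto
  then obtain B where "\<forall>y\<in>f ` {- A..A}. norm y \<le> B" by (auto simp: bounded_iff)
  then have B: "norm (f x) \<le> B" if "x \<in> {- A..A}" for x using that by simp
  have "AE x in \<mu>. norm (f x) \<le> B" using assms(2) by eventually_elim (rule B)
  then show ?thesis
    using borel_measurable_continuous_onI[OF assms(3)] by (intro integrable_const_bound[where B = B]) auto
qed

lemma continuous_on_KL: "exp_law N \<Longrightarrow> continuous_on S (KL N)"
  by (intro continuous_at_imp_continuous_on ballI isCont_KL)

text \<open>By density the two measures agree on all continuous functions, in particular on cosines
  and sines, hence they have the same characteristic function.\<close>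

lemma representing_measure_unique:
  assumes \<mu>: "real_distribution \<mu>" "AE x in \<mu>. x \<in> {- A..A}" and \<nu>: "real_distribution \<nu>" "AE x in \<nu>. x \<in> {- A..A}"
    and A: "0 \<le> A" and eq: "\<And>N. bounded_law N \<Longrightarrow> (\<integral>a. KL N a \<partial>\<mu>) = (\<integral>a. KL N a \<partial>\<nu>)"
  shows "\<mu> = \<nu>"
proof -
  have cont_eq: "(\<integral>a. f a \<partial>\<mu>) = (\<integral>a. f a \<partial>\<nu>)" if f: "continuous_on UNIV f" for f :: "real \<Rightarrow> real"
  proof -
    have "\<bar>(\<integral>a. f a \<partial>\<mu>) - (\<integral>a. f a \<partial>\<nu>)\<bar> \<le> 0 + e" if e: "0 < e" for e
    proof -
      have "KL_approx A f" by (rule KL_dense[OF A continuous_on_subset[OF f]]) simp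
      moreover have e2: "0 < e / 2" using e by simp
      ultimately obtain N1 N2 m where N: "bounded_law N1" "bounded_law N2" "0 < (m::nat)"
        "\<forall>a\<in>{- A..A}. \<bar>f a - (KL N1 a - KL N2 a) / real m\<bar> \<le> e / 2"
        unfolding KL_approx_def by meson
      note el = N(1,2)[THEN bounded_law_exp_law]
      let ?g = "\<lambda>a. (KL N1 a - KL N2 a) / real m"
      have close: "\<bar>(\<integral>a. f a \<partial>\<rho>) - (\<integral>a. ?g a \<partial>\<rho>)\<bar> \<le> e / 2" "(\<integral>a. ?g a \<partial>\<rho>) = ((\<integral>a. KL N1 a \<partial>\<rho>) - (\<integral>a. KL N2 a \<partial>\<rho>)) / real m"
        if \<rho>: "real_distribution \<rho>" "AE x in \<rho>. x \<in> {- A..A}" for \<rho>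
      proof -
        interpret real_distribution \<rho> by (rule \<rho>(1))
        note int = integrable_continuous_compact_support[OF \<rho>]
        have i: "integrable \<rho> (KL N1)" "integrable \<rho> (KL N2)" "integrable \<rho> f" by (auto intro!: int continuous_on_KL el f)
        then show "(\<integral>a. ?g a \<partial>\<rho>) = ((\<integral>a. KL N1 a \<partial>\<rho>) - (\<integral>a. KL N2 a \<partial>\<rho>)) / real m" by simp
        have "\<bar>(\<integral>a. f a \<partial>\<rho>) - (\<integral>a. ?g a \<partial>\<rho>)\<bar> = \<bar>\<integral>a. f a - ?g a \<partial>\<rho>\<bar>" using i by simp
        also have "\<dots> \<le> (\<integral>a. \<bar>f a - ?g a\<bar> \<partial>\<rho>)" by (rule integral_abs_bound)
        also have "\<dots> \<le> (\<integral>a. e / 2 \<partial>\<rho>)"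
        proof (rule integral_mono_AE)
          show "AE a in \<rho>. \<bar>f a - ?g a\<bar> \<le> e / 2"
            using \<rho>(2) by eventually_elim (use N(4) in blast)
        qed (use i in auto)
        finally show "\<bar>(\<integral>a. f a \<partial>\<rho>) - (\<integral>a. ?g a \<partial>\<rho>)\<bar> \<le> e / 2" by (simp add: prob_space[unfolded space_eq_univ])
      qed
      have "(\<integral>a. ?g a \<partial>\<mu>) = (\<integral>a. ?g a \<partial>\<nu>)" unfolding close(2)[OF \<mu>] close(2)[OF \<nu>] eq[OF N(1)] eq[OF N(2)] ..
      with close(1)[OF \<mu>] close(1)[OF \<nu>] show ?thesis by linarith
    qed
    then have "\<bar>(\<integral>a. f a \<partial>\<mu>) - (\<integral>a. f a \<partial>\<nu>)\<bar> \<le> 0" by (rule field_le_epsilon)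
    then show ?thesis by simp
  qed
  have "char \<mu> t = char \<nu> t" for t
  proof (rule complex_eqI)
    interpret \<mu>: real_distribution \<mu> by (rule \<mu>(1))
    interpret \<nu>: real_distribution \<nu> by (rule \<nu>(1))
    have "continuous_on UNIV (\<lambda>x. cos (t * x))" "continuous_on UNIV (\<lambda>x. sin (t * x))" by (intro continuous_intros)+
    note c = cont_eq[OF this(1)] cont_eq[OF this(2)]
    have Re: "Re (char \<rho> t) = (\<integral>x. cos (t * x) \<partial>\<rho>)" and Im: "Im (char \<rho> t) = (\<integral>x. sin (t * x) \<partial>\<rho>)"
      if "real_distribution \<rho>" for \<rho>
    proof -
      interpret real_distribution \<rho> by fact
      have "integrable \<rho> (\<lambda>x. iexp (t * x))" by (rule integrable_iexp) auto
      then show "Re (char \<rho> t) = (\<integral>x. cos (t * x) \<partial>\<rho>)" "Im (char \<rho> t) = (\<integral>x. sin (t * x) \<partial>\<rho>)"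
        unfolding char_def by (simp_all add: integral_Re[symmetric] integral_Im[symmetric] Re_exp Im_exp del: integral_Re integral_Im)
    qed
    show "Re (char \<mu> t) = Re (char \<nu> t)" "Im (char \<mu> t) = Im (char \<nu> t)"
      using c by (simp_all add: Re Im \<mu>(1) \<nu>(1))
  qed
  then show ?thesis using Levy_uniqueness[OF \<mu>(1) \<nu>(1)] by blast
qed

text \<open>Density yields only approximations, so the functional is extended to C[-A, A] as an
  infimum over dominating cumulant differences; \<phi> is recovered as its value at a cumulant
  function.\<close>

lemma (in law_statistic) bounded_representation:
  obtains \<mu> A where "0 < A" "real_distribution \<mu>" "AE x in \<mu>. x \<in> {- A..A}"
    "\<And>N. bounded_law N \<Longrightarrow> \<phi> N = (\<integral>a. KL N a \<partial>\<mu>)"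
proof -
  obtain A where A: "0 < A" and mono_A: "\<And>N1 N2 B. exp_law N1 \<Longrightarrow> exp_law N2 \<Longrightarrow> AE x in N1. \<bar>x\<bar> \<le> B \<Longrightarrow>
      AE x in N2. \<bar>x\<bar> \<le> B \<Longrightarrow> (\<And>a. a \<in> {- A..A} \<Longrightarrow> KL N2 a \<le> KL N1 a) \<Longrightarrow> \<phi> N2 \<le> \<phi> N1"
    using mono_on_compact by blast
  have mono_b: "\<phi> N2 \<le> \<phi> N1" if N: "bounded_law N1" "bounded_law N2" and le: "\<And>a. a \<in> {- A..A} \<Longrightarrow> KL N2 a \<le> KL N1 a" for N1 N2
  proof -
    obtain B1 B2 where "AE x in N1. \<bar>x\<bar> \<le> B1" "AE x in N2. \<bar>x\<bar> \<le> B2" using N by (auto simp: bounded_law_def)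
    then have "AE x in N1. \<bar>x\<bar> \<le> max B1 B2" "AE x in N2. \<bar>x\<bar> \<le> max B1 B2" by (auto elim!: eventually_mono)
    with mono_A[OF N[THEN bounded_law_exp_law]] le show ?thesis by blast
  qed
  \<comment> \<open>Clearing denominators and moving the negative terms across leaves a comparison
    of two genuine laws, with the error e carried by a constant.\<close>
  have compare: "(\<phi> N1 - \<phi> N2) / real m \<le> (\<phi> N3 - \<phi> N4) / real n + e"
    if N: "bounded_law N1" "bounded_law N2" "bounded_law N3" "bounded_law N4" and mn: "0 < m" "0 < n"
      and le: "\<And>a. a \<in> {- A..A} \<Longrightarrow> (KL N1 a - KL N2 a) / real m \<le> (KL N3 a - KL N4 a) / real n + e"
    for N1 N2 N3 N4 e and m n :: nat
  proof -
    let ?P = "conv_pow n N1 \<star> conv_pow m N4" and ?Q = "(conv_pow m N3 \<star> conv_pow n N2) \<star> return borel (real m * real n * e)"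
    note el = N[THEN bounded_law_exp_law]
    have "\<phi> ?P \<le> \<phi> ?Q"
    proof (rule mono_b)
      fix a assume "a \<in> {- A..A}"
      from le[OF this] have "real m * real n * ((KL N1 a - KL N2 a) / real m) \<le> real m * real n * ((KL N3 a - KL N4 a) / real n + e)"
        by (intro mult_left_mono) auto
      moreover have "real m * real n * ((KL N1 a - KL N2 a) / real m) = real n * KL N1 a - real n * KL N2 a"
        "real m * real n * ((KL N3 a - KL N4 a) / real n + e) = real m * KL N3 a - real m * KL N4 a + real m * real n * e"
        using mn by (simp_all add: field_simps)
      ultimately have "real n * KL N1 a + real m * KL N4 a \<le> real m * KL N3 a + real n * KL N2 a + real m * real n * e"
        by linarith
      then show "KL ?P a \<le> KL ?Q a"
        by (simp add: KL_convolution exp_law_convolution exp_law_conv_pow KL_conv_pow el)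
    qed (auto intro!: bounded_law_convolution bounded_law_conv_pow N)
    then have "real n * \<phi> N1 + real m * \<phi> N4 \<le> real m * \<phi> N3 + real n * \<phi> N2 + real m * real n * e"
      by (simp add: add exp_law_convolution exp_law_conv_pow conv_pow el const)
    then show ?thesis using mn by (simp add: field_simps)
  qed
  define V where "V f = {(\<phi> N1 - \<phi> N2) / real m | N1 N2 m. bounded_law N1 \<and> bounded_law N2 \<and> 0 < m \<and>
    (\<forall>a\<in>{- A..A}. f a \<le> (KL N1 a - KL N2 a) / real m)}" for f :: "real \<Rightarrow> real"
  define L where "L f = Inf (V f)" for f
  \<comment> \<open>Shows at once that the infimum is finite, that it is continuous in f, and, with
    e = 0, that it agrees with \<phi> on cumulant differences.\<close>
  have L_close: "\<bar>L f - (\<phi> N1 - \<phi> N2) / real m\<bar> \<le> e"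
    if N: "bounded_law N1" "bounded_law N2" "0 < m" and close: "\<And>a. a \<in> {- A..A} \<Longrightarrow> \<bar>f a - (KL N1 a - KL N2 a) / real m\<bar> \<le> e"
    for f N1 N2 e and m :: nat
  proof -
    have lower: "(\<phi> N1 - \<phi> N2) / real m - e \<le> v" if vV: "v \<in> V f" for v
    proof -
      obtain N3 N4 n where v: "v = (\<phi> N3 - \<phi> N4) / real n" "bounded_law N3" "bounded_law N4" "0 < n"
        "\<forall>a\<in>{- A..A}. f a \<le> (KL N3 a - KL N4 a) / real n"
        using vV unfolding V_def by blast
      have "(\<phi> N1 - \<phi> N2) / real m \<le> (\<phi> N3 - \<phi> N4) / real n + e"
      proof (rule compare)
        fix a assume "a \<in> {- A..A}"
        with v(5) close[of a] show "(KL N1 a - KL N2 a) / real m \<le> (KL N3 a - KL N4 a) / real n + e" by force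
      qed (use N v in auto)
      then show ?thesis by (simp add: v(1))
    qed
    let ?N1 = "N1 \<star> return borel (real m * e)"
    have el: "exp_law N1" "exp_law N2" using N by (auto intro: bounded_law_exp_law)
    have "(\<phi> ?N1 - \<phi> N2) / real m \<in> V f"
      unfolding V_def
    proof (intro CollectI exI conjI ballI refl)
      fix a assume "a \<in> {- A..A}"
      from close[OF this] have "f a \<le> (KL N1 a - KL N2 a) / real m + e" by linarith
      also have "\<dots> = (KL ?N1 a - KL N2 a) / real m" using N(3) by (simp add: KL_convolution el field_simps)
      finally show "f a \<le> (KL ?N1 a - KL N2 a) / real m" .
    qed (use N in \<open>auto intro!: bounded_law_convolution\<close>)
    moreover have "(\<phi> ?N1 - \<phi> N2) / real m = (\<phi> N1 - \<phi> N2) / real m + e"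
      using N(3) by (simp add: add el const field_simps)
    ultimately have mem: "(\<phi> N1 - \<phi> N2) / real m + e \<in> V f" by simp
    have "bdd_below (V f)" using lower by (rule bdd_belowI)
    then have "L f \<le> (\<phi> N1 - \<phi> N2) / real m + e" unfolding L_def by (rule cInf_lower[OF mem])
    moreover have "(\<phi> N1 - \<phi> N2) / real m - e \<le> L f"
      unfolding L_def using lower mem by (intro cInf_greatest) auto
    ultimately show ?thesis by linarith
  qed
  note approx = KL_dense[OF less_imp_le[OF A], unfolded KL_approx_def, rule_format]
  have L_add: "L (\<lambda>a. f a + g a) = L f + L g" if fg: "continuous_on {- A..A} f" "continuous_on {- A..A} g" for f g
  proof -
    have "\<bar>L (\<lambda>a. f a + g a) - (L f + L g)\<bar> \<le> 0 + e" if "0 < e" for e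
    proof -
      have e4: "0 < e / 4" using \<open>0 < e\<close> by simp
      obtain N1 N2 m where f: "bounded_law N1" "bounded_law N2" "0 < (m::nat)"
        "\<forall>a\<in>{- A..A}. \<bar>f a - (KL N1 a - KL N2 a) / real m\<bar> \<le> e / 4"
        using approx[OF fg(1) e4] by blast
      obtain P1 P2 n where g: "bounded_law P1" "bounded_law P2" "0 < (n::nat)"
        "\<forall>a\<in>{- A..A}. \<bar>g a - (KL P1 a - KL P2 a) / real n\<bar> \<le> e / 4"
        using approx[OF fg(2) e4] by blast
      let ?Q1 = "conv_pow n N1 \<star> conv_pow m P1" and ?Q2 = "conv_pow n N2 \<star> conv_pow m P2"
      note el = f(1,2)[THEN bounded_law_exp_law] g(1,2)[THEN bounded_law_exp_law]
      note K = KL_common_denominator[OF el f(3) g(3)]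
      have F: "(\<phi> ?Q1 - \<phi> ?Q2) / real (m * n) = (\<phi> N1 - \<phi> N2) / real m + (\<phi> P1 - \<phi> P2) / real n"
        using f g by (simp add: add conv_pow el exp_law_conv_pow field_simps)
      have 1: "\<bar>L (\<lambda>a. f a + g a) - (\<phi> ?Q1 - \<phi> ?Q2) / real (m * n)\<bar> \<le> e / 2"
      proof (rule L_close)
        fix a assume "a \<in> {- A..A}"
        with f(4) g(4) have "\<bar>f a - (KL N1 a - KL N2 a) / real m\<bar> \<le> e / 4" "\<bar>g a - (KL P1 a - KL P2 a) / real n\<bar> \<le> e / 4"
          by auto
        then show "\<bar>f a + g a - (KL ?Q1 a - KL ?Q2 a) / real (m * n)\<bar> \<le> e / 2" unfolding K by linarith
      qed (use f g in \<open>auto intro!: bounded_law_convolution bounded_law_conv_pow\<close>)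
      have 2: "\<bar>L f - (\<phi> N1 - \<phi> N2) / real m\<bar> \<le> e / 4" using f by (intro L_close) auto
      have 3: "\<bar>L g - (\<phi> P1 - \<phi> P2) / real n\<bar> \<le> e / 4" using g by (intro L_close) auto
      from 1 2 3 show ?thesis unfolding F by linarith
    qed
    then have "\<bar>L (\<lambda>a. f a + g a) - (L f + L g)\<bar> \<le> 0" by (rule field_le_epsilon)
    then show ?thesis by simp
  qed
  have zero: "\<phi> (return borel 0) = 0" by (rule const)
  have L_bound: "\<bar>L f\<bar> \<le> C" if "\<And>a. a \<in> {- A..A} \<Longrightarrow> \<bar>f a\<bar> \<le> C" for f C
    using L_close[of "return borel 0" "return borel 0" 1 f C] that by simp
  have L_scale: "L (\<lambda>a. c * f a) = c * L f" if f: "continuous_on {- A..A} f" for c f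
  proof -
    have "bounded (f ` {- A..A})" by (intro compact_imp_bounded compact_continuous_image f) auto
    then obtain C where "\<forall>y\<in>f ` {- A..A}. norm y \<le> C" by (auto simp: bounded_iff)
    then have C: "\<bar>f a\<bar> \<le> C" if "a \<in> {- A..A}" for a using that by auto
    \<comment> \<open>For fixed f, L (x f) is additive in x and bounded by C |x|, hence linear in
      x.\<close>
    have "L (\<lambda>a. c * f a) = c * L (\<lambda>a. 1 * f a)"
    proof (rule additive_bounded_linear)
      show "L (\<lambda>a. (x + y) * f a) = L (\<lambda>a. x * f a) + L (\<lambda>a. y * f a)" for x y
        unfolding distrib_right using f by (intro L_add continuous_intros)
      show "\<bar>L (\<lambda>a. x * f a)\<bar> \<le> C * \<bar>x\<bar>" for x
      proof (rule L_bound)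
        fix a assume "a \<in> {- A..A}"
        from mult_left_mono[OF C[OF this] abs_ge_zero[of x]] show "\<bar>x * f a\<bar> \<le> C * \<bar>x\<bar>"
          by (simp add: abs_mult mult.commute)
      qed
    qed
    then show ?thesis by simp
  qed
  have L_pos: "0 \<le> L f" if f: "continuous_on {- A..A} f" and "\<And>a. a \<in> {- A..A} \<Longrightarrow> 0 \<le> f a" for f
  proof (rule field_le_epsilon)
    fix e :: real assume "0 < e"
    then have e2: "0 < e / 2" by simp
    obtain N1 N2 m where N: "bounded_law N1" "bounded_law N2" "0 < (m::nat)"
      "\<forall>a\<in>{- A..A}. \<bar>f a - (KL N1 a - KL N2 a) / real m\<bar> \<le> e / 2"
      using approx[OF f e2] by blast
    have "(\<phi> (return borel 0) - \<phi> (return borel 0)) / real 1 \<le> (\<phi> N1 - \<phi> N2) / real m + e / 2"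
    proof (rule compare)
      fix a assume a: "a \<in> {- A..A}"
      with N(4) have "\<bar>f a - (KL N1 a - KL N2 a) / real m\<bar> \<le> e / 2" by blast
      with that(2)[OF a] have "0 \<le> (KL N1 a - KL N2 a) / real m + e / 2" by linarith
      then show "(KL (return borel 0) a - KL (return borel 0) a) / real 1 \<le> (KL N1 a - KL N2 a) / real m + e / 2"
        by simp
    qed (use N in auto)
    moreover have "\<bar>L f - (\<phi> N1 - \<phi> N2) / real m\<bar> \<le> e / 2" using N by (intro L_close) auto
    ultimately show "0 \<le> L f + e" unfolding diff_self div_0 by linarith
  qed
  have L_KL: "L (KL N) = \<phi> N" if "bounded_law N" for N
    using L_close[of N "return borel 0" 1 "KL N" 0] that zero by simp
  have L_one: "L (\<lambda>_. 1) = 1"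
    using L_KL[of "return borel 1"] by (simp add: const fun_eq_iff[symmetric] KL_return[abs_def])
  have "- A < A" using A by simp
  then obtain \<mu> where \<mu>: "real_distribution \<mu>" "AE x in \<mu>. x \<in> {- A..A}"
    "\<And>f. continuous_on UNIV f \<Longrightarrow> (\<integral>x. f x \<partial>\<mu>) = L f"
    by (rule riesz_interval[OF _ L_add L_scale L_pos L_one]) (assumption | rule that)+
  show ?thesis
  proof (rule that[OF A \<mu>(1,2)])
    fix N assume "bounded_law N"
    then show "\<phi> N = (\<integral>a. KL N a \<partial>\<mu>)"
      by (simp add: \<mu>(3) continuous_on_KL bounded_law_exp_law L_KL)
  qed
qed

section \<open>Passage to unbounded variables\<close>

lemma cdf_convolution_le:
  assumes N: "exp_law N1" "exp_law N2" and c: "AE x in N1. - c \<le> x"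
  shows "cdf (N1 \<star> N2) t \<le> cdf N2 (t + c)"
proof -
  interpret N1: prob_space N1 by (rule exp_lawD[OF N(1)])
  interpret N2: real_distribution N2 by (rule exp_law_real_distr[OF N(2)])
  interpret C: real_distribution "N1 \<star> N2" by (rule exp_law_real_distr[OF exp_law_convolution[OF N]])
  have "emeasure (N1 \<star> N2) {..t} = (\<integral>\<^sup>+x. emeasure N2 {a. a + x \<in> {..t}} \<partial>N1)"
    by (rule convolution_emeasure) (use N in \<open>auto dest: exp_lawD\<close>)
  also have "\<dots> \<le> (\<integral>\<^sup>+x. emeasure N2 {..t + c} \<partial>N1)"
    using c by (intro nn_integral_mono_AE, eventually_elim) (auto intro!: emeasure_mono)
  also have "\<dots> = emeasure N2 {..t + c}" by (simp add: N1.emeasure_space_1)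
  finally show ?thesis by (simp add: cdf_def C.emeasure_eq_measure N2.emeasure_eq_measure)
qed

section \<open>Truncations and independent tails\<close>

definition clip :: "real \<Rightarrow> real \<Rightarrow> real" where
  "clip c x = max (- c) (min c x)"

abbreviation trunc :: "nat \<Rightarrow> real measure \<Rightarrow> real measure" where
  "trunc n N \<equiv> distr N borel (clip (real n))"

text \<open>The factor 2 is the price of independence: the tail is added to an independent
  truncation, which may be as low as - c, and 2 x - c \<ge> x for x \<ge> c.\<close>

definition upper_tail :: "real \<Rightarrow> real \<Rightarrow> real" where
  "upper_tail c x = (if c \<le> x then 2 * x else 0)"

lemma clip_measurable [measurable]: "clip c \<in> borel_measurable borel"
  unfolding clip_def[abs_def] by measurable

lemma upper_tail_measurable [measurable]: "upper_tail c \<in> borel_measurable borel"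
  unfolding upper_tail_def[abs_def] by measurable

lemma abs_clip_le: "0 \<le> c \<Longrightarrow> \<bar>clip c x\<bar> \<le> \<bar>x\<bar>" "0 \<le> c \<Longrightarrow> \<bar>clip c x\<bar> \<le> c"
  by (auto simp: clip_def)

lemma exp_law_clip: "exp_law N \<Longrightarrow> 0 \<le> c \<Longrightarrow> exp_law (distr N borel (clip c))"
  by (rule exp_law_distr_linear_growth[where c = 1 and d = 0]) (auto simp: abs_clip_le)

lemma exp_law_upper_tail: "exp_law N \<Longrightarrow> exp_law (distr N borel (upper_tail c))"
  by (rule exp_law_distr_linear_growth[where c = 2 and d = 0]) (auto simp: upper_tail_def)

lemma bounded_law_clip:
  assumes "exp_law N" "0 \<le> c"
  shows "bounded_law (distr N borel (clip c))"
proof -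
  have "AE x in distr N borel (clip c). \<bar>x\<bar> \<le> c"
    using exp_lawD(2)[OF assms(1)] assms(2)
    by (subst AE_distr_iff) (auto cong: measurable_cong_sets simp: abs_clip_le)
  then show ?thesis using exp_law_clip[OF assms] by (auto simp: bounded_law_def)
qed

lemma AE_upper_tail_nonneg:
  assumes "exp_law N" "0 \<le> c"
  shows "AE x in distr N borel (upper_tail c). 0 \<le> x"
  using exp_lawD(2)[OF assms(1)] assms(2)
  by (subst AE_distr_iff) (auto cong: measurable_cong_sets simp: upper_tail_def)

text \<open>Below - c the sum has no mass. Between - c and c it is enough that the tail is
  nonnegative. From c on, the truncation is at least - c, and the doubled tail makes up for
  it.\<close>

lemma cdf_clip_tail_le:
  assumes N: "exp_law N" and c: "0 \<le> c"
  shows "cdf (distr N borel (clip c) \<star> distr N borel (upper_tail c)) t \<le> cdf N t"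
proof -
  interpret real_distribution N by (rule exp_law_real_distr[OF N])
  let ?C = "distr N borel (clip c)" and ?T = "distr N borel (upper_tail c)"
  note el = exp_law_clip[OF N c] exp_law_upper_tail[OF N, of c]
  have [simp, measurable_cong]: "sets N = sets borel" by simp
  have cdf_distr: "cdf (distr N borel g) s = prob {x. g x \<le> s}" if [measurable]: "g \<in> borel_measurable borel" for g s
    by (simp add: cdf_def measure_distr vimage_def)
  have C: "AE x in ?C. - c \<le> x" using c by (subst AE_distr_iff) (auto simp: clip_def)
  have T: "AE x in ?T. - 0 \<le> x" using AE_upper_tail_nonneg[OF N c] by simp
  consider "t < - c" | "- c \<le> t" "t < c" | "c \<le> t" by linarith
  then show ?thesis
  proof cases
    case 1
    have "AE x in ?C \<star> ?T. - c \<le> x" by (rule AE_convolution[OF el C T]) auto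
    then have "AE x in ?C \<star> ?T. t < x" by eventually_elim (use 1 in simp)
    then have "cdf (?C \<star> ?T) t = 0"
      by (intro cdf_eq_0_of_AE_gt exp_law_real_distr exp_law_convolution el)
    then show ?thesis by (simp add: cdf_nonneg)
  next
    case 2
    have "cdf (?C \<star> ?T) t = cdf (?T \<star> ?C) t"
      using el by (subst convolution_commutative) (auto dest: exp_lawD)
    also have "\<dots> \<le> cdf ?C (t + 0)" by (rule cdf_convolution_le[OF el(2,1) T])
    also have "\<dots> = prob {x. clip c x \<le> t}" by (simp add: cdf_distr)
    also have "{x. clip c x \<le> t} = {..t}" using 2 by (auto simp: clip_def)
    finally show ?thesis by (simp add: cdf_def)
  next
    case 3
    have "cdf (?C \<star> ?T) t \<le> cdf ?T (t + c)" by (rule cdf_convolution_le[OF el C])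
    also have "\<dots> = prob {x. upper_tail c x \<le> t + c}" by (simp add: cdf_distr)
    also have "\<dots> \<le> prob {..t}" using 3 by (intro finite_measure_mono) (auto simp: upper_tail_def split: if_splits)
    finally show ?thesis by (simp add: cdf_def)
  qed
qed

text \<open>By dominated convergence the exponential moments of the tails tend to 1, so suitable
  cut-offs meet the hypotheses of \<open>rare_laws_small\<close>. One small value bounds all later
  ones, because the tail decreases in the cut-off.\<close>

lemma (in law_statistic) upper_tail_small:
  assumes N: "exp_law N" and e: "0 < e"
  shows "\<forall>\<^sub>F n in sequentially. \<phi> (distr N borel (upper_tail (real n))) < e"
proof -
  interpret real_distribution N by (rule exp_law_real_distr[OF N])
  have [simp, measurable_cong]: "sets N = sets borel" by simp
  let ?T = "\<lambda>n::nat. distr N borel (upper_tail (real n))"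
  have lim: "(\<lambda>n. \<integral>x. exp (real j * upper_tail (real n) x) \<partial>N) \<longlonglongrightarrow> (\<integral>x. 1 \<partial>N)" for j :: nat
  proof (rule integral_dominated_convergence[where w = "\<lambda>x. exp ((2 * real j) * \<bar>x\<bar>)"])
    show "integrable N (\<lambda>x. exp ((2 * real j) * \<bar>x\<bar>))" by (rule exp_law_integrable_exp_abs[OF N])
    show "AE x in N. (\<lambda>n. exp (real j * upper_tail (real n) x)) \<longlonglongrightarrow> 1"
    proof (rule AE_I2)
      fix x
      obtain k :: nat where k: "x < real k" using reals_Archimedean2 by blast
      have "\<forall>\<^sub>F n in sequentially. exp (real j * upper_tail (real n) x) = 1"
        using eventually_ge_at_top[of k]
      proof eventually_elim
        case (elim n)
        then have "x < real n" using k of_nat_mono[OF elim, where 'a = real] by linarith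
        then show ?case by (simp add: upper_tail_def)
      qed
      then show "(\<lambda>n. exp (real j * upper_tail (real n) x)) \<longlonglongrightarrow> 1" by (rule tendsto_eventually)
    qed
    show "AE x in N. norm (exp (real j * upper_tail (real n) x)) \<le> exp (2 * real j * \<bar>x\<bar>)" for n
      by (rule AE_I2) (auto simp: upper_tail_def intro!: mult_left_mono)
  qed auto
  have "\<exists>n. (\<integral>x. exp (real j * x) \<partial>?T n) \<le> exp ((1 / 2) ^ j / real (Suc j))" for j :: nat
  proof -
    have "(\<integral>x. 1 \<partial>N) < exp ((1 / 2) ^ j / real (Suc j))" using prob_space by simp
    from order_tendstoD(2)[OF lim this]
    obtain n where "(\<integral>x. exp (real j * upper_tail (real n) x) \<partial>N) < exp ((1 / 2) ^ j / real (Suc j))"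
      by (auto simp: eventually_sequentially)
    then show ?thesis by (intro exI[of _ n]) (simp add: integral_distr del: of_nat_Suc)
  qed
  then obtain k where k: "\<And>j. (\<integral>x. exp (real j * x) \<partial>?T (k j)) \<le> exp ((1 / 2) ^ j / real (Suc j))" by metis
  obtain j where j: "\<phi> (?T (k j)) < e"
    using rare_laws_small[of "\<lambda>j. ?T (k j)", OF exp_law_upper_tail[OF N] AE_upper_tail_nonneg[OF N] k e] by auto
  have "\<phi> (?T n) < e" if "k j \<le> n" for n
  proof -
    have "\<phi> (?T n) \<le> \<phi> (?T (k j))"
    proof (rule mono[OF exp_law_upper_tail[OF N] exp_law_upper_tail[OF N]])
      have "upper_tail (real n) x \<le> upper_tail (real (k j)) x" for x
        using that of_nat_mono[OF that, where 'a = real] by (auto simp: upper_tail_def)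
      then show "cdf (?T (k j)) t \<le> cdf (?T n) t" for t
        by (intro cdf_distr_le prob_space_axioms) auto
    qed
    with j show ?thesis by simp
  qed
  then show ?thesis by (auto simp: eventually_sequentially)
qed

lemma (in law_statistic) upper_clip:
  assumes N: "exp_law N" and e: "0 < e"
  shows "\<forall>\<^sub>F n in sequentially. \<phi> N \<le> \<phi> (trunc n N) + e"
  using upper_tail_small[OF N e]
proof eventually_elim
  case (elim n)
  have "\<phi> N \<le> \<phi> (trunc n N \<star> distr N borel (upper_tail (real n)))"
    by (intro mono exp_law_convolution exp_law_clip exp_law_upper_tail N cdf_clip_tail_le) auto
  with elim show ?case by (simp add: add exp_law_clip exp_law_upper_tail N)
qed

text \<open>The lower half is the upper half for the reflected functional, since clipping is
  odd.\<close>

lemma (in law_statistic) clip_tendsto: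
  assumes N: "exp_law N"
  shows "(\<lambda>n. \<phi> (trunc n N)) \<longlonglongrightarrow> \<phi> N"
proof (rule tendstoI)
  fix e :: real assume "0 < e"
  then have e: "0 < e / 2" by simp
  have [simp, measurable_cong]: "sets N = sets borel" by (rule exp_lawD[OF N])
  have [simp]: "space N = UNIV" by (rule exp_lawD[OF N])
  interpret refl: law_statistic "\<lambda>N. - \<phi> (reflect N)" by (rule reflected)
  have 1: "reflect (reflect N) = N"
    unfolding reflect_def by (subst distr_distr) (auto simp: comp_def intro: distr_id2)
  have 2: "reflect (distr (reflect N) borel (clip (real n))) = trunc n N" for n
    unfolding reflect_def by (simp add: distr_distr comp_def) (rule distr_cong, auto simp: clip_def)
  show "\<forall>\<^sub>F n in sequentially. dist (\<phi> (trunc n N)) (\<phi> N) < e"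
    using upper_clip[OF N e] refl.upper_clip[OF exp_law_reflect[OF N] e]
  proof eventually_elim
    case (elim n)
    then show ?case using \<open>0 < e\<close> unfolding 1 2 dist_real_def by linarith
  qed
qed

lemma KL_clip_tendsto:
  assumes N: "exp_law N"
  shows "(\<lambda>n. KL (trunc n N) a) \<longlonglongrightarrow> KL N a"
proof -
  have [simp, measurable_cong]: "sets N = sets borel" by (rule exp_lawD[OF N])
  have m: "(\<lambda>n. mexp (trunc n N) a) \<longlonglongrightarrow> mexp N a"
    unfolding mexp_distr[OF \<open>sets N = sets borel\<close> clip_measurable]
    unfolding mexp_def
  proof (rule integral_dominated_convergence[where w = "\<lambda>x. exp ((\<bar>a\<bar> + 1) * \<bar>x\<bar>)"])
    show "integrable N (\<lambda>x. exp ((\<bar>a\<bar> + 1) * \<bar>x\<bar>))" by (rule exp_law_integrable_exp_abs[OF N])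
    show "AE x in N. (\<lambda>n. expint a (clip (real n) x)) \<longlonglongrightarrow> expint a x"
    proof (rule AE_I2)
      fix x
      obtain k :: nat where k: "\<bar>x\<bar> < real k" using reals_Archimedean2 by blast
      have "\<forall>\<^sub>F n in sequentially. expint a (clip (real n) x) = expint a x"
        using eventually_ge_at_top[of k]
      proof eventually_elim
        case (elim n)
        then have "\<bar>x\<bar> < real n" using k of_nat_mono[OF elim, where 'a = real] by linarith
        then have "clip (real n) x = x" unfolding clip_def by linarith
        then show ?case by simp
      qed
      then show "(\<lambda>n. expint a (clip (real n) x)) \<longlonglongrightarrow> expint a x" by (rule tendsto_eventually)
    qed
    show "AE x in N. norm (expint a (clip (real n) x)) \<le> exp ((\<bar>a\<bar> + 1) * \<bar>x\<bar>)" for n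
    proof (rule AE_I2)
      fix x
      have "\<bar>expint a (clip (real n) x)\<bar> \<le> exp ((\<bar>a\<bar> + 1) * \<bar>clip (real n) x\<bar>)" by (rule abs_expint_le) simp
      also have "\<dots> \<le> exp ((\<bar>a\<bar> + 1) * \<bar>x\<bar>)" by (simp add: abs_clip_le mult_left_mono)
      finally show "norm (expint a (clip (real n) x)) \<le> exp ((\<bar>a\<bar> + 1) * \<bar>x\<bar>)" by simp
    qed
  qed auto
  have "a * mexp N a > -1"
    using one_plus_mexp[OF N, of a] exp_law_expectation_exp_pos[OF N, of a] by linarith
  then have "(\<lambda>n. lnq (a * mexp (trunc n N) a)) \<longlonglongrightarrow> lnq (a * mexp N a)"
    by (intro isCont_tendsto_compose[OF isCont_lnq] tendsto_intros m)
  from tendsto_mult[OF m this] show ?thesis by (simp add: KL_eq N exp_law_clip)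
qed

lemma (in law_statistic) representation:
  obtains \<mu> A where "0 < A" "real_distribution \<mu>" "AE x in \<mu>. x \<in> {- A..A}"
    "\<And>N. exp_law N \<Longrightarrow> \<phi> N = (\<integral>a. KL N a \<partial>\<mu>)"
proof -
  obtain \<mu> A where \<mu>: "0 < A" "real_distribution \<mu>" "AE x in \<mu>. x \<in> {- A..A}"
    "\<And>N. bounded_law N \<Longrightarrow> \<phi> N = (\<integral>a. KL N a \<partial>\<mu>)"
    by (rule bounded_representation) blast
  interpret \<mu>: real_distribution \<mu> by (rule \<mu>(2))
  show ?thesis
  proof (rule that[OF \<mu>(1-3)])
    fix N assume N: "exp_law N"
    have [simp, measurable_cong]: "sets N = sets borel" by (rule exp_lawD[OF N])
    have meas: "KL P \<in> borel_measurable \<mu>" if "exp_law P" for P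
      using borel_measurable_continuous_onI[OF continuous_on_KL[OF that]] by simp
    \<comment> \<open>One bound for all truncations and all a in [-A, A], because clipping does not
      increase |x|; it permits dominated convergence in the parameter a.\<close>
    let ?C = "\<integral>x. exp ((A + 1) * \<bar>x\<bar>) \<partial>N"
    have bound: "\<bar>KL (trunc n N) a\<bar> \<le> ?C" if "a \<in> {- A..A}" for n a
    proof -
      have "\<bar>KL (trunc n N) a\<bar> \<le> (\<integral>x. exp ((A + 1) * \<bar>x\<bar>) \<partial>trunc n N)"
        using that by (intro abs_KL_le exp_law_clip N) auto
      also have "\<dots> = (\<integral>x. exp ((A + 1) * \<bar>clip (real n) x\<bar>) \<partial>N)" by (rule integral_distr) auto
      also have "\<dots> \<le> ?C"
      proof (rule integral_mono)
        have "integrable (trunc n N) (\<lambda>x. exp ((A + 1) * \<bar>x\<bar>))"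
          by (rule exp_law_integrable_exp_abs[OF exp_law_clip[OF N]]) simp
        then show "integrable N (\<lambda>x. exp ((A + 1) * \<bar>clip (real n) x\<bar>))"
          by (simp add: integrable_distr_eq)
      qed (use \<mu>(1) in \<open>auto intro!: exp_law_integrable_exp_abs N mult_left_mono abs_clip_le\<close>)
      finally show ?thesis .
    qed
    have "(\<lambda>n. \<integral>a. KL (trunc n N) a \<partial>\<mu>) \<longlonglongrightarrow> (\<integral>a. KL N a \<partial>\<mu>)"
    proof (rule integral_dominated_convergence[where w = "\<lambda>_. ?C"])
      show "AE a in \<mu>. norm (KL (trunc n N) a) \<le> ?C" for n
        using \<mu>(3) by eventually_elim (simp only: real_norm_def, rule bound)
    qed (auto intro!: meas N exp_law_clip KL_clip_tendsto)
    moreover have "(\<integral>a. KL (trunc n N) a \<partial>\<mu>) = \<phi> (trunc n N)" for n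
      by (rule \<mu>(4)[symmetric], rule bounded_law_clip) (auto simp: N)
    ultimately show "\<phi> N = (\<integral>a. KL N a \<partial>\<mu>)"
      using LIMSEQ_unique[OF clip_tendsto[OF N]] by simp
  qed
qed

text \<open>Replaces the topological support by an interval of full measure, the form in which
  integrals use it.\<close>

lemma compactly_supported_prob_iff:
  "compactly_supported_prob \<mu> \<longleftrightarrow> real_distribution \<mu> \<and> (\<exists>A\<ge>0. AE x in \<mu>. x \<in> {- A..A})"
proof
  assume \<mu>: "compactly_supported_prob \<mu>"
  then interpret prob_space \<mu> by (simp add: compactly_supported_prob_def)
  have [simp, measurable_cong]: "sets \<mu> = sets borel" using \<mu> by (simp add: compactly_supported_prob_def)
  obtain \<B> :: "real set set" where \<B>: "countable \<B>" "topological_basis \<B>"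
    using ex_countable_basis by blast
  \<comment> \<open>A point outside the support has a null basic neighbourhood; as the basis is
    countable, all of these together are still null.\<close>
  let ?N = "{B\<in>\<B>. emeasure \<mu> B = 0}"
  have "\<Union>?N \<in> null_sets \<mu>"
  proof -
    have "(\<Union>B\<in>?N. B) \<in> null_sets \<mu>"
    proof (rule null_sets_UN')
      show "countable ?N" using \<B>(1) by (rule countable_subset[rotated]) auto
      show "B \<in> null_sets \<mu>" if "B \<in> ?N" for B
        using that topological_basis_open[OF \<B>(2), of B] by (auto simp: null_sets_def)
    qed
    then show ?thesis by simp
  qed
  then have "AE x in \<mu>. x \<notin> \<Union>?N" by (rule AE_not_in)
  moreover have "x \<in> msupport \<mu>" if "x \<notin> \<Union>?N" for x
    unfolding msupport_def
  proof (intro CollectI allI impI, elim conjE)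
    fix U assume U: "open U" "x \<in> U"
    then obtain B where B: "B \<in> \<B>" "x \<in> B" "B \<subseteq> U"
      using topological_basisE[OF \<B>(2)] by blast
    then have "0 < emeasure \<mu> B" using that by (auto simp: zero_less_iff_neq_zero)
    also have "\<dots> \<le> emeasure \<mu> U" using B U by (intro emeasure_mono) auto
    finally show "0 < emeasure \<mu> U" .
  qed
  ultimately have supp: "AE x in \<mu>. x \<in> msupport \<mu>" by (auto elim: eventually_mono)
  have "bounded (msupport \<mu>)" using \<mu> by (auto simp: compactly_supported_prob_def intro: compact_imp_bounded)
  then obtain A where A: "\<And>x. x \<in> msupport \<mu> \<Longrightarrow> \<bar>x\<bar> \<le> A" by (auto simp: bounded_iff)
  have "AE x in \<mu>. x \<in> {- max 0 A..max 0 A}"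
    using supp by eventually_elim (use A in force)
  moreover have "real_distribution \<mu>" by (simp add: real_distribution_def real_distribution_axioms_def prob_space_axioms)
  ultimately show "real_distribution \<mu> \<and> (\<exists>A\<ge>0. AE x in \<mu>. x \<in> {- A..A})"
    by (intro conjI exI[of _ "max 0 A"]) auto
next
  assume "real_distribution \<mu> \<and> (\<exists>A\<ge>0. AE x in \<mu>. x \<in> {- A..A})"
  then obtain A where \<mu>: "real_distribution \<mu>" and A: "AE x in \<mu>. x \<in> {- A..A}" by blast
  interpret real_distribution \<mu> by (rule \<mu>)
  have null: "emeasure \<mu> (- {- A..A}) = 0"
    using A by (subst (asm) AE_iff_null) (auto simp: null_sets_def Compl_eq)
  have "open (- msupport \<mu>)"
  proof (subst open_subopen, intro ballI)
    fix x assume "x \<in> - msupport \<mu>"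
    then obtain U where "open U" "x \<in> U" "emeasure \<mu> U = 0" by (auto simp: msupport_def zero_less_iff_neq_zero)
    then show "\<exists>T. open T \<and> x \<in> T \<and> T \<subseteq> - msupport \<mu>"
      by (intro exI[of _ U]) (auto simp: msupport_def)
  qed
  then have "closed (msupport \<mu>)" by (simp add: closed_def)
  moreover have "msupport \<mu> \<subseteq> {- A..A}"
  proof
    fix x assume x: "x \<in> msupport \<mu>"
    show "x \<in> {- A..A}"
    proof (rule ccontr)
      assume "x \<notin> {- A..A}"
      moreover have "open (- {- A..A})" by (intro open_Compl closed_atLeastAtMost)
      ultimately have "0 < emeasure \<mu> (- {- A..A})" using x unfolding msupport_def by blast
      with null show False by simp
    qed
  qed
  ultimately have "compact (msupport \<mu>)"
    using bounded_subset[OF bounded_closed_interval] by (auto simp: compact_eq_bounded_closed)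
  then show "compactly_supported_prob \<mu>"
    by (simp add: compactly_supported_prob_def prob_space_axioms)
qed

section \<open>From laws back to random variables\<close>

context nonatomic_prob_space
begin

lemma L_M_iff: "X \<in> L_M M \<longleftrightarrow> X \<in> borel_measurable M \<and> exp_law (distr M borel X)"
proof (cases "X \<in> borel_measurable M")
  case True
  then have [measurable]: "X \<in> borel_measurable M" .
  have e: "exp_law (distr M borel X) \<longleftrightarrow> (\<forall>a. integrable M (\<lambda>\<omega>. exp (a * X \<omega>)))"
    using prob_space_distr[OF True] by (simp add: exp_law_def integrable_distr_eq)
  show ?thesis
  proof
    assume "X \<in> L_M M"
    then have "integrable M (\<lambda>\<omega>. exp (a * X \<omega>))" for a
      by (cases "a = 0") (auto simp: L_M_def)
    with True e show "X \<in> borel_measurable M \<and> exp_law (distr M borel X)" by blast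
  next
    assume X: "X \<in> borel_measurable M \<and> exp_law (distr M borel X)"
    then have "integrable (distr M borel X) (\<lambda>x. x)" by (intro exp_law_integrable_id) simp
    then have "integrable M X" by (simp add: integrable_distr_eq)
    with X e show "X \<in> L_M M" by (simp add: L_M_def)
  qed
qed (simp add: L_M_def)

lemma K_eq_KL: "X \<in> borel_measurable M \<Longrightarrow> K M a X = KL (distr M borel X) a"
  by (simp add: K_def KL_def integral_distr)

lemma fosd_iff:
  assumes [measurable]: "X \<in> borel_measurable M" "Y \<in> borel_measurable M"
  shows "fosd M X Y \<longleftrightarrow> (\<forall>t. cdf (distr M borel X) t \<le> cdf (distr M borel Y) t)"
  by (simp add: fosd_def cdf_def measure_distr vimage_def Int_def conj_commute)

lemma distr_const: "distr M borel (\<lambda>_. c :: real) = return borel c"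
proof (rule measure_eqI)
  fix A assume "A \<in> sets (distr M borel (\<lambda>_. c))"
  then show "emeasure (distr M borel (\<lambda>_. c)) A = emeasure (return borel c) A"
    by (auto simp: emeasure_distr emeasure_space_1 indicator_def vimage_def)
qed simp

lemma const_in_L_M: "(\<lambda>_. c) \<in> L_M M"
  by (simp add: L_M_iff distr_const)

lemma exp_law_realized:
  assumes "exp_law N1" "exp_law N2"
  obtains X Y where "X \<in> L_M M" "Y \<in> L_M M" "indep_var borel X borel Y" "distr M borel X = N1" "distr M borel Y = N2"
proof -
  obtain X Y where "X \<in> borel_measurable M" "Y \<in> borel_measurable M" "indep_var borel X borel Y"
    "distr M borel X = N1" "distr M borel Y = N2"
    using indep_pair_exists assms[THEN exp_law_real_distr] by blast
  with assms that show ?thesis by (simp add: L_M_iff)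
qed

lemma sum_in_L_M:
  assumes "X \<in> L_M M" "Y \<in> L_M M" "indep_var borel X borel Y"
  shows "(\<lambda>\<omega>. X \<omega> + Y \<omega>) \<in> L_M M" "distr M borel (\<lambda>\<omega>. X \<omega> + Y \<omega>) = (distr M borel X \<star> distr M borel Y)"
proof -
  have [measurable]: "X \<in> borel_measurable M" "Y \<in> borel_measurable M" using assms by (simp_all add: L_M_iff)
  show eq: "distr M borel (\<lambda>\<omega>. X \<omega> + Y \<omega>) = (distr M borel X \<star> distr M borel Y)"
    using assms by (intro sum_indep_random_variable) (auto simp: L_M_iff)
  show "(\<lambda>\<omega>. X \<omega> + Y \<omega>) \<in> L_M M"
    using assms exp_law_convolution by (simp add: L_M_iff eq)
qed

text \<open>\<phi> evaluates \<Phi> at a chosen variable with the given law, and law invariance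
  makes the choice immaterial. Additivity is tested on an independent pair with the two
  laws.\<close>

lemma law_statistic_of_statistic:
  assumes \<Phi>: "monotone_additive_statistic M \<Phi>"
  obtains \<phi> where "law_statistic \<phi>" "\<And>X. X \<in> L_M M \<Longrightarrow> \<Phi> X = \<phi> (distr M borel X)"
proof -
  define \<phi> where "\<phi> N = \<Phi> (SOME X. X \<in> L_M M \<and> distr M borel X = N)" for N
  have law: "\<Phi> X = \<phi> (distr M borel X)" if "X \<in> L_M M" for X
  proof -
    define Y where "Y = (SOME Y. Y \<in> L_M M \<and> distr M borel Y = distr M borel X)"
    have Y: "Y \<in> L_M M \<and> distr M borel Y = distr M borel X"
      unfolding Y_def by (rule someI[of _ X]) (use that in simp)
    have "\<forall>X\<in>L_M M. \<forall>Y\<in>L_M M. distr M borel X = distr M borel Y \<longrightarrow> \<Phi> X = \<Phi> Y"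
      using \<Phi> unfolding monotone_additive_statistic_def statistic_def by blast
    with that Y have "\<Phi> X = \<Phi> Y" by metis
    then show ?thesis by (simp add: \<phi>_def Y_def)
  qed
  have "law_statistic \<phi>"
  proof
    fix N1 N2 assume N: "exp_law N1" "exp_law N2"
    obtain X Y where XY: "X \<in> L_M M" "Y \<in> L_M M" "indep_var borel X borel Y"
      "distr M borel X = N1" "distr M borel Y = N2" using exp_law_realized[OF N] by blast
    have "\<Phi> (\<lambda>\<omega>. X \<omega> + Y \<omega>) = \<Phi> X + \<Phi> Y"
      using \<Phi> XY by (simp add: monotone_additive_statistic_def additive_map_def)
    then show "\<phi> (N1 \<star> N2) = \<phi> N1 + \<phi> N2"
      using XY sum_in_L_M[OF XY(1-3)] by (simp add: law)
    assume "\<And>t. cdf N1 t \<le> cdf N2 t"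
    then have "fosd M X Y" using XY by (subst fosd_iff) (auto simp: L_M_iff)
    then have "\<Phi> Y \<le> \<Phi> X"
      using \<Phi> XY by (simp add: monotone_additive_statistic_def monotone_map_def)
    then show "\<phi> N2 \<le> \<phi> N1" using XY by (simp add: law)
  next
    fix c
    have "\<Phi> (\<lambda>_. c) = c" using \<Phi> unfolding monotone_additive_statistic_def statistic_def by blast
    then show "\<phi> (return borel c) = c" by (simp add: law const_in_L_M distr_const)
  qed
  with law that show ?thesis by blast
qed

lemma representation_exists:
  assumes "monotone_additive_statistic M \<Phi>"
  shows "\<exists>\<mu>. compactly_supported_prob \<mu> \<and> represents M \<mu> \<Phi>"
proof -
  obtain \<phi> where \<phi>: "law_statistic \<phi>" "\<And>X. X \<in> L_M M \<Longrightarrow> \<Phi> X = \<phi> (distr M borel X)"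
    using law_statistic_of_statistic[OF assms] by blast
  interpret law_statistic \<phi> by (rule \<phi>(1))
  obtain \<mu> A where \<mu>: "0 < A" "real_distribution \<mu>" "AE x in \<mu>. x \<in> {- A..A}"
    "\<And>N. exp_law N \<Longrightarrow> \<phi> N = (\<integral>a. KL N a \<partial>\<mu>)"
    by (rule representation) blast
  have "represents M \<mu> \<Phi>"
    unfolding represents_def using \<phi>(2) \<mu>(4) by (simp add: L_M_iff K_eq_KL)
  moreover have "compactly_supported_prob \<mu>"
    using \<mu>(1-3) by (auto simp: compactly_supported_prob_iff intro!: exI[of _ A])
  ultimately show ?thesis by blast
qed

lemma representation_unique:
  assumes \<mu>: "compactly_supported_prob \<mu>" "represents M \<mu> \<Phi>" and \<nu>: "compactly_supported_prob \<nu>" "represents M \<nu> \<Phi>"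
  shows "\<mu> = \<nu>"
proof -
  obtain A B where A: "real_distribution \<mu>" "0 \<le> A" "AE x in \<mu>. x \<in> {- A..A}"
    and B: "real_distribution \<nu>" "0 \<le> B" "AE x in \<nu>. x \<in> {- B..B}"
    using \<mu>(1) \<nu>(1) unfolding compactly_supported_prob_iff by blast
  show ?thesis
  \<comment> \<open>A + B gives one interval that carries both measures.\<close>
  proof (rule representing_measure_unique[of \<mu> "A + B" \<nu>])
    show "AE x in \<mu>. x \<in> {- (A + B)..A + B}" using A(3) by eventually_elim (use A(2) B(2) in auto)
    show "AE x in \<nu>. x \<in> {- (A + B)..A + B}" using B(3) by eventually_elim (use A(2) B(2) in auto)
    fix N assume "bounded_law N"
    then have N: "exp_law N" by (rule bounded_law_exp_law)
    obtain X where X: "X \<in> L_M M" "distr M borel X = N" using exp_law_realized[OF N N] by blast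
    then have KX: "K M a X = KL N a" for a by (simp add: K_eq_KL L_M_iff)
    have "\<Phi> X = (\<integral>a. K M a X \<partial>\<mu>)" "\<Phi> X = (\<integral>a. K M a X \<partial>\<nu>)"
      using X(1) \<mu>(2) \<nu>(2) unfolding represents_def by blast+
    then show "(\<integral>a. KL N a \<partial>\<mu>) = (\<integral>a. KL N a \<partial>\<nu>)" by (simp add: KX)
  qed (use A B in auto)
qed

text \<open>Each K_a is itself monotone and additive, which integration over a preserves; continuity
  in a and the compact range of a make the integrals meaningful.\<close>

lemma represented_is_statistic:
  assumes \<mu>: "compactly_supported_prob \<mu>" "represents M \<mu> \<Phi>"
  shows "monotone_additive_statistic M \<Phi>"
proof -
  obtain A where A: "real_distribution \<mu>" "AE x in \<mu>. x \<in> {- A..A}"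
    using \<mu>(1) unfolding compactly_supported_prob_iff by blast
  interpret \<mu>: real_distribution \<mu> by (rule A(1))
  have \<Phi>: "\<Phi> X = (\<integral>a. KL (distr M borel X) a \<partial>\<mu>)" if "X \<in> L_M M" for X
    using \<mu>(2) that by (simp add: represents_def K_eq_KL L_M_iff)
  have int: "integrable \<mu> (KL N)" if "exp_law N" for N
    by (rule integrable_continuous_compact_support[OF A continuous_on_KL[OF that]])
  have "statistic M \<Phi>"
    unfolding statistic_def
    using \<mu>.prob_space by (auto simp: \<Phi> const_in_L_M distr_const)
  moreover have "monotone_map M \<Phi>"
    unfolding monotone_map_def
  proof (intro ballI impI)
    fix X Y assume XY: "X \<in> L_M M" "Y \<in> L_M M" and "fosd M X Y"
    then have el: "exp_law (distr M borel X)" "exp_law (distr M borel Y)"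
      and le: "cdf (distr M borel X) t \<le> cdf (distr M borel Y) t" for t
      by (auto simp: L_M_iff fosd_iff)
    have "KL (distr M borel Y) a \<le> KL (distr M borel X) a" for a
      using mexp_mono[OF el le] by (simp add: KL_le_iff el)
    then show "\<Phi> Y \<le> \<Phi> X"
      unfolding \<Phi>[OF XY(1)] \<Phi>[OF XY(2)] by (intro integral_mono int el) auto
  qed
  moreover have "additive_map M \<Phi>"
    unfolding additive_map_def
  proof (intro ballI impI)
    fix X Y assume XY: "X \<in> L_M M" "Y \<in> L_M M" "indep_var borel X borel Y"
    then have el: "exp_law (distr M borel X)" "exp_law (distr M borel Y)" by (auto simp: L_M_iff)
    show "\<Phi> (\<lambda>\<omega>. X \<omega> + Y \<omega>) = \<Phi> X + \<Phi> Y"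
      unfolding \<Phi>[OF XY(1)] \<Phi>[OF XY(2)] \<Phi>[OF sum_in_L_M(1)[OF XY]] sum_in_L_M(2)[OF XY]
      unfolding KL_convolution[OF el, abs_def]
      by (rule Bochner_Integration.integral_add[OF int[OF el(1)] int[OF el(2)]])
  qed
  ultimately show ?thesis by (simp add: monotone_additive_statistic_def)
qed

end

theorem theorem2:
  fixes M :: "'a measure" and \<Phi> :: "('a \<Rightarrow> real) \<Rightarrow> real"
  assumes "prob_space M" and "nonatomic M"
  shows "(monotone_additive_statistic M \<Phi> \<longleftrightarrow>
            (\<exists>\<mu>. compactly_supported_prob \<mu> \<and> represents M \<mu> \<Phi>)) \<and>
         (monotone_additive_statistic M \<Phi> \<longrightarrow>
            (\<exists>!\<mu>. compactly_supported_prob \<mu> \<and> represents M \<mu> \<Phi>))"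
proof -
  interpret nonatomic_prob_space M
    using assms by (simp add: nonatomic_prob_space_def nonatomic_prob_space_axioms_def)
  show ?thesis
    using representation_exists representation_unique represented_is_statistic by metis
qed

end
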